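(* Consider the uniform approximation problem $\mathrm{id}_d\colon\mathcal{H}_d^\gamma\to L_\infty([0,1]^d)$, $f\mapsto f$, $d\in\mathbb{N}$, defined on the sequence of unanchored weighted Sobolev spaces $(\mathcal{H}_d^\gamma)_{d\in\mathbb{N}}$, where the product weights $\gamma$ are constructed out of uniformly bounded generators $C_\gamma\ge\gamma_{d,1}\ge\cdots\ge\gamma_{d,d}>0$, $d\in\mathbb{N}$ (with $C_\gamma$ independent of $d$). Study this problem in the worst case setting and with respect to the absolute error criterion. Then we have - polynomial tractability if and only if $q(\gamma)<1$, and - strong polynomial tractability if and only if $p(\gamma)<1$.
   Context: Unanchored Sobolev space: for $\gamma>0$, $\mathcal{H}_1^\gamma$ is the space of absolutely continuous $f\colon[0,1]\to\mathbb{R}$ with $f'\in L_2([0,1])$ and inner product $\langle f,g\rangle=\langle f,g\rangle_{L_2([0,1])}+\gamma^{-1}\langle f',g'\rangle_{L_2([0,1])}$. For $d\in\mathbb{N}$, $\mathcal{H}_d^\gamma=\bigotimes_{k=1}^d\mathcal{H}_1^{\gamma_{d,k}}$ (Hilbert space tensor product), so that $\|f\mid\mathcal{H}_d^\gamma\|^2=\sum_{\boldsymbol\alpha\in\{0,1\}^d}\frac1{\gamma_{\boldsymbol\alpha}}\int_{[0,1]^d}|D^{\boldsymbol\alpha}f(\boldsymbol x)|^2\,d\boldsymbol x$ with $\gamma_{\boldsymbol\alpha}=\prod_{j=1}^d(\gamma_{d,j})^{\alpha_j}$. Sum exponents: $p(\gamma)=\inf\{\kappa\ge0\mid\limsup_{d\to\infty}\sum_{j=1}^d(\gamma_{d,j})^\kappa<\infty\}$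 and $q(\gamma)=\inf\{\kappa\ge0\mid\limsup_{d\to\infty}\sum_{j=1}^d(\gamma_{d,j})^\kappa/\ln(d+1)<\infty\}$, with $\inf\emptyset=\infty$. Worst case setting: $e(n,d)=\inf_A\sup_{\|f\mid\mathcal{H}_d^\gamma\|\le1}\|f-Af\mid L_\infty([0,1]^d)\|$, the infimum over linear algorithms $Af=\sum_{j=1}^nL_j(f)g_j$ with continuous linear functionals $L_j$ on $\mathcal{H}_d^\gamma$ and $g_j\in L_\infty([0,1]^d)$; $n(\varepsilon,d)=\min\{n\in\mathbb{N}_0\mid e(n,d)\le\varepsilon\}$. Polynomial tractability: there are $C,p>0$, $q\ge0$ with $n(\varepsilon,d)\le C\varepsilon^{-p}d^q$ for all $\varepsilon\in(0,1]$, $d\in\mathbb{N}$; strong polynomial tractability: this holds with $q=0$. *)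

theory Defs
  imports "HOL-Probability.Probability"
begin

section \<open>The univariate unanchored Sobolev space\<close>

definition abs_continuous_on :: "real set \<Rightarrow> (real \<Rightarrow> real) \<Rightarrow> bool" where
  "abs_continuous_on S f \<longleftrightarrow>
     (\<forall>\<epsilon>>0. \<exists>\<delta>>0. \<forall>P :: (real \<times> real) set.
        finite P \<and> (\<forall>(a, b)\<in>P. a \<le> b \<and> {a..b} \<subseteq> S) \<and>
        disjoint_family_on (\<lambda>(a, b). {a<..<b}) P \<and> (\<Sum>(a, b)\<in>P. b - a) < \<delta>
        \<longrightarrow> (\<Sum>(a, b)\<in>P. \<bar>f b - f a\<bar>) < \<epsilon>)"

text \<open>
  A function on the unit interval is represented by any function on the real line extending it;
  nothing below depends on the values outside the interval. The differentiability clause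
  is automatic for absolutely continuous functions (Lebesgue). It is spelled out because
  \<^const>\<open>deriv\<close> is a total operator.
\<close>

definition sobolev1 :: "(real \<Rightarrow> real) set" where
  "sobolev1 = {f. abs_continuous_on {0..1} f \<and>
     (AE x in lebesgue_on {0..1}. f differentiable (at x)) \<and>
     deriv f \<in> borel_measurable (lebesgue_on {0..1}) \<and>
     integrable (lebesgue_on {0..1}) (\<lambda>x. (deriv f x)\<^sup>2)}"

definition sobolev1_inner :: "real \<Rightarrow> (real \<Rightarrow> real) \<Rightarrow> (real \<Rightarrow> real) \<Rightarrow> real" where
  "sobolev1_inner c f g =
     (LINT x|lebesgue_on {0..1}. f x * g x) +
     inverse c * (LINT x|lebesgue_on {0..1}. deriv f x * deriv g x)"


section \<open>Hilbert space tensor products of function spaces\<close>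

text \<open>
  For a nonempty finite index set \<open>I\<close>, an element of the algebraic tensor product of spaces
  \<open>H k\<close> of functions on \<open>D\<close> is a finite sum of elementary tensors; it is represented by the list
  of its summands, each given by its factors \<open>s k \<in> H k\<close>. (Scalars are absorbed into a factor.)
\<close>

definition tensor_fun :: "'i set \<Rightarrow> ('i \<Rightarrow> 'a \<Rightarrow> real) list \<Rightarrow> ('i \<Rightarrow> 'a) \<Rightarrow> real" where
  "tensor_fun I S x = (\<Sum>s\<leftarrow>S. \<Prod>k\<in>I. s k (x k))"

definition tensor_inner ::
  "'i set \<Rightarrow> ('i \<Rightarrow> 'h \<Rightarrow> 'h \<Rightarrow> real) \<Rightarrow> ('i \<Rightarrow> 'h) list \<Rightarrow> ('i \<Rightarrow> 'h) list \<Rightarrow> real" where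
  "tensor_inner I ip S T = (\<Sum>s\<leftarrow>S. \<Sum>t\<leftarrow>T. \<Prod>k\<in>I. ip k (s k) (t k))"

text \<open>
  Squared norm of the difference of two elements, expanded by bilinearity.
\<close>

definition tensor_dist2 ::
  "'i set \<Rightarrow> ('i \<Rightarrow> 'h \<Rightarrow> 'h \<Rightarrow> real) \<Rightarrow> ('i \<Rightarrow> 'h) list \<Rightarrow> ('i \<Rightarrow> 'h) list \<Rightarrow> real" where
  "tensor_dist2 I ip S T =
     tensor_inner I ip S S - 2 * tensor_inner I ip S T + tensor_inner I ip T T"

text \<open>
  The completion of the algebraic tensor product is realised as a space of functions on the
  product domain: when point evaluations on each \<open>H k\<close> are continuous, Cauchy sequences
  converge pointwise, and an element of the completion is identified with the pointwise limit
  of the Cauchy sequences representing it.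
\<close>

definition tensor_represents ::
  "'i set \<Rightarrow> 'a set \<Rightarrow> ('i \<Rightarrow> ('a \<Rightarrow> real) set) \<Rightarrow> ('i \<Rightarrow> ('a \<Rightarrow> real) \<Rightarrow> ('a \<Rightarrow> real) \<Rightarrow> real) \<Rightarrow>
   (nat \<Rightarrow> ('i \<Rightarrow> 'a \<Rightarrow> real) list) \<Rightarrow> (('i \<Rightarrow> 'a) \<Rightarrow> real) \<Rightarrow> bool" where
  "tensor_represents I D H ip X f \<longleftrightarrow>
     (\<forall>n. \<forall>s\<in>set (X n). \<forall>k\<in>I. s k \<in> H k) \<and>
     (\<forall>\<epsilon>>0. \<exists>N. \<forall>m\<ge>N. \<forall>n\<ge>N. tensor_dist2 I ip (X m) (X n) < \<epsilon>) \<and>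
     (\<forall>x \<in> I \<rightarrow>\<^sub>E D. (\<lambda>n. tensor_fun I (X n) x) \<longlonglongrightarrow> f x)"

definition hilbert_tensor ::
  "'i set \<Rightarrow> 'a set \<Rightarrow> ('i \<Rightarrow> ('a \<Rightarrow> real) set) \<Rightarrow> ('i \<Rightarrow> ('a \<Rightarrow> real) \<Rightarrow> ('a \<Rightarrow> real) \<Rightarrow> real) \<Rightarrow>
   (('i \<Rightarrow> 'a) \<Rightarrow> real) set" where
  "hilbert_tensor I D H ip = {f. \<exists>X. tensor_represents I D H ip X f}"

text \<open>
  The norm is the limit of the norms along a representing sequence. All sequences representing
  \<open>f\<close> have the same limit, so the infimum below is taken over a singleton.
\<close>

definition hilbert_tensor_norm ::
  "'i set \<Rightarrow> 'a set \<Rightarrow> ('i \<Rightarrow> ('a \<Rightarrow> real) set) \<Rightarrow> ('i \<Rightarrow> ('a \<Rightarrow> real) \<Rightarrow> ('a \<Rightarrow> real) \<Rightarrow> real) \<Rightarrow>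
   (('i \<Rightarrow> 'a) \<Rightarrow> real) \<Rightarrow> real" where
  "hilbert_tensor_norm I D H ip f =
     Inf {r. \<exists>X. tensor_represents I D H ip X f \<and>
                (\<lambda>n. sqrt (tensor_inner I ip (X n) (X n))) \<longlonglongrightarrow> r}"


section \<open>The weighted multivariate spaces\<close>

definition sobolev :: "(nat \<Rightarrow> nat \<Rightarrow> real) \<Rightarrow> nat \<Rightarrow> ((nat \<Rightarrow> real) \<Rightarrow> real) set" where
  "sobolev \<gamma> d = hilbert_tensor {1..d} {0..1} (\<lambda>k. sobolev1) (\<lambda>k. sobolev1_inner (\<gamma> d k))"

definition sobolev_norm :: "(nat \<Rightarrow> nat \<Rightarrow> real) \<Rightarrow> nat \<Rightarrow> ((nat \<Rightarrow> real) \<Rightarrow> real) \<Rightarrow> real" where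
  "sobolev_norm \<gamma> d =
     hilbert_tensor_norm {1..d} {0..1} (\<lambda>k. sobolev1) (\<lambda>k. sobolev1_inner (\<gamma> d k))"

definition cube_measure :: "nat \<Rightarrow> (nat \<Rightarrow> real) measure" where
  "cube_measure d = PiM {1..d} (\<lambda>k. restrict_space lborel {0..1})"


section \<open>Worst case uniform approximation\<close>

definition Linf_norm :: "'x measure \<Rightarrow> ('x \<Rightarrow> real) \<Rightarrow> ereal" where
  "Linf_norm M f = esssup M (\<lambda>x. ereal \<bar>f x\<bar>)"

definition Linf :: "'x measure \<Rightarrow> ('x \<Rightarrow> real) set" where
  "Linf M = {f \<in> borel_measurable M. Linf_norm M f < \<infinity>}"

text \<open>
  Functions agreeing on the cube are not identified in \<^const>\<open>sobolev\<close>, but their difference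
  has norm \<open>0\<close>, so a continuous linear functional takes the same value on them.
\<close>

definition continuous_functionals ::
  "('x \<Rightarrow> real) set \<Rightarrow> (('x \<Rightarrow> real) \<Rightarrow> real) \<Rightarrow> (('x \<Rightarrow> real) \<Rightarrow> real) set" where
  "continuous_functionals H nrm = {L.
     (\<forall>f\<in>H. \<forall>g\<in>H. \<forall>a b. L (\<lambda>x. a * f x + b * g x) = a * L f + b * L g) \<and>
     (\<exists>B. \<forall>f\<in>H. \<bar>L f\<bar> \<le> B * nrm f)}"

definition linear_algorithms ::
  "('x \<Rightarrow> real) set \<Rightarrow> (('x \<Rightarrow> real) \<Rightarrow> real) \<Rightarrow> 'x measure \<Rightarrow> nat \<Rightarrow>
   (('x \<Rightarrow> real) \<Rightarrow> 'x \<Rightarrow> real) set" where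
  "linear_algorithms H nrm M n = {A. \<exists>L g.
     (\<forall>j\<in>{1..n}. L j \<in> continuous_functionals H nrm \<and> g j \<in> Linf M) \<and>
     A = (\<lambda>f x. \<Sum>j=1..n. L j f * g j x)}"

definition minimal_error ::
  "('x \<Rightarrow> real) set \<Rightarrow> (('x \<Rightarrow> real) \<Rightarrow> real) \<Rightarrow> 'x measure \<Rightarrow> nat \<Rightarrow> ereal" where
  "minimal_error H nrm M n =
     (INF A \<in> linear_algorithms H nrm M n.
        SUP f \<in> {f \<in> H. nrm f \<le> 1}. Linf_norm M (\<lambda>x. f x - A f x))"

definition unif_error :: "(nat \<Rightarrow> nat \<Rightarrow> real) \<Rightarrow> nat \<Rightarrow> nat \<Rightarrow> ereal" where
  "unif_error \<gamma> n d = minimal_error (sobolev \<gamma> d) (sobolev_norm \<gamma> d) (cube_measure d) n"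

text \<open>
  The infimum is a minimum if the set is nonempty, and \<open>\<infinity>\<close> otherwise.
\<close>

definition info_complexity :: "(nat \<Rightarrow> nat \<Rightarrow> real) \<Rightarrow> real \<Rightarrow> nat \<Rightarrow> enat" where
  "info_complexity \<gamma> \<epsilon> d = Inf {enat n |n. unif_error \<gamma> n d \<le> ereal \<epsilon>}"

definition polynomially_tractable :: "(real \<Rightarrow> nat \<Rightarrow> enat) \<Rightarrow> bool" where
  "polynomially_tractable N \<longleftrightarrow>
     (\<exists>C>0. \<exists>p>0. \<exists>q\<ge>0. \<forall>\<epsilon>\<in>{0<..1}. \<forall>d\<ge>1.
        ereal_of_enat (N \<epsilon> d) \<le> ereal (C * \<epsilon> powr (- p) * real d powr q))"

definition strongly_polynomially_tractable :: "(real \<Rightarrow> nat \<Rightarrow> enat) \<Rightarrow> bool" where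
  "strongly_polynomially_tractable N \<longleftrightarrow>
     (\<exists>C>0. \<exists>p>0. \<forall>\<epsilon>\<in>{0<..1}. \<forall>d\<ge>1.
        ereal_of_enat (N \<epsilon> d) \<le> ereal (C * \<epsilon> powr (- p)))"


section \<open>Sum exponents\<close>

definition sum_exponent_p :: "(nat \<Rightarrow> nat \<Rightarrow> real) \<Rightarrow> ereal" where
  "sum_exponent_p \<gamma> = Inf {ereal \<kappa> |\<kappa>. \<kappa> \<ge> 0 \<and>
     limsup (\<lambda>d. ereal (\<Sum>j=1..d. \<gamma> d j powr \<kappa>)) < \<infinity>}"

definition sum_exponent_q :: "(nat \<Rightarrow> nat \<Rightarrow> real) \<Rightarrow> ereal" where
  "sum_exponent_q \<gamma> = Inf {ereal \<kappa> |\<kappa>. \<kappa> \<ge> 0 \<and>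
     limsup (\<lambda>d. ereal ((\<Sum>j=1..d. \<gamma> d j powr \<kappa>) / ln (real d + 1))) < \<infinity>}"

end

theory Submission
  imports Defs
begin

text \<open>
  The functions \<open>1\<close> and \<open>sqrt 2 * cos (m \<pi> x)\<close> are orthonormal in the univariate \<open>L\<^sub>2\<close> space and, by
  integration by parts against an absolutely continuous function, orthogonal in the Sobolev space
  with squared norms \<open>1 + (m \<pi>)\<^sup>2 / \<gamma>\<close>. Their tensor products therefore diagonalise the problem with
  singular values \<open>\<lambda>\<^sub>\<kappa>\<close>, the inverses of products of these numbers.

  Upper bound: truncate the tensor cosine series to the multi-indices with \<open>\<mu>\<^sub>\<kappa> > \<delta>\<close>, where
  \<open>\<mu>\<^sub>\<kappa>\<close> is \<open>\<lambda>\<^sub>\<kappa>\<close> multiplied by 2 for each nonzero frequency. By Bessel's inequality and Cauchy-Schwarz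
  the squared uniform error is at most the sum of the discarded \<open>\<mu>\<^sub>\<kappa>\<close>, which for \<open>1/2 < \<tau> < 1\<close> is at
  most \<open>\<delta> powr (1 - \<tau>)\<close> times \<open>\<Sum>\<^sub>\<kappa> \<mu>\<^sub>\<kappa> powr \<tau> \<le> \<Prod>\<^sub>j (1 + Z \<gamma>\<^sub>j powr \<tau>)\<close>, while the number of retained
  indices is at most this sum times \<open>\<delta> powr (- \<tau>)\<close>.

  Lower bound: if \<open>n\<close> functionals achieve error \<open>\<epsilon>\<close>, the functions annihilated by them are bounded by
  \<open>\<epsilon>\<close> pointwise; integrating the squared norm of the evaluation functional on this kernel shows that
  at most \<open>n + O(\<epsilon>\<^sup>2 / \<delta>)\<close> of the \<open>\<lambda>\<^sub>\<kappa>\<close> exceed \<open>\<delta>\<close>. Choosing \<open>\<epsilon>\<close> as a suitable power of \<open>\<delta>\<close> turns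
  polynomial complexity into a bound on \<open>\<Sum>\<^sub>\<kappa> \<lambda>\<^sub>\<kappa> powr \<tau> = \<Prod>\<^sub>j (1 + t\<^sub>j powr \<tau>)\<close> over \<open>\<kappa> \<in> {0, 1}\<^sup>d\<close> with some
  \<open>\<tau> < 1\<close>, and \<open>t\<^sub>j\<close> is comparable to \<open>\<gamma>\<^sub>j\<close> because the weights are bounded.
\<close>

subsection \<open>Absolutely continuous functions\<close>

text \<open>
  In the Riemann sums, the tags outside \<open>N\<close> are handled by differentiability; those in \<open>N\<close> are forced
  by the gauge into an open set of small measure, where absolute continuity applies.
\<close>

lemma AC_ftc:
  fixes f g :: "real \<Rightarrow> real"
  assumes ab: "a \<le> b" and ac: "abs_continuous_on {a..b} f" and N: "negligible N"
    and deriv: "\<And>x. x \<in> {a..b} - N \<Longrightarrow> (f has_real_derivative g x) (at x)"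
    and zero: "\<And>x. x \<in> N \<Longrightarrow> g x = 0"
  shows "(g has_integral (f b - f a)) {a..b}"
proof -
  have "\<exists>\<gamma>. gauge \<gamma> \<and> (\<forall>p. p tagged_division_of cbox a b \<and> \<gamma> fine p \<longrightarrow>
      norm ((\<Sum>(x, k)\<in>p. measure lborel k *\<^sub>R g x) - (f b - f a)) < e)" if e0: "e > 0" for e
  proof -
    \<comment> \<open>The \<open>+ 1\<close> keeps the denominator positive when
      \<open>a = b\<close> and makes \<open>e' * (b - a) < e / 2\<close> strict.\<close>
    define e' where "e' = e / (2 * (b - a + 1))"
    have e': "e' > 0" using that ab by (simp add: e'_def)
    have "\<forall>x. \<exists>d>0. x \<in> {a..b} - N \<longrightarrow>
         (\<forall>y. norm (y-x) < d \<longrightarrow> norm (f y - f x - g x * (y-x)) \<le> e' * norm (y-x))"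
    proof
      fix x
      show "\<exists>d>0. x \<in> {a..b} - N \<longrightarrow>
         (\<forall>y. norm (y-x) < d \<longrightarrow> norm (f y - f x - g x * (y-x)) \<le> e' * norm (y-x))"
      proof (cases "x \<in> {a..b} - N")
        case True
        from deriv[OF this] have "(f has_derivative (*) (g x)) (at x)"
          by (simp add: has_field_derivative_def)
        then show ?thesis
          using e' unfolding has_derivative_at_alt by metis
      next
        case False
        then show ?thesis by (intro exI[of _ 1]) auto
      qed
    qed
    then obtain d where d: "\<And>x. 0 < d x"
      "\<And>x y. \<lbrakk>x \<in> {a..b} - N; norm (y-x) < d x\<rbrakk>
           \<Longrightarrow> norm (f y - f x - g x * (y-x)) \<le> e' * norm (y-x)"
      by metis
    obtain \<delta> where \<delta>: "\<delta> > 0" and ac\<delta>: "\<forall>P. finite P \<and> (\<forall>(u, v)\<in>P. u \<le> v \<and> {u..v} \<subseteq> {a..b}) \<and>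
        disjoint_family_on (\<lambda>(u, v). {u<..<v}) P \<and> (\<Sum>(u, v)\<in>P. v - u) < \<delta>
        \<longrightarrow> (\<Sum>(u, v)\<in>P. \<bar>f v - f u\<bar>) < e / 2"
      using ac[unfolded abs_continuous_on_def, THEN spec, THEN mp, OF half_gt_zero[OF e0]] by (elim exE conjE)
    have Nsets: "N \<in> sets lebesgue" and Nnull: "N \<in> null_sets lebesgue"
      using N by (auto simp: negligible_iff_null_sets)
    obtain T where T: "open T" "N \<subseteq> T" "T - N \<in> lmeasurable" "emeasure lebesgue (T - N) < ennreal \<delta>"
      using sets_lebesgue_outer_open[OF Nsets \<delta>] by metis
    have Tm: "T \<in> lmeasurable"
      using fmeasurable.Un[OF T(3) negligible_imp_measurable[OF N]] T(2) by (simp add: Un_absorb2)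
    have "measure lebesgue T = measure lebesgue (T - N)"
      using Nnull Tm by (simp add: measure_Diff_null_set fmeasurableD)
    also have "\<dots> < \<delta>"
      using T(4) \<delta> by (metis T(3) emeasure_eq_measure2 ennreal_less_iff measure_nonneg)
    finally have Tless: "measure lebesgue T < \<delta>" .
    have "\<forall>x. \<exists>r>0. x \<in> T \<longrightarrow> ball x r \<subseteq> T"
      using T(1) by (meson open_contains_ball zero_less_one)
    then obtain r where r: "\<And>x. r x > 0" "\<And>x. x \<in> T \<Longrightarrow> ball x (r x) \<subseteq> T"
      by metis
    \<comment> \<open>The radius \<open>d x\<close> serves the tags outside \<open>N\<close>;
      \<open>r x\<close> confines the intervals tagged in \<open>N\<close> to the small open set
      \<open>T\<close>.\<close>
    define \<gamma> where "\<gamma> = (\<lambda>x. ball x (min (d x) (r x)))"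
    have gauge: "gauge \<gamma>"
      unfolding \<gamma>_def using d(1) r(1) by (intro gauge_ball_dependent) auto
    show ?thesis
    proof (intro exI[of _ \<gamma>] conjI gauge allI impI)
      fix p assume "p tagged_division_of cbox a b \<and> \<gamma> fine p"
      then have ptag: "p tagged_division_of cbox a b" and fine: "\<gamma> fine p" by auto
      have finp: "finite p" using ptag by blast
      have ba: "b - a = (\<Sum>(x,K)\<in>p. Sup K - Inf K)" "f b - f a = (\<Sum>(x,K)\<in>p. f(Sup K) - f(Inf K))"
        using additive_tagged_division_1[where f= "\<lambda>x. x"] additive_tagged_division_1[where f= f]
            ab ptag by auto
      have K: "\<exists>u v. K = {u..v} \<and> u \<le> v \<and> Inf K = u \<and> Sup K = v \<and> x \<in> K \<and> K \<subseteq> {a..b} \<and> K \<subseteq> \<gamma> x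
          \<and> measure lborel K = v - u"
        if "(x, K) \<in> p" for x K
      proof -
        have "x \<in> K" "K \<subseteq> cbox a b" "\<exists>u v. K = cbox u v"
          using ptag that by (blast dest: tagged_division_ofD)+
        moreover have "K \<subseteq> \<gamma> x" using fine that by (auto simp: fine_def)
        ultimately show ?thesis by fastforce
      qed
      define p1 where "p1 = {(x,K)\<in>p. x \<in> N}"
      define p2 where "p2 = {(x,K)\<in>p. x \<notin> N}"
      have p12: "p = p1 \<union> p2" "p1 \<inter> p2 = {}" "finite p1" "finite p2"
        using finp by (auto simp: p1_def p2_def intro: finite_subset)
      define h where "h = (\<lambda>K::real set. (Inf K, Sup K))"
      define P where "P = (h \<circ> snd) ` p1"
      have S2: "norm (\<Sum>(x,K)\<in>p2. measure lborel K *\<^sub>R g x - (f(Sup K) - f(Inf K))) \<le> (\<Sum>(x,K)\<in>p2. e' * (Sup K - Inf K))"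
        unfolding case_prod_unfold
      proof (rule sum_norm_le)
        fix z assume z: "z \<in> p2"
        obtain x K where xK: "z = (x, K)" by (cases z)
        with z have xp: "(x,K) \<in> p" and xN: "x \<notin> N" by (auto simp: p2_def)
        from K[OF xp] obtain u v where uv: "K = {u..v}" "u \<le> v" "x \<in> K" "K \<subseteq> {a..b}" "K \<subseteq> \<gamma> x" by blast
        have xab: "x \<in> {a..b} - N" using uv xN by auto
        have "u \<in> \<gamma> x" "v \<in> \<gamma> x" using uv by auto
        then have "norm (f u - f x - g x * (u-x)) \<le> e' * norm (u-x)" "norm (f v - f x - g x * (v-x)) \<le> e' * norm (v-x)"
          using d(2)[OF xab] by (auto simp: \<gamma>_def dist_real_def abs_minus_commute)
        moreover have "u \<le> x" "x \<le> v" using uv by auto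
        ultimately have "\<bar>(v - u) * g x - (f v - f u)\<bar> \<le> e' * (x - u) + e' * (v - x)"
          by (simp add: algebra_simps)
        then show "norm (measure lborel (snd z) *\<^sub>R g (fst z) - (f (Sup (snd z)) - f (Inf (snd z)))) \<le> e' * (Sup (snd z) - Inf (snd z))"
          using uv xK by (simp add: algebra_simps)
      qed
      also have "\<dots> \<le> (\<Sum>(x,K)\<in>p. e' * (Sup K - Inf K))"
        using finp p12 K e' by (intro sum_mono2) (fastforce simp: zero_le_mult_iff)+
      also have "\<dots> = e' * (b - a)"
        unfolding ba(1) sum_distrib_left by (simp add: case_prod_unfold)
      also have "\<dots> < e / 2"
        using that ab by (simp add: e'_def field_simps)
      finally have B2: "norm (\<Sum>(x,K)\<in>p2. measure lborel K *\<^sub>R g x - (f(Sup K) - f(Inf K))) < e / 2" .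
      have p1zero: "measure lborel K *\<^sub>R g x - (f(Sup K) - f(Inf K)) = - (f(Sup K) - f(Inf K))" if "(x,K) \<in> p1" for x K
        using that zero by (auto simp: p1_def)
      have disj: "interior K \<inter> interior K' = {}" if "(x,K) \<in> p" "(x',K') \<in> p" "(x,K) \<noteq> (x',K')" for x K x' K'
        using tagged_division_ofD(5)[OF ptag that] .
      have S1: "(\<Sum>(x,K)\<in>p1. \<bar>f(Sup K) - f(Inf K)\<bar>) = (\<Sum>(u,v)\<in>P. \<bar>f v - f u\<bar>)"
      proof -
        \<comment> \<open>The map from tagged pairs to end points need not be injective, but two
          different pairs with the same interval have disjoint interiors. The interval is then a
          single point, and its summand is 0.\<close>
        have "sum (\<lambda>(u,v). \<bar>f v - f u\<bar>) P = sum ((\<lambda>(u,v). \<bar>f v - f u\<bar>) \<circ> (h \<circ> snd)) p1"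
          unfolding P_def
        proof (rule sum.reindex_nontrivial[OF p12(3)])
          fix z z' assume zz: "z \<in> p1" "z' \<in> p1" "z \<noteq> z'" "(h \<circ> snd) z = (h \<circ> snd) z'"
          obtain x K x' K' where xK: "z = (x, K)" "z' = (x', K')" by (cases z, cases z')
          with zz have xp: "(x,K) \<in> p" "(x',K') \<in> p" "(x,K) \<noteq> (x',K')" by (auto simp: p1_def)
          obtain u v where uv: "K = {u..v}" "u \<le> v" using K[OF xp(1)] by blast
          obtain u' v' where uv': "K' = {u'..v'}" "u' \<le> v'" using K[OF xp(2)] by blast
          have "u = u'" "v = v'" using zz(4) uv uv' by (auto simp: h_def xK)
          then have "u = v" using disj[OF xp] uv uv' by (auto simp: interior_atLeastAtMost_real)
          then show "(\<lambda>(u,v). \<bar>f v - f u\<bar>) ((h \<circ> snd) z) = 0"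
            using uv xK by (simp add: h_def)
        qed
        then show ?thesis by (simp add: h_def o_def case_prod_unfold)
      qed
      have div: "snd ` p1 division_of \<Union>(snd ` p1)"
      proof (rule division_ofI)
        show "finite (snd ` p1)" using p12 by auto
        fix K assume "K \<in> snd ` p1"
        then obtain x where xp: "(x,K) \<in> p" by (auto simp: p1_def)
        show "K \<subseteq> \<Union> (snd ` p1)" using \<open>K \<in> snd ` p1\<close> by auto
        show "K \<noteq> {}" using K[OF xp] by blast
        show "\<exists>a b. K = cbox a b" using K[OF xp] by auto
        fix K' assume K': "K' \<in> snd ` p1" and ne: "K \<noteq> K'"
        from K' obtain x' where xp': "(x',K') \<in> p" by (auto simp: p1_def)
        show "interior K \<inter> interior K' = {}" using disj[OF xp xp'] ne by auto
      qed simp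
      have "(\<Sum>(u,v)\<in>P. \<bar>f v - f u\<bar>) < e / 2"
      proof (intro ac\<delta>[THEN spec, THEN mp] conjI)
        show "finite P" using p12 by (auto simp: P_def)
        show "\<forall>(u, v)\<in>P. u \<le> v \<and> {u..v} \<subseteq> {a..b}"
          using K by (fastforce simp: P_def h_def p1_def)
        show "disjoint_family_on (\<lambda>(u, v). {u<..<v}) P"
          unfolding disjoint_family_on_def
        proof (intro ballI impI)
          fix w w' assume ww: "w \<in> P" "w' \<in> P" "w \<noteq> w'"
          then obtain x K x' K' where *: "(x,K) \<in> p" "(x',K') \<in> p" "w = h K" "w' = h K'"
            by (auto simp: P_def p1_def)
          with ww have "(x,K) \<noteq> (x',K')" by auto
          then have d: "interior K \<inter> interior K' = {}" using disj *(1,2) by blast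
          obtain u v where uv: "K = {u..v}" "u \<le> v" using K[OF *(1)] by blast
          obtain u' v' where uv': "K' = {u'..v'}" "u' \<le> v'" using K[OF *(2)] by blast
          have "w = (u, v)" "w' = (u', v')" using *(3,4) uv uv' by (auto simp: h_def)
          then show "(case w of (u, v) \<Rightarrow> {u<..<v}) \<inter> (case w' of (u, v) \<Rightarrow> {u<..<v}) = {}"
            using d uv uv' by (simp add: interior_atLeastAtMost_real)
        qed
        have "(\<Sum>(u, v)\<in>P. v - u) = (\<Sum>K\<in>snd ` p1. Sup K - Inf K)"
        proof -
          have P': "P = h ` (snd ` p1)" by (simp add: P_def image_comp)
          have "inj_on h (snd ` p1)"
          proof (rule inj_onI)
            fix K K' assume "K \<in> snd ` p1" "K' \<in> snd ` p1" "h K = h K'"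
            moreover from this obtain x x' where "(x,K) \<in> p" "(x',K') \<in> p" by (auto simp: p1_def)
            ultimately show "K = K'" using K[of x K] K[of x' K'] by (auto simp: h_def)
          qed
          then show ?thesis unfolding P' by (simp add: sum.reindex h_def)
        qed
        also have "\<dots> = (\<Sum>K\<in>snd ` p1. measure lebesgue K)"
        proof (rule sum.cong[OF refl])
          fix K' assume "K' \<in> snd ` p1"
          then obtain x where "(x,K') \<in> p" by (auto simp: p1_def)
          then obtain u v where "K' = {u..v}" "u \<le> v" using K by blast
          then show "Sup K' - Inf K' = measure lebesgue K'" by simp
        qed
        also have "\<dots> = measure lebesgue (\<Union>(snd ` p1))"
          using content_division[OF div] .
        also have "\<dots> \<le> measure lebesgue T"
        proof (rule measure_mono_fmeasurable[OF _ _ Tm])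
          show "\<Union> (snd ` p1) \<in> sets lebesgue"
            using lmeasurable_division[OF div] by (rule fmeasurableD)
          show "\<Union> (snd ` p1) \<subseteq> T"
          proof
            fix y assume "y \<in> \<Union> (snd ` p1)"
            then obtain x K' where *: "(x,K') \<in> p" "x \<in> N" "y \<in> K'" by (auto simp: p1_def)
            then have "y \<in> ball x (r x)" using K[OF *(1)] by (auto simp: \<gamma>_def)
            then show "y \<in> T" using r(2) * T(2) by blast
          qed
        qed
        finally show "(\<Sum>(u, v)\<in>P. v - u) < \<delta>" using Tless by simp
      qed
      then have B1: "(\<Sum>(x,K)\<in>p1. \<bar>f(Sup K) - f(Inf K)\<bar>) < e / 2" by (simp add: S1)
      have "(\<Sum>(x, k)\<in>p. measure lborel k *\<^sub>R g x) - (f b - f a) = (\<Sum>(x,K)\<in>p. measure lborel K *\<^sub>R g x - (f(Sup K) - f(Inf K)))"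
        unfolding ba by (simp add: sum_subtractf case_prod_unfold)
      also have "\<dots> = (\<Sum>(x,K)\<in>p1. measure lborel K *\<^sub>R g x - (f(Sup K) - f(Inf K))) + (\<Sum>(x,K)\<in>p2. measure lborel K *\<^sub>R g x - (f(Sup K) - f(Inf K)))"
        unfolding p12(1) using p12 by (intro sum.union_disjoint) auto
      also have "(\<Sum>(x,K)\<in>p1. measure lborel K *\<^sub>R g x - (f(Sup K) - f(Inf K))) = (\<Sum>(x,K)\<in>p1. - (f(Sup K) - f(Inf K)))"
        using p1zero by (intro sum.cong) auto
      finally have "norm ((\<Sum>(x, k)\<in>p. measure lborel k *\<^sub>R g x) - (f b - f a)) \<le>
         norm (\<Sum>(x,K)\<in>p1. - (f(Sup K) - f(Inf K))) + norm (\<Sum>(x,K)\<in>p2. measure lborel K *\<^sub>R g x - (f(Sup K) - f(Inf K)))"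
        by (simp add: norm_triangle_ineq)
      also have "norm (\<Sum>(x,K)\<in>p1. - (f(Sup K) - f(Inf K))) \<le> (\<Sum>(x,K)\<in>p1. \<bar>f(Sup K) - f(Inf K)\<bar>)"
        unfolding case_prod_unfold by (intro sum_norm_le) auto
      finally show "norm ((\<Sum>(x, k)\<in>p. measure lborel k *\<^sub>R g x) - (f b - f a)) < e"
        using B1 B2 by linarith
    qed
  qed
  then show ?thesis
    unfolding has_integral[of g, folded box_real(2)] box_real[symmetric] has_integral by blast
qed

lemma AC_continuous_on:
  assumes ac: "abs_continuous_on {a..b} f"
  shows "continuous_on {a..b} f"
  unfolding continuous_on_iff
proof (intro ballI allI impI)
  fix x e :: real assume x: "x \<in> {a..b}" and e: "e > 0"
  obtain \<delta> where \<delta>: "\<delta> > 0" and ac\<delta>: "\<forall>P. finite P \<and> (\<forall>(u, v)\<in>P. u \<le> v \<and> {u..v} \<subseteq> {a..b}) \<and>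
        disjoint_family_on (\<lambda>(u, v). {u<..<v}) P \<and> (\<Sum>(u, v)\<in>P. v - u) < \<delta>
        \<longrightarrow> (\<Sum>(u, v)\<in>P. \<bar>f v - f u\<bar>) < e"
    using ac[unfolded abs_continuous_on_def, THEN spec, THEN mp, OF e] by (elim exE conjE)
  have *: "\<bar>f v - f u\<bar> < e" if "u \<le> v" "u \<in> {a..b}" "v \<in> {a..b}" "v - u < \<delta>" for u v
    using ac\<delta>[THEN spec, of "{(u,v)}"] that by (auto simp: disjoint_family_on_def)
  show "\<exists>d>0. \<forall>y\<in>{a..b}. dist y x < d \<longrightarrow> dist (f y) (f x) < e"
  proof (intro exI[of _ \<delta>] conjI ballI impI \<delta>)
    fix y assume y: "y \<in> {a..b}" "dist y x < \<delta>"
    show "dist (f y) (f x) < e"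
    proof (cases "y \<le> x")
      case True
      then show ?thesis using *[of y x] x y by (simp add: dist_real_def abs_minus_commute)
    next
      case False
      then show ?thesis using *[of x y] x y by (simp add: dist_real_def)
    qed
  qed
qed

lemma C1_lipschitz_on_Icc:
  fixes g g' :: "real \<Rightarrow> real"
  assumes "\<And>x. (g has_real_derivative g' x) (at x)" "continuous_on UNIV g'"
  obtains L where "L > 0" "\<And>u v. \<lbrakk>u \<in> {a..b}; v \<in> {a..b}; u \<le> v\<rbrakk> \<Longrightarrow> \<bar>g v - g u\<bar> \<le> L * (v - u)"
proof -
  have "bounded (g' ` {a..b})"
    using assms(2) by (intro compact_imp_bounded compact_continuous_image) (auto intro: continuous_on_subset)
  then obtain B where "\<forall>y\<in>g' ` {a..b}. norm y \<le> B"
    unfolding bounded_iff by blast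
  then have B: "\<And>x. x \<in> {a..b} \<Longrightarrow> \<bar>g' x\<bar> \<le> B" by simp
  have "\<bar>g v - g u\<bar> \<le> max B 1 * (v - u)" if "u \<in> {a..b}" "v \<in> {a..b}" "u \<le> v" for u v
  proof -
    have "norm (g v - g u) \<le> max B 1 * norm (v - u)"
    proof (rule field_differentiable_bound[where S = "{a..b}" and f' = g'])
      show "(g has_field_derivative g' z) (at z within {a..b})" for z
        using assms(1) by (rule DERIV_subset) auto
      show "norm (g' z) \<le> max B 1" if "z \<in> {a..b}" for z
        using B[OF that] by auto
    qed (use that in auto)
    then show ?thesis using that by simp
  qed
  then show ?thesis by (intro that[of "max B 1"]) auto
qed

text \<open>Over an interval the product changes by at most
  \<open>G * |f v - f u| + F * L * (v - u)\<close>, where \<open>F\<close>, \<open>G\<close> bound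
  the factors and \<open>L\<close> is a Lipschitz constant of \<open>g\<close>. Absolute continuity
  of \<open>f\<close> controls the first term and the total length the second. The case of interest
  is \<open>g = cos_basis' m\<close>, for integration by parts.\<close>

lemma AC_mult_C1:
  fixes f g g' :: "real \<Rightarrow> real"
  assumes ac: "abs_continuous_on {a..b} f"
    and g: "\<And>x. (g has_real_derivative g' x) (at x)" "continuous_on UNIV g'"
  shows "abs_continuous_on {a..b} (\<lambda>x. f x * g x)"
proof -
  obtain L where L: "L > 0" "\<And>u v. \<lbrakk>u \<in> {a..b}; v \<in> {a..b}; u \<le> v\<rbrakk> \<Longrightarrow> \<bar>g v - g u\<bar> \<le> L * (v - u)"
    using C1_lipschitz_on_Icc[OF g] by metis
  have "bounded (f ` {a..b})"
    using AC_continuous_on[OF ac] by (intro compact_imp_bounded compact_continuous_image) auto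
  then obtain F where F: "F > 0" "\<And>x. x \<in> {a..b} \<Longrightarrow> \<bar>f x\<bar> \<le> F"
    unfolding bounded_pos by auto
  have "continuous_on {a..b} g"
    using g(1) by (meson DERIV_isCont continuous_at_imp_continuous_on)
  then have "bounded (g ` {a..b})"
    by (intro compact_imp_bounded compact_continuous_image) auto
  then obtain G where G: "G > 0" "\<And>x. x \<in> {a..b} \<Longrightarrow> \<bar>g x\<bar> \<le> G"
    unfolding bounded_pos by auto
  show ?thesis
    unfolding abs_continuous_on_def
  proof (intro allI impI)
    fix e :: real assume e: "e > 0"
    then have "e / (2 * G) > 0" using G by simp
    from ac[unfolded abs_continuous_on_def, THEN spec, THEN mp, OF this]
    obtain \<delta> where \<delta>: "\<delta> > 0" and ac\<delta>: "\<forall>P. finite P \<and> (\<forall>(u, v)\<in>P. u \<le> v \<and> {u..v} \<subseteq> {a..b}) \<and>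
        disjoint_family_on (\<lambda>(u, v). {u<..<v}) P \<and> (\<Sum>(u, v)\<in>P. v - u) < \<delta>
        \<longrightarrow> (\<Sum>(u, v)\<in>P. \<bar>f v - f u\<bar>) < e / (2 * G)" by (elim exE conjE)
    define d where "d = min \<delta> (e / (2 * F * L))"
    have d: "d > 0" "d \<le> \<delta>" "F * L * d \<le> e / 2"
      using \<delta> e F L by (auto simp: d_def min_def field_simps)
    show "\<exists>\<delta>>0. \<forall>P. finite P \<and> (\<forall>(u, v)\<in>P. u \<le> v \<and> {u..v} \<subseteq> {a..b}) \<and>
        disjoint_family_on (\<lambda>(u, v). {u<..<v}) P \<and> (\<Sum>(u, v)\<in>P. v - u) < \<delta>
        \<longrightarrow> (\<Sum>(u, v)\<in>P. \<bar>f v * g v - f u * g u\<bar>) < e"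
    proof (intro exI[of _ d] conjI d(1) allI impI)
      fix P :: "(real \<times> real) set"
      assume P: "finite P \<and> (\<forall>(u, v)\<in>P. u \<le> v \<and> {u..v} \<subseteq> {a..b}) \<and>
        disjoint_family_on (\<lambda>(u, v). {u<..<v}) P \<and> (\<Sum>(u, v)\<in>P. v - u) < d"
      then have fP: "(\<Sum>(u, v)\<in>P. \<bar>f v - f u\<bar>) < e / (2 * G)"
        using ac\<delta> d(2) by (meson less_le_trans)
      have "(\<Sum>(u, v)\<in>P. \<bar>f v * g v - f u * g u\<bar>) \<le> (\<Sum>(u, v)\<in>P. G * \<bar>f v - f u\<bar> + F * L * (v - u))"
      proof (rule sum_mono, clarify)
        fix u v assume "(u, v) \<in> P"
        then have uv: "u \<le> v" "u \<in> {a..b}" "v \<in> {a..b}" using P by (auto simp: subset_iff)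
        have "\<bar>f v * g v - f u * g u\<bar> = \<bar>(f v - f u) * g v + f u * (g v - g u)\<bar>"
          by (simp add: algebra_simps)
        also have "\<dots> \<le> \<bar>f v - f u\<bar> * \<bar>g v\<bar> + \<bar>f u\<bar> * \<bar>g v - g u\<bar>"
          by (metis abs_mult abs_triangle_ineq)
        also have "\<dots> \<le> \<bar>f v - f u\<bar> * G + F * (L * (v - u))"
          using F G L uv by (intro add_mono mult_mono) auto
        finally show "\<bar>f v * g v - f u * g u\<bar> \<le> G * \<bar>f v - f u\<bar> + F * L * (v - u)"
          by (simp add: algebra_simps)
      qed
      also have "\<dots> = G * (\<Sum>(u, v)\<in>P. \<bar>f v - f u\<bar>) + F * L * (\<Sum>(u, v)\<in>P. v - u)"
        by (simp add: sum.distrib sum_distrib_left case_prod_unfold)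
      also have "\<dots> < G * (e / (2 * G)) + F * L * d"
        using fP P G F L by (intro add_strict_mono mult_strict_left_mono) auto
      also have "\<dots> \<le> e" using d G by simp
      finally show "(\<Sum>(u, v)\<in>P. \<bar>f v * g v - f u * g u\<bar>) < e" .
    qed
  qed
qed

lemma AC_const: "abs_continuous_on S (\<lambda>x. c)"
  unfolding abs_continuous_on_def by (auto intro!: exI[of _ 1] simp: case_prod_unfold)

lemma AC_C1:
  fixes g g' :: "real \<Rightarrow> real"
  assumes g: "\<And>x. (g has_real_derivative g' x) (at x)" "continuous_on UNIV g'"
  shows "abs_continuous_on {a..b} g"
  using AC_mult_C1[OF AC_const[of "{a..b}" 1] g] by simp

subsection \<open>The univariate Sobolev space and the cosine basis\<close>

lemma sobolev1_C1:
  fixes g g' :: "real \<Rightarrow> real"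
  assumes g: "\<And>x. (g has_real_derivative g' x) (at x)" "continuous_on UNIV g'"
  shows "g \<in> sobolev1"
proof -
  have d: "deriv g = g'" using g(1) by (auto intro!: DERIV_imp_deriv)
  have c: "continuous_on {0..1} g'" using g(2) continuous_on_subset by blast
  have "g differentiable (at x)" for x
    using g(1) by (meson field_differentiable_def field_differentiable_imp_differentiable)
  moreover have "g' \<in> borel_measurable (lebesgue_on {0..1})"
    using c by (intro continuous_imp_measurable_on_sets_lebesgue) auto
  moreover have "integrable (lebesgue_on {0..1}) (\<lambda>x. (g' x)\<^sup>2)"
    using c by (intro continuous_imp_integrable_real continuous_intros) auto
  ultimately show ?thesis
    using AC_C1[OF g] by (simp add: sobolev1_def d)
qed

lemma sobolev1_continuous: "f \<in> sobolev1 \<Longrightarrow> continuous_on {0..1} f"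
  by (simp add: sobolev1_def AC_continuous_on)

lemma sobolev1_integrable_mult:
  assumes "f \<in> sobolev1" "g \<in> sobolev1"
  shows "integrable (lebesgue_on {0..1}) (\<lambda>x. f x * g x)"
  using assms[THEN sobolev1_continuous] by (intro continuous_imp_integrable_real continuous_intros)

lemma sobolev1_integrable_deriv_mult:
  assumes "f \<in> sobolev1" "g \<in> sobolev1"
  shows "integrable (lebesgue_on {0..1}) (\<lambda>x. deriv f x * deriv g x)"
proof (rule Bochner_Integration.integrable_bound)
  show "integrable (lebesgue_on {0..1}) (\<lambda>x. (deriv f x)\<^sup>2 + (deriv g x)\<^sup>2)"
    using assms by (auto simp: sobolev1_def)
  show "(\<lambda>x. deriv f x * deriv g x) \<in> borel_measurable (lebesgue_on {0..1})"
    using assms by (auto simp: sobolev1_def)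
  have "\<bar>a * b\<bar> \<le> \<bar>a\<^sup>2 + b\<^sup>2\<bar>" for a b :: real
  proof -
    have "2 * \<bar>a * b\<bar> \<le> a\<^sup>2 + b\<^sup>2" using sum_squares_bound[of "\<bar>a\<bar>" "\<bar>b\<bar>"] by (simp add: abs_mult)
    then show ?thesis using abs_ge_self[of "a\<^sup>2 + b\<^sup>2"] abs_ge_zero[of "a * b"] by linarith
  qed
  then show "AE x in lebesgue_on {0..1}. norm (deriv f x * deriv g x) \<le> norm ((deriv f x)\<^sup>2 + (deriv g x)\<^sup>2)"
    by simp
qed

text \<open>The eigenfunctions of the second derivative on the unit interval under Neumann boundary
  conditions, normalised in \<open>L_2\<close>.\<close>

definition cos_basis :: "nat \<Rightarrow> real \<Rightarrow> real" where
  "cos_basis m x = (if m = 0 then 1 else sqrt 2 * cos (real m * pi * x))"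

definition cos_basis' :: "nat \<Rightarrow> real \<Rightarrow> real" where
  "cos_basis' m x = - (sqrt 2 * (real m * pi) * sin (real m * pi * x))"

definition cos_coeff :: "(real \<Rightarrow> real) \<Rightarrow> nat \<Rightarrow> real" where
  "cos_coeff f m = (LINT x|lebesgue_on {0..1}. f x * cos_basis m x)"

lemma cos_basis_deriv: "(cos_basis m has_real_derivative cos_basis' m x) (at x)"
proof (cases "m = 0")
  case True
  then show ?thesis by (simp add: cos_basis_def[abs_def] cos_basis'_def)
next
  case False
  then show ?thesis
    by (auto simp: cos_basis_def[abs_def] cos_basis'_def intro!: derivative_eq_intros)
qed

lemma cos_basis'_deriv: "(cos_basis' m has_real_derivative - (real m * pi)\<^sup>2 * cos_basis m x) (at x)"
proof (cases "m = 0")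
  case True
  then show ?thesis by (simp add: cos_basis'_def[abs_def])
next
  case False
  then show ?thesis
    by (auto simp: cos_basis_def[abs_def] cos_basis'_def[abs_def] power2_eq_square intro!: derivative_eq_intros)
qed

lemma continuous_on_cos_basis: "continuous_on S (cos_basis m)"
  using cos_basis_deriv by (meson DERIV_isCont continuous_at_imp_continuous_on)

lemma continuous_on_cos_basis': "continuous_on S (cos_basis' m)"
  using cos_basis'_deriv by (meson DERIV_isCont continuous_at_imp_continuous_on)

lemma deriv_cos_basis: "deriv (cos_basis m) = cos_basis' m"
  using cos_basis_deriv by (auto intro!: DERIV_imp_deriv)

lemma cmult_cos_basis_sobolev1: "(\<lambda>x. a * cos_basis m x) \<in> sobolev1"
  by (rule sobolev1_C1[where g' = "\<lambda>x. a * cos_basis' m x"])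
     (auto intro!: DERIV_cmult cos_basis_deriv continuous_intros continuous_on_cos_basis')

lemma deriv_cmult_cos_basis: "deriv (\<lambda>x. a * cos_basis m x) = (\<lambda>x. a * cos_basis' m x)"
  by (auto intro!: DERIV_imp_deriv DERIV_cmult cos_basis_deriv)

lemma cos_basis_sobolev1: "cos_basis m \<in> sobolev1"
  using cmult_cos_basis_sobolev1[of 1 m] by simp

lemma abs_cos_basis_le: "\<bar>cos_basis m x\<bar> \<le> sqrt 2"
  by (auto simp: cos_basis_def abs_mult)

lemma cos_basis_sq_le: "(cos_basis m x)\<^sup>2 \<le> (if m = 0 then 1 else 2)"
  by (auto simp: cos_basis_def power_mult_distrib abs_square_le_1)

text \<open>Integration by parts: \<open>cos_basis' m\<close> vanishes at 0 and 1, so there is no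
  boundary term, and its derivative is a multiple of \<open>cos_basis m\<close>. The product with
  \<open>f\<close> is only absolutely continuous, which is what \<open>AC_ftc\<close> is made
  for.\<close>

lemma integral_deriv_cos_basis':
  assumes f: "f \<in> sobolev1"
  shows "(LINT x|lebesgue_on {0..1}. deriv f x * cos_basis' m x) = (real m * pi)\<^sup>2 * cos_coeff f m"
proof -
  define N where "N = {x\<in>{0..1}. \<not> f differentiable (at x)}"
  have "AE x in lebesgue_on {0..1}. f differentiable (at x)"
    using f by (simp add: sobolev1_def)
  then have "AE x in lebesgue. x \<notin> N"
    by (simp add: AE_restrict_space_iff N_def) (auto elim: eventually_mono)
  then have N: "negligible N"
    by (simp add: negligible_iff_null_sets eventually_ae_filter)
       (metis (mono_tags, lifting) AE_iff_null_sets completion.complete2 mem_Collect_eq subsetI)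
  define h where "h = (\<lambda>x. deriv f x * cos_basis' m x + f x * (- (real m * pi)\<^sup>2 * cos_basis m x))"
  \<comment> \<open>On \<open>N\<close> the function \<open>deriv f\<close> has no meaning, and
    \<open>AC_ftc\<close> asks for the value 0 there; the null set is restored afterwards by
    \<open>has_integral_spike\<close>.\<close>
  have "((\<lambda>x. if x \<in> N then 0 else h x) has_integral (f 1 * cos_basis' m 1 - f 0 * cos_basis' m 0)) {0..1}"
  proof (rule AC_ftc[where N = N])
    show "abs_continuous_on {0..1} (\<lambda>x. f x * cos_basis' m x)"
      using f by (intro AC_mult_C1[OF _ cos_basis'_deriv])
        (auto simp: sobolev1_def intro!: continuous_intros continuous_on_cos_basis)
    fix x :: real assume x: "x \<in> {0..1} - N"
    then have "(f has_real_derivative deriv f x) (at x)"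
      by (auto simp: N_def DERIV_deriv_iff_real_differentiable)
    then show "((\<lambda>x. f x * cos_basis' m x) has_real_derivative (if x \<in> N then 0 else h x)) (at x)"
      using x DERIV_mult[OF _ cos_basis'_deriv, of f "deriv f x" x m] by (simp add: h_def algebra_simps)
  qed (auto simp: N)
  moreover have "cos_basis' m 1 = 0" "cos_basis' m 0 = 0"
    by (auto simp: cos_basis'_def)
  ultimately have "((\<lambda>x. if x \<in> N then 0 else h x) has_integral 0) {0..1}" by simp
  then have z: "(h has_integral 0) {0..1}"
    by (rule has_integral_spike[OF N, rotated]) auto
  have i1: "integrable (lebesgue_on {0..1}) (\<lambda>x. deriv f x * cos_basis' m x)"
    using sobolev1_integrable_deriv_mult[OF f cos_basis_sobolev1] by (simp add: deriv_cos_basis)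
  have i2: "integrable (lebesgue_on {0..1}) (\<lambda>x. f x * cos_basis m x)"
    using sobolev1_integrable_mult[OF f cos_basis_sobolev1] .
  then have i3: "integrable (lebesgue_on {0..1}) (\<lambda>x. - (real m * pi)\<^sup>2 * (f x * cos_basis m x))"
    by (rule integrable_mult_right)
  have hh: "h = (\<lambda>x. deriv f x * cos_basis' m x + - (real m * pi)\<^sup>2 * (f x * cos_basis m x))"
    by (auto simp: h_def)
  have "integrable (lebesgue_on {0..1}) h"
    unfolding hh using i1 i3 by (rule Bochner_Integration.integrable_add)
  then have "(h has_integral (LINT x|lebesgue_on {0..1}. h x)) {0..1}"
    by (rule has_integral_integral_lebesgue_on) auto
  with z have "0 = (LINT x|lebesgue_on {0..1}. h x)"
    by (rule has_integral_unique)
  also have "\<dots> = (LINT x|lebesgue_on {0..1}. deriv f x * cos_basis' m x) - (real m * pi)\<^sup>2 * cos_coeff f m"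
    unfolding hh Bochner_Integration.integral_add[OF i1 i3] integral_mult_right_zero cos_coeff_def by simp
  finally show ?thesis by simp
qed

text \<open>Against a cosine the Sobolev inner product is a multiple of the \<open>L_2\<close> one.
  The same functions are therefore orthogonal for every weight \<open>c\<close>, with only their
  norms changing.\<close>

lemma sobolev1_inner_cos_basis:
  assumes "f \<in> sobolev1"
  shows "sobolev1_inner c f (cos_basis m) = (1 + (real m * pi)\<^sup>2 / c) * cos_coeff f m"
  using integral_deriv_cos_basis'[OF assms, of m]
  by (simp add: sobolev1_inner_def deriv_cos_basis cos_coeff_def[symmetric] algebra_simps divide_inverse)

text \<open>The frequency is an integer because the product-to-sum formula produces the difference
  \<open>m - n\<close>.\<close>

lemma integral_cos_int:
  fixes k :: int
  shows "(LINT x|lebesgue_on {0..1}. cos (of_int k * pi * x)) = (if k = 0 then 1 else 0)"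
proof (cases "k = 0")
  case True
  then show ?thesis by (simp add: measure_restrict_space)
next
  case False
  have "((\<lambda>x. cos (of_int k * pi * x)) has_integral
      (sin (of_int k * pi * 1) / (of_int k * pi) - sin (of_int k * pi * 0) / (of_int k * pi))) {0..1}"
    using False by (intro fundamental_theorem_of_calculus)
      (auto simp flip: has_real_derivative_iff_has_vector_derivative intro!: derivative_eq_intros)
  moreover have "sin (of_int k * pi) = 0"
    by (metis mult.commute sin_npi_int)
  ultimately have "((\<lambda>x. cos (of_int k * pi * x)) has_integral 0) {0..1}" by simp
  moreover have "integrable (lebesgue_on {0..1}) (\<lambda>x. cos (of_int k * pi * x))"
    by (intro continuous_imp_integrable_real continuous_intros)
  ultimately show ?thesis
    using False by (simp add: lebesgue_integral_eq_integral integral_unique)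
qed

lemma cos_coeff_cos_basis: "cos_coeff (cos_basis m) n = (if m = n then 1 else 0)"
proof -
  have i: "integrable (lebesgue_on {0..1}) (\<lambda>x. cos (of_int k * pi * x))" for k :: int
    by (intro continuous_imp_integrable_real continuous_intros)
  have 2: "(LINT x|lebesgue_on {0..1}. cos (of_int k * pi * x) + cos (of_int l * pi * x))
      = (if k = 0 then 1 else 0) + (if l = 0 then 1 else 0)" for k l :: int
    using i by (subst Bochner_Integration.integral_add) (auto simp: integral_cos_int)
  consider "m = 0" "n = 0" | "m = 0" "n > 0" | "m > 0" "n = 0" | "m > 0" "n > 0" by auto
  then show ?thesis
  proof cases
    case 1
    then show ?thesis by (simp add: cos_coeff_def cos_basis_def measure_restrict_space)
  next
    case 2
    then show ?thesis using integral_cos_int[of "int n"] by (simp add: cos_coeff_def cos_basis_def)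
  next
    case 3
    then show ?thesis using integral_cos_int[of "int m"] by (simp add: cos_coeff_def cos_basis_def)
  next
    case 4
    have "cos_basis m x * cos_basis n x = cos (of_int (int m - int n) * pi * x) + cos (of_int (int m + int n) * pi * x)" for x
    proof -
      have "cos_basis m x * cos_basis n x = 2 * (cos (real m * pi * x) * cos (real n * pi * x))"
        using 4 by (simp add: cos_basis_def)
      also have "\<dots> = cos (real m * pi * x - real n * pi * x) + cos (real m * pi * x + real n * pi * x)"
        unfolding cos_times_cos by simp
      finally show ?thesis by (simp add: algebra_simps)
    qed
    then show ?thesis using 4 2[of "int m - int n" "int m + int n"] by (simp add: cos_coeff_def)
  qed
qed

text \<open>Scalars are carried along since the coefficient of an elementary tensor is absorbed into
  one of its factors.\<close>

lemma sobolev1_inner_cmult_cos_basis: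
  "sobolev1_inner c (\<lambda>x. a * cos_basis m x) (\<lambda>x. b * cos_basis n x) =
     a * b * (if m = n then 1 + (real m * pi)\<^sup>2 / c else 0)"
proof -
  have "sobolev1_inner c (\<lambda>x. a * cos_basis m x) (\<lambda>x. b * cos_basis n x) = a * b * sobolev1_inner c (cos_basis m) (cos_basis n)"
  proof -
    have "(LINT x|lebesgue_on {0..1}. a * F x * (b * G x)) = a * b * (LINT x|lebesgue_on {0..1}. F x * G x)"
      for F G :: "real \<Rightarrow> real"
      unfolding integral_mult_right_zero[symmetric] by (simp add: algebra_simps)
    then show ?thesis
      by (simp add: sobolev1_inner_def deriv_cmult_cos_basis deriv_cos_basis algebra_simps)
  qed
  then show ?thesis by (simp add: sobolev1_inner_cos_basis[OF cos_basis_sobolev1] cos_coeff_cos_basis)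
qed

lemma sobolev1_inner_commute: "sobolev1_inner c f g = sobolev1_inner c g f"
  by (simp add: sobolev1_inner_def mult.commute)

subsection \<open>Positivity and Bessel's inequality in tensor products\<close>

text \<open>
  A special case of Schur's product theorem: one factor is an integral of rank-one kernels.
\<close>

lemma psd_sobolev1_inner_mult:
  assumes A: "finite A" and c: "c > 0" and f: "\<And>i. i \<in> A \<Longrightarrow> f i \<in> sobolev1"
    and M: "\<And>a. 0 \<le> (\<Sum>i\<in>A. \<Sum>j\<in>A. a i * a j * (M i j :: real))"
  shows "0 \<le> (\<Sum>i\<in>A. \<Sum>j\<in>A. a i * a j * (sobolev1_inner c (f i) (f j) * M i j))"
proof -
  \<comment> \<open>For each \<open>x\<close> this is the form of \<open>M\<close> at the
    coefficients \<open>a i * F i x\<close>, hence nonnegative. Integrating it for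
    \<open>F = f\<close> and for the derivatives of \<open>f\<close> yields the two parts of the
    inner product.\<close>
  define Q :: "(_ \<Rightarrow> real \<Rightarrow> real) \<Rightarrow> real \<Rightarrow> real" where "Q = (\<lambda>F x. \<Sum>i\<in>A. \<Sum>j\<in>A. (a i * F i x) * (a j * F j x) * M i j)"
  have Q: "Q F x \<ge> 0" for F :: "_ \<Rightarrow> real \<Rightarrow> real" and x
    unfolding Q_def by (rule M)
  have int: "(LINT x|lebesgue_on {0..1}. Q F x) =
      (\<Sum>i\<in>A. \<Sum>j\<in>A. a i * a j * M i j * (LINT x|lebesgue_on {0..1}. F i x * F j x))"
    if "\<And>i j. i \<in> A \<Longrightarrow> j \<in> A \<Longrightarrow> integrable (lebesgue_on {0..1}) (\<lambda>x. F i x * F j x)" for F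
  proof -
    have "Q F x = (\<Sum>i\<in>A. \<Sum>j\<in>A. a i * a j * M i j * (F i x * F j x))" for x
      unfolding Q_def by (intro sum.cong refl) (simp add: algebra_simps)
    then show ?thesis
      using that by (simp add: Bochner_Integration.integral_sum)
  qed
  have "0 \<le> (LINT x|lebesgue_on {0..1}. Q f x) + inverse c * (LINT x|lebesgue_on {0..1}. Q (\<lambda>i. deriv (f i)) x)"
    using Q c by (intro add_nonneg_nonneg mult_nonneg_nonneg Bochner_Integration.integral_nonneg) auto
  also have "\<dots> = (\<Sum>i\<in>A. \<Sum>j\<in>A. a i * a j * (sobolev1_inner c (f i) (f j) * M i j))"
    using f by (simp add: int sobolev1_integrable_mult sobolev1_integrable_deriv_mult sobolev1_inner_def
        sum_distrib_left sum.distrib[symmetric] algebra_simps)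
  finally show ?thesis .
qed

text \<open>The induction starts from the all-one kernel, whose form is the square of
  \<open>\<Sum>i\<in>A. a i\<close>, and multiplies in one factor at a time. Positivity for all
  coefficients is the induction hypothesis.\<close>

lemma psd_prod_sobolev1_inner:
  assumes "finite I" "finite A" "\<And>k. k \<in> I \<Longrightarrow> c k > 0" "\<And>i k. i \<in> A \<Longrightarrow> k \<in> I \<Longrightarrow> f i k \<in> sobolev1"
  shows "0 \<le> (\<Sum>i\<in>A. \<Sum>j\<in>A. a i * a j * (\<Prod>k\<in>I. sobolev1_inner (c k) (f i k) (f j k)))"
  using assms
proof (induction I arbitrary: a rule: finite_induct)
  case empty
  have "(\<Sum>i\<in>A. \<Sum>j\<in>A. a i * a j) = (\<Sum>i\<in>A. a i)\<^sup>2"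
    by (simp add: power2_eq_square sum_product)
  then show ?case by simp
next
  case (insert k I)
  have "0 \<le> (\<Sum>i\<in>A. \<Sum>j\<in>A. a i * a j * (sobolev1_inner (c k) (f i k) (f j k) *
      (\<Prod>k\<in>I. sobolev1_inner (c k) (f i k) (f j k))))"
    using insert by (intro psd_sobolev1_inner_mult) auto
  then show ?case using insert by simp
qed

text \<open>Indexing both families by the disjoint sum \<open>A <+> B\<close> and expanding gives
  the squared norm of a sum of two linear combinations. The index types may differ: list positions
  are paired with multi-indices in Bessel's inequality.\<close>

lemma psd_two_families:
  fixes f :: "'a \<Rightarrow> 'k \<Rightarrow> real \<Rightarrow> real" and g :: "'b \<Rightarrow> 'k \<Rightarrow> real \<Rightarrow> real"
  assumes "finite I" "finite A" "finite B" "\<And>k. k \<in> I \<Longrightarrow> c k > 0"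
    "\<And>i k. i \<in> A \<Longrightarrow> k \<in> I \<Longrightarrow> f i k \<in> sobolev1" "\<And>i k. i \<in> B \<Longrightarrow> k \<in> I \<Longrightarrow> g i k \<in> sobolev1"
  defines "p \<equiv> (\<lambda>u v. \<Prod>k\<in>I. sobolev1_inner (c k) (u k) (v k))"
  shows "0 \<le> (\<Sum>i\<in>A. \<Sum>j\<in>A. a i * a j * p (f i) (f j)) + 2 * (\<Sum>i\<in>A. \<Sum>j\<in>B. a i * b j * p (f i) (g j))
    + (\<Sum>i\<in>B. \<Sum>j\<in>B. b i * b j * p (g i) (g j))"
proof -
  have pc: "p u v = p v u" for u v
    by (simp add: p_def sobolev1_inner_commute)
  have "0 \<le> (\<Sum>i\<in>A <+> B. \<Sum>j\<in>A <+> B. case_sum a b i * case_sum a b j *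
      p (case_sum f g i) (case_sum f g j))"
    unfolding p_def using assms by (intro psd_prod_sobolev1_inner) auto
  also have "\<dots> = (\<Sum>i\<in>A. \<Sum>j\<in>A. a i * a j * p (f i) (f j)) + (\<Sum>i\<in>A. \<Sum>j\<in>B. a i * b j * p (f i) (g j))
    + ((\<Sum>i\<in>B. \<Sum>j\<in>A. b i * a j * p (g i) (f j)) + (\<Sum>i\<in>B. \<Sum>j\<in>B. b i * b j * p (g i) (g j)))"
    using assms(2,3) by (simp add: sum.Plus o_def sum.distrib)
  also have "(\<Sum>i\<in>B. \<Sum>j\<in>A. b i * a j * p (g i) (f j)) = (\<Sum>i\<in>A. \<Sum>j\<in>B. a i * b j * p (f i) (g j))"
    by (subst sum.swap) (simp add: pc mult.commute)
  finally show ?thesis by simp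
qed

section \<open>Seminorms on the algebraic tensor product\<close>

abbreviation sob_tensor_inner where
  "sob_tensor_inner I c \<equiv> tensor_inner I (\<lambda>k. sobolev1_inner (c k))"

abbreviation sob_tensor_dist2 where
  "sob_tensor_dist2 I c \<equiv> tensor_dist2 I (\<lambda>k. sobolev1_inner (c k))"

lemma sum_list_map_conv_sum: "(\<Sum>s\<leftarrow>S. g s) = (\<Sum>i<length S. g (S ! i))" for g :: "_ \<Rightarrow> real"
  by (simp add: sum_list_sum_nth atLeast0LessThan)

lemma tensor_inner_conv_sum:
  "tensor_inner I ip S T = (\<Sum>i<length S. \<Sum>j<length T. \<Prod>k\<in>I. ip k ((S ! i) k) ((T ! j) k))"
  by (simp add: tensor_inner_def sum_list_map_conv_sum)

text \<open>The expression is the squared norm of \<open>a\<close> times \<open>S\<close> plus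
  \<open>b\<close> times \<open>T\<close>. The scalars enter as coefficients of the two families
  rather than through the lists.\<close>

lemma sob_tensor_quadratic_nonneg:
  assumes "finite I" "\<And>k. k \<in> I \<Longrightarrow> c k > 0"
    "\<And>s k. s \<in> set S \<Longrightarrow> k \<in> I \<Longrightarrow> s k \<in> sobolev1" "\<And>s k. s \<in> set T \<Longrightarrow> k \<in> I \<Longrightarrow> s k \<in> sobolev1"
  shows "0 \<le> a\<^sup>2 * sob_tensor_inner I c S S + 2 * a * b * sob_tensor_inner I c S T + b\<^sup>2 * sob_tensor_inner I c T T"
proof -
  have "0 \<le> (\<Sum>i<length S. \<Sum>j<length S. a * a * (\<Prod>k\<in>I. sobolev1_inner (c k) ((S ! i) k) ((S ! j) k)))
    + 2 * (\<Sum>i<length S. \<Sum>j<length T. a * b * (\<Prod>k\<in>I. sobolev1_inner (c k) ((S ! i) k) ((T ! j) k)))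
    + (\<Sum>i<length T. \<Sum>j<length T. b * b * (\<Prod>k\<in>I. sobolev1_inner (c k) ((T ! i) k) ((T ! j) k)))"
    using assms by (intro psd_two_families) auto
  then show ?thesis
    by (simp add: tensor_inner_conv_sum sum_distrib_left[symmetric] power2_eq_square mult.assoc)
qed

lemma sob_tensor_inner_self_nonneg:
  assumes "finite I" "\<And>k. k \<in> I \<Longrightarrow> c k > 0" "\<And>s k. s \<in> set S \<Longrightarrow> k \<in> I \<Longrightarrow> s k \<in> sobolev1"
  shows "0 \<le> sob_tensor_inner I c S S"
  using sob_tensor_quadratic_nonneg[of I c S S 1 0] assms by simp

lemma discriminant_le:
  fixes p q r :: real
  assumes "\<And>a b. 0 \<le> a\<^sup>2 * p + 2 * a * b * r + b\<^sup>2 * q"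
  shows "r\<^sup>2 \<le> p * q"
proof -
  have p: "p \<ge> 0" using assms[of 1 0] by simp
  show ?thesis
  proof (cases "p = 0")
    case True
    \<comment> \<open>With \<open>p = 0\<close> the form is linear in \<open>a\<close>; the chosen
      \<open>a\<close> makes it equal to -1 at \<open>b = 1\<close>.\<close>
    have "r = 0"
    proof (rule ccontr)
      assume "r \<noteq> 0"
      then show False using assms[of "- (q + 1) / (2 * r)" 1] True \<open>r \<noteq> 0\<close> by (simp add: field_simps)
    qed
    then show ?thesis using True by simp
  next
    case False
    \<comment> \<open>The choice \<open>a = r\<close>, \<open>b = -p\<close> is the minimiser of the
      form up to scaling.\<close>
    have "0 \<le> p * (p * q - r\<^sup>2)" using assms[of r "-p"] by (simp add: algebra_simps power2_eq_square)
    then show ?thesis using p False by (simp add: zero_le_mult_iff)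
  qed
qed

text \<open>The reverse triangle inequality, from Cauchy-Schwarz in its discriminant form.\<close>

lemma sob_tensor_norm_diff_le:
  assumes "finite I" "\<And>k. k \<in> I \<Longrightarrow> c k > 0"
    "\<And>s k. s \<in> set S \<Longrightarrow> k \<in> I \<Longrightarrow> s k \<in> sobolev1" "\<And>s k. s \<in> set T \<Longrightarrow> k \<in> I \<Longrightarrow> s k \<in> sobolev1"
  shows "(sqrt (sob_tensor_inner I c S S) - sqrt (sob_tensor_inner I c T T))\<^sup>2 \<le> sob_tensor_dist2 I c S T"
proof -
  let ?p = "sob_tensor_inner I c S S" and ?r = "sob_tensor_inner I c S T" and ?q = "sob_tensor_inner I c T T"
  have pq: "?p \<ge> 0" "?q \<ge> 0" using assms by (auto intro!: sob_tensor_inner_self_nonneg)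
  have "?r\<^sup>2 \<le> ?p * ?q"
    using assms by (intro discriminant_le sob_tensor_quadratic_nonneg) auto
  then have "\<bar>?r\<bar> \<le> sqrt ?p * sqrt ?q"
    by (metis real_sqrt_abs real_sqrt_le_iff real_sqrt_mult)
  then show ?thesis using pq by (simp add: tensor_dist2_def power2_diff)
qed

text \<open>Guarantees that every representing sequence contributes a value to the infimum in
  \<open>hilbert_tensor_norm\<close>.\<close>

lemma sob_tensor_norms_convergent:
  assumes I: "finite I" "\<And>k. k \<in> I \<Longrightarrow> c k > 0"
    and X: "tensor_represents I D (\<lambda>k. sobolev1) (\<lambda>k. sobolev1_inner (c k)) X f"
  shows "convergent (\<lambda>n. sqrt (sob_tensor_inner I c (X n) (X n)))"
proof (rule Cauchy_convergent, rule metric_CauchyI)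
  fix e :: real assume e: "e > 0"
  then obtain N where N: "\<forall>m\<ge>N. \<forall>n\<ge>N. sob_tensor_dist2 I c (X m) (X n) < e\<^sup>2"
    using X unfolding tensor_represents_def by (meson zero_less_power)
  show "\<exists>M. \<forall>m\<ge>M. \<forall>n\<ge>M. dist (sqrt (sob_tensor_inner I c (X m) (X m))) (sqrt (sob_tensor_inner I c (X n) (X n))) < e"
  proof (intro exI[of _ N] allI impI)
    fix m n assume "m \<ge> N" "n \<ge> N"
    have "(sqrt (sob_tensor_inner I c (X m) (X m)) - sqrt (sob_tensor_inner I c (X n) (X n)))\<^sup>2 \<le> sob_tensor_dist2 I c (X m) (X n)"
      using X by (intro sob_tensor_norm_diff_le I) (auto simp: tensor_represents_def)
    also have "\<dots> < e\<^sup>2" using N \<open>m \<ge> N\<close> \<open>n \<ge> N\<close> by blast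
    finally show "dist (sqrt (sob_tensor_inner I c (X m) (X m))) (sqrt (sob_tensor_inner I c (X n) (X n))) < e"
      using e by (metis abs_of_pos dist_real_def power2_less_imp_less power2_abs less_imp_le)
  qed
qed

section \<open>Bessel's inequality for tensor cosines\<close>

definition cos_weight :: "real \<Rightarrow> nat \<Rightarrow> real" where
  "cos_weight c m = 1 + (real m * pi)\<^sup>2 / c"

lemma cos_weight_ge_1: "c > 0 \<Longrightarrow> cos_weight c m \<ge> 1"
  by (simp add: cos_weight_def)

text \<open>The \<open>L_2\<close> coefficient of the represented function against a tensor cosine,
  computed factor by factor; the identification with an integral over the cube comes later.\<close>

definition tensor_coeff :: "'i set \<Rightarrow> ('i \<Rightarrow> real \<Rightarrow> real) list \<Rightarrow> ('i \<Rightarrow> nat) \<Rightarrow> real" where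
  "tensor_coeff I S \<kappa> = (\<Sum>s\<leftarrow>S. \<Prod>k\<in>I. cos_coeff (s k) (\<kappa> k))"

text \<open>Extensionality makes distinct multi-indices differ at some coordinate in
  \<open>I\<close>, which produces a zero factor. This gives the orthogonality of tensor
  cosines.\<close>

lemma prod_if_eq_PiE:
  assumes "finite I" "\<kappa> \<in> I \<rightarrow>\<^sub>E B" "\<kappa>' \<in> I \<rightarrow>\<^sub>E B"
  shows "(\<Prod>k\<in>I. if \<kappa> k = \<kappa>' k then w k else 0) = (if \<kappa> = \<kappa>' then (\<Prod>k\<in>I. w k) else (0::real))"
proof (cases "\<kappa> = \<kappa>'")
  case False
  then obtain k where "k \<in> I" "\<kappa> k \<noteq> \<kappa>' k"
    using assms(2,3) PiE_ext by metis
  then have "(\<Prod>k\<in>I. if \<kappa> k = \<kappa>' k then w k else 0) = 0"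
    using assms(1) by (subst prod_zero_iff) auto
  then show ?thesis using False by simp
qed simp

text \<open>The squared norm of \<open>S\<close> minus its projection onto the cosines in
  \<open>K\<close> is nonnegative. Since \<open>cos_weight\<close> is the squared norm of a cosine,
  the cross terms contribute \<open>- 2 * w \<kappa> * (h \<kappa>)\<^sup>2\<close> and the diagonal
  \<open>w \<kappa> * (h \<kappa>)\<^sup>2\<close>.\<close>

lemma sob_tensor_bessel:
  assumes I: "finite I" "\<And>k. k \<in> I \<Longrightarrow> c k > 0"
    and S: "\<And>s k. s \<in> set S \<Longrightarrow> k \<in> I \<Longrightarrow> s k \<in> sobolev1"
    and K: "finite K" "K \<subseteq> I \<rightarrow>\<^sub>E UNIV"
  shows "(\<Sum>\<kappa>\<in>K. (\<Prod>k\<in>I. cos_weight (c k) (\<kappa> k)) * (tensor_coeff I S \<kappa>)\<^sup>2) \<le> sob_tensor_inner I c S S"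
proof -
  define w where "w = (\<lambda>\<kappa>. \<Prod>k\<in>I. cos_weight (c k) (\<kappa> k))"
  define h where "h = tensor_coeff I S"
  define p where "p = (\<lambda>u v. \<Prod>k\<in>I. sobolev1_inner (c k) (u k) (v k))"
  let ?E = "\<lambda>\<kappa> k. cos_basis (\<kappa> k)"
  have "0 \<le> (\<Sum>i<length S. \<Sum>j<length S. 1 * 1 * p (S ! i) (S ! j))
     + 2 * (\<Sum>i<length S. \<Sum>\<kappa>\<in>K. 1 * - h \<kappa> * p (S ! i) (?E \<kappa>))
     + (\<Sum>\<kappa>\<in>K. \<Sum>\<kappa>'\<in>K. - h \<kappa> * - h \<kappa>' * p (?E \<kappa>) (?E \<kappa>'))"
    unfolding p_def using I S K cos_basis_sobolev1 by (intro psd_two_families) auto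
  also have "(\<Sum>i<length S. \<Sum>j<length S. 1 * 1 * p (S ! i) (S ! j)) = sob_tensor_inner I c S S"
    by (simp add: tensor_inner_conv_sum p_def)
  also have "(\<Sum>i<length S. \<Sum>\<kappa>\<in>K. 1 * - h \<kappa> * p (S ! i) (?E \<kappa>)) = (\<Sum>\<kappa>\<in>K. - w \<kappa> * (h \<kappa>)\<^sup>2)"
  proof (subst sum.swap, rule sum.cong[OF refl])
    fix \<kappa> assume "\<kappa> \<in> K"
    have *: "p (S ! i) (?E \<kappa>) = w \<kappa> * (\<Prod>k\<in>I. cos_coeff ((S ! i) k) (\<kappa> k))" if "i < length S" for i
      using S that by (simp add: p_def w_def sobolev1_inner_cos_basis cos_weight_def prod.distrib)
    have "h \<kappa> = (\<Sum>i<length S. \<Prod>k\<in>I. cos_coeff ((S ! i) k) (\<kappa> k))"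
      by (simp add: h_def tensor_coeff_def sum_list_map_conv_sum)
    then show "(\<Sum>i<length S. 1 * - h \<kappa> * p (S ! i) (?E \<kappa>)) = - w \<kappa> * (h \<kappa>)\<^sup>2"
      by (simp add: * sum_negf sum_distrib_left[symmetric] power2_eq_square)
  qed
  also have "(\<Sum>\<kappa>\<in>K. \<Sum>\<kappa>'\<in>K. - h \<kappa> * - h \<kappa>' * p (?E \<kappa>) (?E \<kappa>')) = (\<Sum>\<kappa>\<in>K. w \<kappa> * (h \<kappa>)\<^sup>2)"
  proof (rule sum.cong[OF refl])
    fix \<kappa> assume \<kappa>: "\<kappa> \<in> K"
    have *: "p (?E \<kappa>) (?E \<kappa>') = (if \<kappa> = \<kappa>' then w \<kappa> else 0)" if "\<kappa>' \<in> K" for \<kappa>'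
    proof -
      have "p (?E \<kappa>) (?E \<kappa>') = (\<Prod>k\<in>I. if \<kappa> k = \<kappa>' k then cos_weight (c k) (\<kappa> k) else 0)"
        unfolding p_def
        by (intro prod.cong refl) (auto simp: sobolev1_inner_cos_basis[OF cos_basis_sobolev1] cos_coeff_cos_basis cos_weight_def)
      then show ?thesis
        using K \<kappa> that I by (subst (asm) prod_if_eq_PiE[where B = UNIV]) (auto simp: w_def)
    qed
    then have "(\<Sum>\<kappa>'\<in>K. - h \<kappa> * - h \<kappa>' * p (?E \<kappa>) (?E \<kappa>')) = (\<Sum>\<kappa>'\<in>K. if \<kappa> = \<kappa>' then w \<kappa> * (h \<kappa>)\<^sup>2 else 0)"
      by (intro sum.cong) (auto simp: power2_eq_square)
    then show "(\<Sum>\<kappa>'\<in>K. - h \<kappa> * - h \<kappa>' * p (?E \<kappa>) (?E \<kappa>')) = w \<kappa> * (h \<kappa>)\<^sup>2"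
      using K \<kappa> by simp
  qed
  finally have "(\<Sum>\<kappa>\<in>K. w \<kappa> * (h \<kappa>)\<^sup>2) \<le> sob_tensor_inner I c S S"
    by (simp add: sum_negf)
  then show ?thesis unfolding w_def h_def .
qed

text \<open>The tensor inequality for the one-element index type \<open>unit\<close>, with
  frequencies viewed as constant multi-indices.\<close>

lemma sobolev1_bessel:
  assumes f: "f \<in> sobolev1" and c: "c > 0"
  shows "(\<Sum>m<M. cos_weight c m * (cos_coeff f m)\<^sup>2) \<le> sobolev1_inner c f f"
proof -
  let ?K = "(\<lambda>m (_::unit). m) ` {..<M}"
  have inj: "inj_on (\<lambda>m (_::unit). m) {..<M}" by (auto simp: inj_on_def fun_eq_iff)
  have "(\<Sum>\<kappa>\<in>?K. (\<Prod>k\<in>UNIV. cos_weight c (\<kappa> k)) * (tensor_coeff UNIV [\<lambda>_. f] \<kappa>)\<^sup>2)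
      \<le> sob_tensor_inner (UNIV::unit set) (\<lambda>_. c) [\<lambda>_. f] [\<lambda>_. f]"
    using f c by (intro sob_tensor_bessel) auto
  then show ?thesis
    using inj by (simp add: sum.reindex tensor_coeff_def tensor_inner_def UNIV_unit)
qed

subsection \<open>Pointwise convergence of cosine series\<close>

text \<open>The linear span of the cosines, given as a predicate in the form that the
  Stone-Weierstrass theorem takes. Closure under multiplication is a consequence of the
  product-to-sum formula.\<close>

inductive cos_poly :: "(real \<Rightarrow> real) \<Rightarrow> bool" where
  base: "cos_poly (\<lambda>x. cos (real k * pi * x))"
| add: "cos_poly f \<Longrightarrow> cos_poly g \<Longrightarrow> cos_poly (\<lambda>x. f x + g x)"
| scale: "cos_poly f \<Longrightarrow> cos_poly (\<lambda>x. c * f x)"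

lemma cos_poly_continuous: "cos_poly f \<Longrightarrow> continuous_on S f"
  by (induction rule: cos_poly.induct) (auto intro!: continuous_intros)

lemma cos_poly_mult:
  assumes "cos_poly f" "cos_poly g"
  shows "cos_poly (\<lambda>x. f x * g x)"
  using assms
proof (induction f rule: cos_poly.induct)
  case (base k)
  from base show ?case
  proof (induction g rule: cos_poly.induct)
    case (base l)
    \<comment> \<open>Frequencies are natural numbers here, so the difference is taken in absolute
      value; evenness of the cosine allows this.\<close>
    have eq: "cos (real k * pi * x) * cos (real l * pi * x) =
      1/2 * (cos (real (nat \<bar>int k - int l\<bar>) * pi * x) + cos (real (k + l) * pi * x))" for x
    proof -
      have "cos (real (nat \<bar>int k - int l\<bar>) * pi * x) = cos (real k * pi * x - real l * pi * x)"
      proof (cases "k \<le> l")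
        case True
        then have "real (nat \<bar>int k - int l\<bar>) = real l - real k" by (simp add: of_nat_diff)
        then show ?thesis by (metis cos_minus left_diff_distrib minus_diff_eq)
      next
        case False
        then have "real (nat \<bar>int k - int l\<bar>) = real k - real l" by (simp add: of_nat_diff)
        then show ?thesis by (simp add: left_diff_distrib)
      qed
      then show ?thesis by (simp add: cos_times_cos distrib_right)
    qed
    show ?case
      unfolding eq by (intro cos_poly.intros)
  next
    case (add f g)
    then show ?case using cos_poly.add by (simp add: distrib_left)
  next
    case (scale f c)
    then show ?case using cos_poly.scale[OF scale.IH, of c] by (simp add: algebra_simps)
  qed
next
  case (add f g')
  then show ?case using cos_poly.add by (simp add: distrib_right)
next
  case (scale f c)
  then show ?case using cos_poly.scale[of "\<lambda>x. f x * g x" c] by (simp add: algebra_simps)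
qed

text \<open>Stone-Weierstrass: the function \<open>cos (pi * x)\<close> is injective on the unit
  interval and so separates its points.\<close>

lemma cos_poly_dense:
  assumes "continuous_on {0..1} h" "e > 0"
  obtains p where "cos_poly p" "\<And>x. x \<in> {0..1} \<Longrightarrow> \<bar>h x - p x\<bar> < e"
proof -
  have const: "cos_poly (\<lambda>x. c)" for c
    using cos_poly.scale[OF cos_poly.base[of 0], of c] by simp
  have "\<exists>p. cos_poly p \<and> (\<forall>x \<in> {0..1}. \<bar>h x - p x\<bar> < e)"
  proof (rule Stone_Weierstrass_HOL)
    fix x y :: real assume xy: "x \<in> {0..1} \<and> y \<in> {0..1} \<and> x \<noteq> y"
    have "cos (pi * x) \<noteq> cos (pi * y)"
      using xy cos_inj_pi[of "pi * x" "pi * y"] by auto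
    then show "\<exists>f. cos_poly f \<and> f x \<noteq> f y"
      using cos_poly.base[of 1] by (intro exI[of _ "\<lambda>x. cos (pi * x)"]) auto
  qed (use assms const cos_poly.add cos_poly_mult cos_poly_continuous in auto)
  then show ?thesis using that by blast
qed

text \<open>Such an \<open>h\<close> is orthogonal to every cosine polynomial \<open>p\<close>, so
  the integral of its square equals that of \<open>h * (h - p)\<close>, which is at most
  \<open>e\<close> times the integral of \<open>|h|\<close> if \<open>p\<close> is uniformly
  \<open>e\<close>-close. The square then integrates to 0, and continuity gives the pointwise
  claim.\<close>

lemma continuous_cos_coeff_zero:
  fixes h :: "real \<Rightarrow> real"
  assumes h: "continuous_on {0..1} h" and z: "\<And>m. cos_coeff h m = 0" and x: "x \<in> {0..1}"
  shows "h x = 0"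
proof -
  have ih: "integrable (lebesgue_on {0..1}) (\<lambda>x. h x * g x)" if "continuous_on {0..1} g" for g
    using h that by (intro continuous_imp_integrable_real continuous_intros)
  have z': "(LINT x|lebesgue_on {0..1}. h x * p x) = 0" if "cos_poly p" for p
    using that
  proof (induction rule: cos_poly.induct)
    case (base k)
    have "cos (real k * pi * x) = (if k = 0 then 1 else inverse (sqrt 2)) * cos_basis k x" for x
      by (auto simp: cos_basis_def)
    then have "(LINT x|lebesgue_on {0..1}. h x * cos (real k * pi * x)) =
       (LINT x|lebesgue_on {0..1}. (if k = 0 then 1 else inverse (sqrt 2)) * (h x * cos_basis k x))"
      by (simp only: mult.left_commute)
    also have "\<dots> = (if k = 0 then 1 else inverse (sqrt 2)) * cos_coeff h k"
      unfolding integral_mult_right_zero cos_coeff_def ..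
    finally show ?case by (simp add: z)
  next
    case (add f g)
    then show ?case
      using ih[OF cos_poly_continuous[OF add.hyps(1)]] ih[OF cos_poly_continuous[OF add.hyps(2)]]
      by (simp add: distrib_left)
  next
    case (scale f c)
    then show ?case by (simp add: mult.left_commute)
  qed
  have ihh: "integrable (lebesgue_on {0..1}) (\<lambda>x. h x * h x)" using ih[OF h] .
  have iah: "integrable (lebesgue_on {0..1}) (\<lambda>x. \<bar>h x\<bar>)"
    using h by (intro continuous_imp_integrable_real continuous_intros)
  define B where "B = (LINT x|lebesgue_on {0..1}. \<bar>h x\<bar>)"
  have "B \<ge> 0" unfolding B_def by simp
  have le: "(LINT x|lebesgue_on {0..1}. h x * h x) \<le> e * B" if e: "e > 0" for e
  proof -
    obtain p where p: "cos_poly p" "\<And>x. x \<in> {0..1} \<Longrightarrow> \<bar>h x - p x\<bar> < e"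
      using cos_poly_dense[OF h e] by blast
    have "(LINT x|lebesgue_on {0..1}. h x * h x) = (LINT x|lebesgue_on {0..1}. h x * h x - h x * p x)"
      using ihh ih[OF cos_poly_continuous[OF p(1)]] z'[OF p(1)] by simp
    also have "\<dots> \<le> (LINT x|lebesgue_on {0..1}. e * \<bar>h x\<bar>)"
    proof (rule integral_mono)
      fix x :: real assume "x \<in> space (lebesgue_on {0..1})"
      then have "\<bar>h x\<bar> * \<bar>h x - p x\<bar> \<le> \<bar>h x\<bar> * e"
        using p(2)[of x] by (intro mult_left_mono) auto
      then have "\<bar>h x * (h x - p x)\<bar> \<le> e * \<bar>h x\<bar>" by (simp add: abs_mult mult.commute)
      then show "h x * h x - h x * p x \<le> e * \<bar>h x\<bar>" by (simp add: algebra_simps)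
    qed (use ihh ih[OF cos_poly_continuous[OF p(1)]] iah in auto)
    also have "\<dots> = e * B" by (simp add: B_def)
    finally show ?thesis .
  qed
  have "(LINT x|lebesgue_on {0..1}. h x * h x) \<le> 0"
  proof (rule field_le_epsilon)
    fix e :: real assume e: "e > 0"
    have "(LINT x|lebesgue_on {0..1}. h x * h x) \<le> e / (B + 1) * B" using e \<open>B \<ge> 0\<close> by (intro le) simp
    also have "\<dots> \<le> e" using e \<open>B \<ge> 0\<close> by (simp add: field_simps)
    finally show "(LINT x|lebesgue_on {0..1}. h x * h x) \<le> 0 + e" by simp
  qed
  moreover have "(LINT x|lebesgue_on {0..1}. h x * h x) \<ge> 0" by simp
  ultimately have "(LINT x|lebesgue_on {0..1}. h x * h x) = 0" by linarith
  then have "((\<lambda>x. h x * h x) has_integral 0) {0..1}"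
    using has_integral_integral_lebesgue_on[OF ihh] by simp
  then have "h x * h x = 0"
    using has_integral_0_cbox_imp_0[of 0 1 "\<lambda>x. h x * h x" x] h x by (auto intro!: continuous_intros)
  then show ?thesis by simp
qed

section \<open>Expansion of Sobolev functions in cosines\<close>

lemma summable_inverse_cos_weight: "summable (\<lambda>m. inverse (cos_weight 1 m))"
proof (rule summable_comparison_test')
  show "summable (\<lambda>m. 2 * inverse ((real (Suc m))\<^sup>2))"
    using inverse_power_summable[of 2, where ?'a = real] by (intro summable_mult) (subst summable_Suc_iff, simp)
  fix m :: nat
  have "(real m)\<^sup>2 \<le> (real m * pi)\<^sup>2"
    using pi_gt3 by (simp add: power_mult_distrib mult_le_cancel_left1 one_le_power)
  moreover have "(real (Suc m))\<^sup>2 \<le> 2 * (1 + (real m)\<^sup>2)"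
    using sum_squares_bound[of "real m" 1] by (simp add: power2_eq_square algebra_simps)
  ultimately have *: "(real (Suc m))\<^sup>2 \<le> 2 * (1 + (real m * pi)\<^sup>2)"
    by (meson add_left_mono mult_left_mono order_trans zero_le_numeral)
  have "(real (Suc m))\<^sup>2 / 2 \<le> cos_weight 1 m"
    unfolding cos_weight_def div_by_1 using * by (metis mult.commute pos_divide_le_eq zero_less_numeral)
  then have "inverse (cos_weight 1 m) \<le> inverse ((real (Suc m))\<^sup>2 / 2)"
    by (intro le_imp_inverse_le) auto
  then show "norm (inverse (cos_weight 1 m)) \<le> 2 * inverse ((real (Suc m))\<^sup>2)"
    using cos_weight_ge_1[of 1 m] by (simp add: inverse_eq_divide)
qed

text \<open>Bessel's inequality and the summability of the inverse weights dominate the terms, so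
  the series converges uniformly to a continuous \<open>g\<close>. All cosine coefficients of
  \<open>f - g\<close> vanish, hence \<open>g = f\<close> at every point. The weight 1 is used
  because membership in \<open>sobolev1\<close> does not refer to a weight.\<close>

lemma cos_series_tendsto:
  assumes f: "f \<in> sobolev1" and x: "x \<in> {0..1}"
  shows "(\<lambda>M. \<Sum>m<M. cos_coeff f m * cos_basis m x) \<longlonglongrightarrow> f x"
proof -
  define u where "u = (\<lambda>m x. cos_coeff f m * cos_basis m x)"
  define B where "B = (\<lambda>m. cos_weight 1 m * (cos_coeff f m)\<^sup>2 + inverse (cos_weight 1 m))"
  have "summable (\<lambda>m. cos_weight 1 m * (cos_coeff f m)\<^sup>2)"
  proof (rule summableI_nonneg_bounded)
    show "0 \<le> cos_weight 1 m * (cos_coeff f m)\<^sup>2" for m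
      using cos_weight_ge_1[of 1 m] by simp
    show "(\<Sum>m<M. cos_weight 1 m * (cos_coeff f m)\<^sup>2) \<le> sobolev1_inner 1 f f" for M
      using sobolev1_bessel[OF f] by simp
  qed
  then have B: "summable B"
    unfolding B_def using summable_inverse_cos_weight by (rule summable_add)
  have uB: "norm (u m x) \<le> B m" for m x
  proof -
    define w where "w = cos_weight 1 m"
    have w: "w > 0" using cos_weight_ge_1[of 1 m] by (simp add: w_def)
    have "norm (u m x) \<le> \<bar>cos_coeff f m\<bar> * 2"
      using abs_cos_basis_le[of m x] sqrt2_less_2 unfolding u_def real_norm_def abs_mult
      by (intro mult_left_mono) auto
    also have "\<dots> = 2 * (sqrt w * \<bar>cos_coeff f m\<bar>) * inverse (sqrt w)"
      using w by simp
    also have "\<dots> \<le> (sqrt w * \<bar>cos_coeff f m\<bar>)\<^sup>2 + (inverse (sqrt w))\<^sup>2"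
      by (rule sum_squares_bound)
    also have "\<dots> = B m"
      using w by (simp add: B_def w_def power_mult_distrib power_inverse)
    finally show ?thesis .
  qed
  define g where "g = (\<lambda>x. \<Sum>m. u m x)"
  have ul: "uniform_limit {0..1} (\<lambda>n x. \<Sum>i<n. u i x) g sequentially"
    unfolding g_def using uB B by (intro Weierstrass_m_test)
  have contS: "continuous_on {0..1} (\<lambda>x. \<Sum>i<n. u i x)" for n
    unfolding u_def by (intro continuous_intros continuous_on_cos_basis)
  have contg: "continuous_on {0..1} g"
    using uniform_limit_theorem[OF _ ul] contS by simp
  have lim: "(\<lambda>M. \<Sum>m<M. u m y) \<longlonglongrightarrow> g y" if "y \<in> {0..1}" for y
    using tendsto_uniform_limitI[OF ul that] .
  have cf: "continuous_on {0..1} f" using sobolev1_continuous[OF f] .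
  have "cos_coeff (\<lambda>x. f x - g x) n = 0" for n
  proof -
    have bd: "norm (\<Sum>i<M. u i y) \<le> suminf B" for M y
    proof -
      have "norm (\<Sum>i<M. u i y) \<le> (\<Sum>i<M. B i)" using uB by (intro sum_norm_le) auto
      also have "\<dots> \<le> suminf B"
      proof (rule sum_le_suminf[OF B])
        fix i show "0 \<le> B i" using uB[of i 0] norm_ge_zero order_trans by blast
      qed auto
      finally show ?thesis .
    qed
    \<comment> \<open>The coefficient of the remainder converges by domination to that of
      \<open>f - g\<close>, while orthonormality makes it 0 as soon as \<open>M > n\<close>.\<close>
    have "(\<lambda>M. LINT y|lebesgue_on {0..1}. (f y - (\<Sum>i<M. u i y)) * cos_basis n y) \<longlonglongrightarrow>
       (LINT y|lebesgue_on {0..1}. (f y - g y) * cos_basis n y)"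
    proof (rule integral_dominated_convergence[where w = "\<lambda>y. (\<bar>f y\<bar> + suminf B) * sqrt 2"])
      show "(\<lambda>y. (f y - g y) * cos_basis n y) \<in> borel_measurable (lebesgue_on {0..1})"
        using cf contg by (intro continuous_imp_measurable_on_sets_lebesgue continuous_intros continuous_on_cos_basis) auto
      show "(\<lambda>y. (f y - (\<Sum>i<M. u i y)) * cos_basis n y) \<in> borel_measurable (lebesgue_on {0..1})" for M
        using cf contS by (intro continuous_imp_measurable_on_sets_lebesgue continuous_on_mult continuous_on_diff continuous_on_cos_basis) auto
      show "integrable (lebesgue_on {0..1}) (\<lambda>y. (\<bar>f y\<bar> + suminf B) * sqrt 2)"
        using cf by (intro continuous_imp_integrable_real continuous_intros)
      show "AE y in lebesgue_on {0..1}. (\<lambda>M. (f y - (\<Sum>i<M. u i y)) * cos_basis n y) \<longlonglongrightarrow> (f y - g y) * cos_basis n y"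
        using lim by (intro AE_I2) (auto intro!: tendsto_intros)
      have "norm ((f y - (\<Sum>i<M. u i y)) * cos_basis n y) \<le> (\<bar>f y\<bar> + suminf B) * sqrt 2" for M y
      proof -
        have "\<bar>f y - (\<Sum>i<M. u i y)\<bar> \<le> \<bar>f y\<bar> + suminf B" using bd[where M = M and y = y] by simp
        then show ?thesis
          using abs_cos_basis_le[of n y] unfolding real_norm_def abs_mult by (intro mult_mono) auto
      qed
      then show "AE y in lebesgue_on {0..1}. norm ((f y - (\<Sum>i<M. u i y)) * cos_basis n y) \<le> (\<bar>f y\<bar> + suminf B) * sqrt 2" for M
        by simp
    qed
    moreover have "(LINT y|lebesgue_on {0..1}. (f y - (\<Sum>i<M. u i y)) * cos_basis n y) = 0" if "M > n" for M
    proof -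
      have i1: "integrable (lebesgue_on {0..1}) (\<lambda>y. f y * cos_basis n y)"
        using sobolev1_integrable_mult[OF f cos_basis_sobolev1] .
      have i2: "integrable (lebesgue_on {0..1}) (\<lambda>y. cos_basis i y * cos_basis n y)" for i
        using sobolev1_integrable_mult[OF cos_basis_sobolev1 cos_basis_sobolev1] .
      have "(f y - (\<Sum>i<M. u i y)) * cos_basis n y = f y * cos_basis n y - (\<Sum>i<M. cos_coeff f i * (cos_basis i y * cos_basis n y))" for y
        by (simp add: u_def left_diff_distrib sum_distrib_right mult.assoc)
      then have "(LINT y|lebesgue_on {0..1}. (f y - (\<Sum>i<M. u i y)) * cos_basis n y)
        = cos_coeff f n - (\<Sum>i<M. cos_coeff f i * cos_coeff (cos_basis i) n)"
        using i1 i2 by (simp add: Bochner_Integration.integral_sum cos_coeff_def)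
      also have "(\<Sum>i<M. cos_coeff f i * cos_coeff (cos_basis i) n) = (\<Sum>i<M. if i = n then cos_coeff f n else 0)"
        by (intro sum.cong) (auto simp: cos_coeff_cos_basis)
      finally show ?thesis using that by simp
    qed
    then have "(\<lambda>M. LINT y|lebesgue_on {0..1}. (f y - (\<Sum>i<M. u i y)) * cos_basis n y) \<longlonglongrightarrow> 0"
      by (intro tendsto_eventually eventually_sequentiallyI[of "Suc n"]) auto
    ultimately show ?thesis
      unfolding cos_coeff_def using LIMSEQ_unique by blast
  qed
  then have "f x - g x = 0"
    using cf contg x by (intro continuous_cos_coeff_zero[where h = "\<lambda>x. f x - g x"] continuous_intros) auto
  then show ?thesis using lim[OF x] by (simp add: u_def)
qed

text \<open>A finite product of univariate partial sums, multiplied out, is the partial sum over a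
  cube of multi-indices.\<close>

lemma tensor_fun_tendsto:
  assumes I: "finite I" and S: "\<And>s k. s \<in> set S \<Longrightarrow> k \<in> I \<Longrightarrow> s k \<in> sobolev1" and x: "x \<in> I \<rightarrow>\<^sub>E {0..1}"
  shows "(\<lambda>M. \<Sum>\<kappa>\<in>I \<rightarrow>\<^sub>E {..<M}. tensor_coeff I S \<kappa> * (\<Prod>k\<in>I. cos_basis (\<kappa> k) (x k))) \<longlonglongrightarrow> tensor_fun I S x"
proof -
  have "(\<lambda>M. \<Sum>i<length S. \<Prod>k\<in>I. \<Sum>m<M. cos_coeff ((S ! i) k) m * cos_basis m (x k)) \<longlonglongrightarrow>
     (\<Sum>i<length S. \<Prod>k\<in>I. (S ! i) k (x k))"
    using S x by (intro tendsto_sum tendsto_prod cos_series_tendsto) auto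
  moreover have "(\<Sum>i<length S. \<Prod>k\<in>I. \<Sum>m<M. cos_coeff ((S ! i) k) m * cos_basis m (x k)) =
     (\<Sum>\<kappa>\<in>I \<rightarrow>\<^sub>E {..<M}. tensor_coeff I S \<kappa> * (\<Prod>k\<in>I. cos_basis (\<kappa> k) (x k)))" for M
    using I by (simp add: prod_sum_PiE prod.distrib tensor_coeff_def sum_list_map_conv_sum sum_distrib_right
        sum.swap[of _ "I \<rightarrow>\<^sub>E {..<M}"])
  ultimately show ?thesis
    by (simp add: tensor_fun_def sum_list_map_conv_sum)
qed

subsection \<open>Truncation of the tensor cosine series\<close>

abbreviation unit_lborel :: "real measure" where
  "unit_lborel \<equiv> restrict_space lborel {0..1}"

abbreviation box_measure :: "'i set \<Rightarrow> ('i \<Rightarrow> real) measure" where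
  "box_measure I \<equiv> PiM I (\<lambda>k. unit_lborel)"

definition cos_tensor :: "'i set \<Rightarrow> ('i \<Rightarrow> nat) \<Rightarrow> ('i \<Rightarrow> real) \<Rightarrow> real" where
  "cos_tensor I \<kappa> x = (\<Prod>k\<in>I. cos_basis (\<kappa> k) (x k))"

lemma prob_space_unit_lborel: "prob_space unit_lborel"
  by (rule prob_spaceI) (simp add: emeasure_restrict_space space_restrict_space)

lemma prob_space_box_measure: "prob_space (box_measure I)"
  by (intro prob_space_PiM prob_space_unit_lborel)

lemma space_box_measure: "space (box_measure I) = I \<rightarrow>\<^sub>E {0..1}"
  by (simp add: space_PiM space_restrict_space)

lemma measurable_unit_lborel:
  fixes f :: "real \<Rightarrow> real"
  assumes "continuous_on {0..1} f"
  shows "f \<in> borel_measurable unit_lborel"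
proof -
  have "f \<in> borel_measurable (restrict_space borel {0..1})"
    using assms by (rule borel_measurable_continuous_on_restrict)
  then show ?thesis
    by (subst measurable_cong_sets[OF sets_restrict_space_cong[OF sets_lborel] refl])
qed

text \<open>Bridges two measures: \<open>sobolev1_inner\<close> integrates over
  \<open>lebesgue_on\<close>, whereas \<open>cube_measure\<close> is a product of restrictions of
  \<open>lborel\<close>.\<close>

lemma
  fixes f :: "real \<Rightarrow> real"
  assumes f: "continuous_on {0..1} f"
  shows integrable_unit_lborel: "integrable unit_lborel f"
    and integral_lebesgue_on_unit: "(LINT x|lebesgue_on {0..1}. f x) = (LINT x|unit_lborel. f x)"
proof -
  have m: "(\<lambda>x. indicator {0..1} x *\<^sub>R f x) \<in> borel_measurable lborel"
    using borel_measurable_continuous_on_indicator[OF _ f] by simp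
  have "integrable (lebesgue_on {0..1}) f"
    using f by (rule continuous_imp_integrable_real)
  then have "integrable lebesgue (\<lambda>x. indicator {0..1} x *\<^sub>R f x)"
    by (subst (asm) integrable_restrict_space) auto
  then have "integrable lborel (\<lambda>x. indicator {0..1} x *\<^sub>R f x)"
    using m by (simp add: integrable_completion)
  then show "integrable unit_lborel f"
    by (subst integrable_restrict_space) auto
  have "(LINT x|lebesgue_on {0..1}. f x) = (LINT x|lebesgue. indicator {0..1} x *\<^sub>R f x)"
    by (subst integral_restrict_space) auto
  also have "\<dots> = (LINT x|lborel. indicator {0..1} x *\<^sub>R f x)"
    using m by (rule integral_completion)
  also have "\<dots> = (LINT x|unit_lborel. f x)"
    by (subst integral_restrict_space) auto
  finally show "(LINT x|lebesgue_on {0..1}. f x) = (LINT x|unit_lborel. f x)" .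
qed

lemma measurable_box_component:
  fixes f :: "real \<Rightarrow> real"
  assumes "continuous_on {0..1} f" "k \<in> I"
  shows "(\<lambda>x. f (x k)) \<in> borel_measurable (box_measure I)"
  using measurable_compose[OF measurable_component_singleton[OF assms(2), of "\<lambda>_. unit_lborel"] measurable_unit_lborel[OF assms(1)]] .

lemma measurable_cos_tensor: "cos_tensor I \<kappa> \<in> borel_measurable (box_measure I)"
  unfolding cos_tensor_def[abs_def]
  by (intro borel_measurable_prod measurable_box_component continuous_on_cos_basis)

lemma measurable_tensor_fun:
  assumes "\<And>s k. s \<in> set S \<Longrightarrow> k \<in> I \<Longrightarrow> s k \<in> sobolev1"
  shows "tensor_fun I S \<in> borel_measurable (box_measure I)"
  unfolding tensor_fun_def[abs_def] sum_list_map_conv_sum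
  using assms by (intro borel_measurable_sum borel_measurable_prod measurable_box_component sobolev1_continuous) auto

text \<open>By Fubini the integral factorises over the coordinates. The integral form of the
  coefficient is the one that passes to limits of representing sequences.\<close>

lemma
  assumes I: "finite I" and S: "\<And>s k. s \<in> set S \<Longrightarrow> k \<in> I \<Longrightarrow> s k \<in> sobolev1"
  shows integrable_tensor_fun_cos_tensor: "integrable (box_measure I) (\<lambda>x. tensor_fun I S x * cos_tensor I \<kappa> x)"
    and integral_tensor_fun_cos_tensor: "(LINT x|box_measure I. tensor_fun I S x * cos_tensor I \<kappa> x) = tensor_coeff I S \<kappa>"
proof -
  interpret product_sigma_finite "\<lambda>_. unit_lborel"
    by (intro product_sigma_finite.intro prob_space_imp_sigma_finite prob_space_unit_lborel)
  have eq: "tensor_fun I S x * cos_tensor I \<kappa> x = (\<Sum>i<length S. \<Prod>k\<in>I. (S ! i) k (x k) * cos_basis (\<kappa> k) (x k))" for x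
    by (simp add: tensor_fun_def cos_tensor_def sum_list_map_conv_sum sum_distrib_right prod.distrib)
  have c: "continuous_on {0..1} (\<lambda>y. (S ! i) k y * cos_basis (\<kappa> k) y)" if "i < length S" "k \<in> I" for i k
    using S that by (intro continuous_intros continuous_on_cos_basis sobolev1_continuous) auto
  have int: "integrable (box_measure I) (\<lambda>x. \<Prod>k\<in>I. (S ! i) k (x k) * cos_basis (\<kappa> k) (x k))" if "i < length S" for i
    using I c that by (intro product_integrable_prod integrable_unit_lborel) auto
  then show "integrable (box_measure I) (\<lambda>x. tensor_fun I S x * cos_tensor I \<kappa> x)"
    unfolding eq by (intro Bochner_Integration.integrable_sum) auto
  have "(LINT x|box_measure I. (\<Prod>k\<in>I. (S ! i) k (x k) * cos_basis (\<kappa> k) (x k))) = (\<Prod>k\<in>I. cos_coeff ((S ! i) k) (\<kappa> k))"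
    if "i < length S" for i
    using I c[OF that]
    by (subst product_integral_prod) (auto simp: cos_coeff_def integral_lebesgue_on_unit intro!: integrable_unit_lborel prod.cong)
  then show "(LINT x|box_measure I. tensor_fun I S x * cos_tensor I \<kappa> x) = tensor_coeff I S \<kappa>"
    unfolding eq using int by (simp add: tensor_coeff_def sum_list_map_conv_sum)
qed

text \<open>
  A bound for the squared \<^const>\<open>cos_basis\<close> function divided by its squared Sobolev norm, uniformly on the interval.
\<close>

definition cos_mass :: "real \<Rightarrow> nat \<Rightarrow> real" where
  "cos_mass c m = (if m = 0 then 1 else 2 / cos_weight c m)"

lemma cos_mass_pos: "c > 0 \<Longrightarrow> cos_mass c m > 0"
  using cos_weight_ge_1[of c m] by (simp add: cos_mass_def)

lemma cos_basis_sq_div_weight_le: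
  assumes "c > 0"
  shows "(cos_basis m x)\<^sup>2 / cos_weight c m \<le> cos_mass c m"
  using cos_basis_sq_le[of m x] cos_weight_ge_1[OF assms, of m]
  by (auto simp: cos_mass_def cos_weight_def[of c 0] divide_right_mono split: if_splits)

abbreviation tensor_mass :: "'i set \<Rightarrow> ('i \<Rightarrow> real) \<Rightarrow> ('i \<Rightarrow> nat) \<Rightarrow> real" where
  "tensor_mass I c \<kappa> \<equiv> (\<Prod>k\<in>I. cos_mass (c k) (\<kappa> k))"

text \<open>Cauchy-Schwarz after splitting each term by \<open>sqrt (w \<kappa>)\<close>: Bessel's
  inequality bounds the sum of the coefficients, and the masses bound the other sum uniformly in
  \<open>x\<close>.\<close>

lemma cos_tensor_sum_le:
  assumes I: "finite I" "\<And>k. k \<in> I \<Longrightarrow> c k > 0"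
    and S: "\<And>s k. s \<in> set S \<Longrightarrow> k \<in> I \<Longrightarrow> s k \<in> sobolev1"
    and K: "finite K" "K \<subseteq> I \<rightarrow>\<^sub>E UNIV"
  shows "(\<Sum>\<kappa>\<in>K. tensor_coeff I S \<kappa> * cos_tensor I \<kappa> x)\<^sup>2 \<le> (\<Sum>\<kappa>\<in>K. tensor_mass I c \<kappa>) * sob_tensor_inner I c S S"
proof -
  define w where "w = (\<lambda>\<kappa>. \<Prod>k\<in>I. cos_weight (c k) (\<kappa> k))"
  have w: "w \<kappa> > 0" for \<kappa>
    unfolding w_def using I(2) cos_weight_ge_1 by (intro prod_pos) (meson less_le_trans zero_less_one)
  have "(\<Sum>\<kappa>\<in>K. tensor_coeff I S \<kappa> * cos_tensor I \<kappa> x)\<^sup>2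
     = (\<Sum>\<kappa>\<in>K. (sqrt (w \<kappa>) * tensor_coeff I S \<kappa>) * (cos_tensor I \<kappa> x / sqrt (w \<kappa>)))\<^sup>2"
    using w by (simp add: less_imp_neq[OF w, symmetric])
  also have "\<dots> \<le> (\<Sum>\<kappa>\<in>K. (sqrt (w \<kappa>) * tensor_coeff I S \<kappa>)\<^sup>2) * (\<Sum>\<kappa>\<in>K. (cos_tensor I \<kappa> x / sqrt (w \<kappa>))\<^sup>2)"
    by (rule Cauchy_Schwarz_ineq_sum)
  also have "(\<Sum>\<kappa>\<in>K. (sqrt (w \<kappa>) * tensor_coeff I S \<kappa>)\<^sup>2) = (\<Sum>\<kappa>\<in>K. w \<kappa> * (tensor_coeff I S \<kappa>)\<^sup>2)"
    using w by (simp add: power_mult_distrib less_imp_le)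
  also have "(\<Sum>\<kappa>\<in>K. (cos_tensor I \<kappa> x / sqrt (w \<kappa>))\<^sup>2) = (\<Sum>\<kappa>\<in>K. (cos_tensor I \<kappa> x)\<^sup>2 / w \<kappa>)"
    using w by (simp add: power_divide less_imp_le)
  also have "(\<Sum>\<kappa>\<in>K. w \<kappa> * (tensor_coeff I S \<kappa>)\<^sup>2) * (\<Sum>\<kappa>\<in>K. (cos_tensor I \<kappa> x)\<^sup>2 / w \<kappa>)
      \<le> sob_tensor_inner I c S S * (\<Sum>\<kappa>\<in>K. tensor_mass I c \<kappa>)"
  proof (rule mult_mono)
    show "(\<Sum>\<kappa>\<in>K. w \<kappa> * (tensor_coeff I S \<kappa>)\<^sup>2) \<le> sob_tensor_inner I c S S"
      unfolding w_def using assms by (rule sob_tensor_bessel)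
    show "(\<Sum>\<kappa>\<in>K. (cos_tensor I \<kappa> x)\<^sup>2 / w \<kappa>) \<le> (\<Sum>\<kappa>\<in>K. tensor_mass I c \<kappa>)"
    proof (rule sum_mono)
      fix \<kappa>
      have "(cos_tensor I \<kappa> x)\<^sup>2 / w \<kappa> = (\<Prod>k\<in>I. (cos_basis (\<kappa> k) (x k))\<^sup>2 / cos_weight (c k) (\<kappa> k))"
        by (simp add: cos_tensor_def w_def prod_power_distrib prod_dividef)
      also have "\<dots> \<le> tensor_mass I c \<kappa>"
        using I(2) cos_weight_ge_1 by (intro prod_mono) (auto intro!: cos_basis_sq_div_weight_le divide_nonneg_nonneg simp: less_imp_le[OF less_le_trans[OF zero_less_one]])
      finally show "(cos_tensor I \<kappa> x)\<^sup>2 / w \<kappa> \<le> tensor_mass I c \<kappa>" .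
    qed
    show "0 \<le> sob_tensor_inner I c S S" using I S by (rule sob_tensor_inner_self_nonneg)
    show "0 \<le> (\<Sum>\<kappa>\<in>K. (cos_tensor I \<kappa> x)\<^sup>2 / w \<kappa>)" using w by (intro sum_nonneg) (simp add: less_imp_le)
  qed
  finally show ?thesis by (simp add: mult.commute)
qed

text \<open>The tail of the series is expressed through finite sets outside \<open>T\<close>. The
  bound holds for the partial sums over growing cubes and survives the limit.\<close>

lemma tensor_fun_remainder_le:
  assumes I: "finite I" "\<And>k. k \<in> I \<Longrightarrow> c k > 0"
    and S: "\<And>s k. s \<in> set S \<Longrightarrow> k \<in> I \<Longrightarrow> s k \<in> sobolev1"
    and T: "finite T" "T \<subseteq> I \<rightarrow>\<^sub>E UNIV"
    and t: "\<And>K. finite K \<Longrightarrow> K \<subseteq> (I \<rightarrow>\<^sub>E UNIV) - T \<Longrightarrow> (\<Sum>\<kappa>\<in>K. tensor_mass I c \<kappa>) \<le> t"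
    and x: "x \<in> I \<rightarrow>\<^sub>E {0..1}"
  shows "(tensor_fun I S x - (\<Sum>\<kappa>\<in>T. tensor_coeff I S \<kappa> * cos_tensor I \<kappa> x))\<^sup>2 \<le> t * sob_tensor_inner I c S S"
proof (rule LIMSEQ_le_const2)
  let ?g = "\<lambda>\<kappa>. tensor_coeff I S \<kappa> * cos_tensor I \<kappa> x"
  let ?B = "\<lambda>M::nat. I \<rightarrow>\<^sub>E {..<M}"
  show "(\<lambda>M. ((\<Sum>\<kappa>\<in>?B M. ?g \<kappa>) - (\<Sum>\<kappa>\<in>T. ?g \<kappa>))\<^sup>2) \<longlonglongrightarrow> (tensor_fun I S x - (\<Sum>\<kappa>\<in>T. ?g \<kappa>))\<^sup>2"
    unfolding cos_tensor_def by (intro tendsto_intros tensor_fun_tendsto I S x)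
  define N where "N = Suc (Max (\<Union>\<kappa>\<in>T. insert 0 (\<kappa> ` I)))"
  have TB: "T \<subseteq> ?B M" if M: "M \<ge> N" for M
  proof
    fix \<kappa> assume \<kappa>: "\<kappa> \<in> T"
    have "\<kappa> k < M" if "k \<in> I" for k
    proof -
      have "\<kappa> k \<le> Max (\<Union>\<kappa>\<in>T. insert 0 (\<kappa> ` I))" using \<kappa> that T I by (intro Max_ge) auto
      then show ?thesis using M by (simp add: N_def)
    qed
    then show "\<kappa> \<in> ?B M" using \<kappa> T by (auto simp: PiE_iff subset_iff)
  qed
  show "\<exists>N. \<forall>M\<ge>N. ((\<Sum>\<kappa>\<in>?B M. ?g \<kappa>) - (\<Sum>\<kappa>\<in>T. ?g \<kappa>))\<^sup>2 \<le> t * sob_tensor_inner I c S S"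
  proof (intro exI[of _ N] allI impI)
    fix M assume "M \<ge> N"
    have fB: "finite (?B M)" using I by (intro finite_PiE) auto
    have "((\<Sum>\<kappa>\<in>?B M. ?g \<kappa>) - (\<Sum>\<kappa>\<in>T. ?g \<kappa>))\<^sup>2 = (\<Sum>\<kappa>\<in>?B M - T. ?g \<kappa>)\<^sup>2"
      using TB[OF \<open>M \<ge> N\<close>] fB by (simp add: sum_diff)
    also have "\<dots> \<le> (\<Sum>\<kappa>\<in>?B M - T. tensor_mass I c \<kappa>) * sob_tensor_inner I c S S"
      using fB by (intro cos_tensor_sum_le I S) (auto simp: PiE_iff)
    also have "\<dots> \<le> t * sob_tensor_inner I c S S"
      using fB by (intro mult_right_mono t sob_tensor_inner_self_nonneg I S) (auto simp: PiE_iff)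
    finally show "((\<Sum>\<kappa>\<in>?B M. ?g \<kappa>) - (\<Sum>\<kappa>\<in>T. ?g \<kappa>))\<^sup>2 \<le> t * sob_tensor_inner I c S S" .
  qed
qed

section \<open>Passage to the completed tensor product\<close>

abbreviation sob_tensor where
  "sob_tensor I c \<equiv> hilbert_tensor I {0..1} (\<lambda>k. sobolev1) (\<lambda>k. sobolev1_inner (c k))"

abbreviation sob_tensor_norm where
  "sob_tensor_norm I c \<equiv> hilbert_tensor_norm I {0..1} (\<lambda>k. sobolev1) (\<lambda>k. sobolev1_inner (c k))"

abbreviation sob_represents where
  "sob_represents I c \<equiv> tensor_represents I {0..1} (\<lambda>k. sobolev1) (\<lambda>k. sobolev1_inner (c k))"

text \<open>An integral of the function itself, so that its value does not depend on the choice of a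
  representing sequence.\<close>

definition box_coeff :: "'i set \<Rightarrow> ('i \<Rightarrow> nat) \<Rightarrow> (('i \<Rightarrow> real) \<Rightarrow> real) \<Rightarrow> real" where
  "box_coeff I \<kappa> f = (LINT x|box_measure I. f x * cos_tensor I \<kappa> x)"

lemma abs_cos_tensor_le: "finite I \<Longrightarrow> \<bar>cos_tensor I \<kappa> x\<bar> \<le> sqrt 2 ^ card I"
  unfolding cos_tensor_def abs_prod using abs_cos_basis_le
  by (simp add: prod_le_power real_sqrt_ge_one)

text \<open>The constant \<open>t0\<close> bounds the total mass through finite sums. Functions in
  the space are therefore bounded on the cube by \<open>sqrt t0\<close> times their norm.\<close>

locale sob_tensor_space =
  fixes I :: "'i set" and c :: "'i \<Rightarrow> real" and t0 :: real
  assumes I: "finite I" and c: "\<And>k. k \<in> I \<Longrightarrow> c k > 0"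
    and t0: "\<And>K. finite K \<Longrightarrow> K \<subseteq> I \<rightarrow>\<^sub>E UNIV \<Longrightarrow> (\<Sum>\<kappa>\<in>K. tensor_mass I c \<kappa>) \<le> t0"
begin

lemma represents_factors:
  "sob_represents I c X f \<Longrightarrow> s \<in> set (X n) \<Longrightarrow> k \<in> I \<Longrightarrow> s k \<in> sobolev1"
  by (simp add: tensor_represents_def)

text \<open>The remainder estimate with the empty set retained. The resulting bound is uniform in
  \<open>n\<close>, as dominated convergence on the cube demands.\<close>

lemma represents_bounded:
  assumes X: "sob_represents I c X f"
  obtains B where "\<And>n x. x \<in> I \<rightarrow>\<^sub>E {0..1} \<Longrightarrow> \<bar>tensor_fun I (X n) x\<bar> \<le> B"
proof -
  have "convergent (\<lambda>n. sqrt (sob_tensor_inner I c (X n) (X n)))"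
    by (rule sob_tensor_norms_convergent[OF I c X])
  then have "Bseq (\<lambda>n. sqrt (sob_tensor_inner I c (X n) (X n)))"
    by (rule convergent_imp_Bseq)
  then obtain b where b: "b > 0" "\<And>n. norm (sqrt (sob_tensor_inner I c (X n) (X n))) \<le> b"
    using BseqE by blast
  have t0': "t0 \<ge> 0" using t0[of "{}"] by simp
  have "\<bar>tensor_fun I (X n) x\<bar> \<le> sqrt t0 * b" if x: "x \<in> I \<rightarrow>\<^sub>E {0..1}" for n x
  proof -
    have "(tensor_fun I (X n) x - (\<Sum>\<kappa>\<in>{}. tensor_coeff I (X n) \<kappa> * cos_tensor I \<kappa> x))\<^sup>2 \<le> t0 * sob_tensor_inner I c (X n) (X n)"
      using t0 by (intro tensor_fun_remainder_le I c represents_factors[OF X] x) auto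
    then have "sqrt ((tensor_fun I (X n) x)\<^sup>2) \<le> sqrt (t0 * sob_tensor_inner I c (X n) (X n))"
      by (intro real_sqrt_le_mono) simp
    also have "\<dots> = sqrt t0 * sqrt (sob_tensor_inner I c (X n) (X n))" by (rule real_sqrt_mult)
    also have "\<dots> \<le> sqrt t0 * b" using b(2)[of n] t0' by (intro mult_left_mono) auto
    finally show ?thesis by simp
  qed
  then show ?thesis using that by blast
qed

lemma represents_measurable:
  assumes X: "sob_represents I c X f"
  shows "f \<in> borel_measurable (box_measure I)"
proof (rule borel_measurable_LIMSEQ_real)
  show "tensor_fun I (X n) \<in> borel_measurable (box_measure I)" for n
    by (intro measurable_tensor_fun represents_factors[OF X])
  show "(\<lambda>n. tensor_fun I (X n) x) \<longlonglongrightarrow> f x" if "x \<in> space (box_measure I)" for x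
    using X that unfolding space_box_measure by (simp add: tensor_represents_def)
qed

lemma
  assumes X: "sob_represents I c X f"
  shows represents_integrable: "integrable (box_measure I) (\<lambda>x. f x * cos_tensor I \<kappa> x)"
    and represents_coeff_tendsto: "(\<lambda>n. tensor_coeff I (X n) \<kappa>) \<longlonglongrightarrow> box_coeff I \<kappa> f"
proof -
  interpret prob_space "box_measure I" by (rule prob_space_box_measure)
  obtain B where B: "\<And>n x. x \<in> I \<rightarrow>\<^sub>E {0..1} \<Longrightarrow> \<bar>tensor_fun I (X n) x\<bar> \<le> B"
    using represents_bounded[OF X] by blast
  have lim: "AE x in box_measure I. (\<lambda>n. tensor_fun I (X n) x * cos_tensor I \<kappa> x) \<longlonglongrightarrow> f x * cos_tensor I \<kappa> x"
    using X by (intro AE_I2 tendsto_intros) (simp add: space_box_measure tensor_represents_def)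
  have bd: "AE x in box_measure I. norm (tensor_fun I (X n) x * cos_tensor I \<kappa> x) \<le> B * sqrt 2 ^ card I" for n
  proof (rule AE_I2)
    fix x assume "x \<in> space (box_measure I)"
    then have "\<bar>tensor_fun I (X n) x\<bar> \<le> B" using B by (simp add: space_box_measure)
    then show "norm (tensor_fun I (X n) x * cos_tensor I \<kappa> x) \<le> B * sqrt 2 ^ card I"
      unfolding real_norm_def abs_mult using abs_cos_tensor_le[OF I] by (intro mult_mono) (auto intro: order_trans)
  qed
  have m: "(\<lambda>x. tensor_fun I (X n) x * cos_tensor I \<kappa> x) \<in> borel_measurable (box_measure I)" for n
    by (intro borel_measurable_times measurable_tensor_fun measurable_cos_tensor represents_factors[OF X])
  have mf: "(\<lambda>x. f x * cos_tensor I \<kappa> x) \<in> borel_measurable (box_measure I)"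
    by (intro borel_measurable_times represents_measurable[OF X] measurable_cos_tensor)
  show "integrable (box_measure I) (\<lambda>x. f x * cos_tensor I \<kappa> x)"
    by (rule integrable_dominated_convergence[OF mf m _ lim bd]) simp
  have "(\<lambda>n. LINT x|box_measure I. tensor_fun I (X n) x * cos_tensor I \<kappa> x) \<longlonglongrightarrow> (LINT x|box_measure I. f x * cos_tensor I \<kappa> x)"
    by (rule integral_dominated_convergence[OF mf m _ lim bd]) simp
  then show "(\<lambda>n. tensor_coeff I (X n) \<kappa>) \<longlonglongrightarrow> box_coeff I \<kappa> f"
    unfolding box_coeff_def using integral_tensor_fun_cos_tensor[OF I] represents_factors[OF X] by simp
qed

lemma represents_norm_exists:
  assumes X: "sob_represents I c X f"
  shows "\<exists>r. (\<lambda>n. sqrt (sob_tensor_inner I c (X n) (X n))) \<longlonglongrightarrow> r"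
  using sob_tensor_norms_convergent[OF I c X] by (simp add: convergent_def)

lemma represents_inner_tendsto:
  assumes X: "sob_represents I c X f" and r: "(\<lambda>n. sqrt (sob_tensor_inner I c (X n) (X n))) \<longlonglongrightarrow> r"
  shows "r \<ge> 0" "(\<lambda>n. sob_tensor_inner I c (X n) (X n)) \<longlonglongrightarrow> r\<^sup>2"
proof -
  have nn: "sob_tensor_inner I c (X n) (X n) \<ge> 0" for n
    by (intro sob_tensor_inner_self_nonneg I c represents_factors[OF X])
  show "r \<ge> 0" using r by (rule LIMSEQ_le_const) (simp add: nn)
  show "(\<lambda>n. sob_tensor_inner I c (X n) (X n)) \<longlonglongrightarrow> r\<^sup>2"
    using tendsto_power[OF r, of 2] nn by simp
qed

lemma represents_remainder_le:
  assumes X: "sob_represents I c X f" and r: "(\<lambda>n. sqrt (sob_tensor_inner I c (X n) (X n))) \<longlonglongrightarrow> r"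
    and T: "finite T" "T \<subseteq> I \<rightarrow>\<^sub>E UNIV"
    and t: "\<And>K. finite K \<Longrightarrow> K \<subseteq> (I \<rightarrow>\<^sub>E UNIV) - T \<Longrightarrow> (\<Sum>\<kappa>\<in>K. tensor_mass I c \<kappa>) \<le> t"
    and x: "x \<in> I \<rightarrow>\<^sub>E {0..1}"
  shows "\<bar>f x - (\<Sum>\<kappa>\<in>T. box_coeff I \<kappa> f * cos_tensor I \<kappa> x)\<bar> \<le> sqrt t * r"
proof -
  have "(f x - (\<Sum>\<kappa>\<in>T. box_coeff I \<kappa> f * cos_tensor I \<kappa> x))\<^sup>2 \<le> t * r\<^sup>2"
  proof (rule LIMSEQ_le)
    have "(\<lambda>n. tensor_fun I (X n) x) \<longlonglongrightarrow> f x" using X x by (simp add: tensor_represents_def)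
    then show "(\<lambda>n. (tensor_fun I (X n) x - (\<Sum>\<kappa>\<in>T. tensor_coeff I (X n) \<kappa> * cos_tensor I \<kappa> x))\<^sup>2) \<longlonglongrightarrow>
       (f x - (\<Sum>\<kappa>\<in>T. box_coeff I \<kappa> f * cos_tensor I \<kappa> x))\<^sup>2"
      by (intro tendsto_intros represents_coeff_tendsto[OF X])
    show "(\<lambda>n. t * sob_tensor_inner I c (X n) (X n)) \<longlonglongrightarrow> t * r\<^sup>2"
      by (intro tendsto_intros represents_inner_tendsto[OF X r])
    show "\<exists>N. \<forall>n\<ge>N. (tensor_fun I (X n) x - (\<Sum>\<kappa>\<in>T. tensor_coeff I (X n) \<kappa> * cos_tensor I \<kappa> x))\<^sup>2
        \<le> t * sob_tensor_inner I c (X n) (X n)"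
      by (intro exI allI impI tensor_fun_remainder_le I c represents_factors[OF X] T t x)
  qed
  then have "sqrt ((f x - (\<Sum>\<kappa>\<in>T. box_coeff I \<kappa> f * cos_tensor I \<kappa> x))\<^sup>2) \<le> sqrt (t * r\<^sup>2)"
    by (rule real_sqrt_le_mono)
  then show ?thesis using represents_inner_tendsto(1)[OF X r] by (simp add: real_sqrt_mult)
qed

text \<open>Bessel's inequality for the single multi-index \<open>\<kappa>\<close>, whose weight is
  at least 1, followed by a limit.\<close>

lemma abs_box_coeff_le:
  assumes X: "sob_represents I c X f" and r: "(\<lambda>n. sqrt (sob_tensor_inner I c (X n) (X n))) \<longlonglongrightarrow> r"
    and \<kappa>: "\<kappa> \<in> I \<rightarrow>\<^sub>E UNIV"
  shows "\<bar>box_coeff I \<kappa> f\<bar> \<le> r"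
proof -
  have "(box_coeff I \<kappa> f)\<^sup>2 \<le> r\<^sup>2"
  proof (rule LIMSEQ_le)
    show "(\<lambda>n. (tensor_coeff I (X n) \<kappa>)\<^sup>2) \<longlonglongrightarrow> (box_coeff I \<kappa> f)\<^sup>2"
      by (intro tendsto_intros represents_coeff_tendsto[OF X])
    show "(\<lambda>n. sob_tensor_inner I c (X n) (X n)) \<longlonglongrightarrow> r\<^sup>2"
      by (rule represents_inner_tendsto[OF X r])
    have "(tensor_coeff I (X n) \<kappa>)\<^sup>2 \<le> sob_tensor_inner I c (X n) (X n)" for n
    proof -
      have "1 \<le> (\<Prod>k\<in>I. cos_weight (c k) (\<kappa> k))" using c cos_weight_ge_1 by (intro prod_ge_1) auto
      then have "1 * (tensor_coeff I (X n) \<kappa>)\<^sup>2 \<le> (\<Prod>k\<in>I. cos_weight (c k) (\<kappa> k)) * (tensor_coeff I (X n) \<kappa>)\<^sup>2"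
        by (intro mult_right_mono) auto
      also have "\<dots> \<le> sob_tensor_inner I c (X n) (X n)"
      proof -
        have "(\<Sum>\<kappa>\<in>{\<kappa>}. (\<Prod>k\<in>I. cos_weight (c k) (\<kappa> k)) * (tensor_coeff I (X n) \<kappa>)\<^sup>2) \<le> sob_tensor_inner I c (X n) (X n)"
          using \<kappa> by (intro sob_tensor_bessel I c represents_factors[OF X]) auto
        then show ?thesis by simp
      qed
      finally show ?thesis by simp
    qed
    then show "\<exists>N. \<forall>n\<ge>N. (tensor_coeff I (X n) \<kappa>)\<^sup>2 \<le> sob_tensor_inner I c (X n) (X n)" by blast
  qed
  then show ?thesis using represents_inner_tendsto(1)[OF X r] by (metis abs_le_square_iff abs_of_nonneg)
qed

text \<open>Replaces the infimum in the norm by a concrete sequence whose limit norm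
  \<open>r\<close> the preceding estimates accept.\<close>

lemma sob_tensor_norm_lessE:
  assumes f: "f \<in> sob_tensor I c" and b: "sob_tensor_norm I c f < b"
  obtains X r where "sob_represents I c X f" "(\<lambda>n. sqrt (sob_tensor_inner I c (X n) (X n))) \<longlonglongrightarrow> r" "r < b"
proof -
  let ?R = "{r. \<exists>X. sob_represents I c X f \<and> (\<lambda>n. sqrt (sob_tensor_inner I c (X n) (X n))) \<longlonglongrightarrow> r}"
  have "?R \<noteq> {}" using f represents_norm_exists by (fastforce simp: hilbert_tensor_def)
  then have "\<exists>r\<in>?R. r < b" using b unfolding hilbert_tensor_norm_def by (rule cInf_lessD)
  then show ?thesis using that by blast
qed

lemma box_coeff_continuous_functional:
  assumes \<kappa>: "\<kappa> \<in> I \<rightarrow>\<^sub>E UNIV"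
  shows "box_coeff I \<kappa> \<in> continuous_functionals (sob_tensor I c) (sob_tensor_norm I c)"
  unfolding continuous_functionals_def
proof (intro CollectI conjI ballI allI exI[of _ 1])
  fix f g :: "('i \<Rightarrow> real) \<Rightarrow> real" and a b :: real
  assume "f \<in> sob_tensor I c" "g \<in> sob_tensor I c"
  then have "integrable (box_measure I) (\<lambda>x. f x * cos_tensor I \<kappa> x)" "integrable (box_measure I) (\<lambda>x. g x * cos_tensor I \<kappa> x)"
    using represents_integrable by (auto simp: hilbert_tensor_def)
  then show "box_coeff I \<kappa> (\<lambda>x. a * f x + b * g x) = a * box_coeff I \<kappa> f + b * box_coeff I \<kappa> g"
    by (simp add: box_coeff_def distrib_right mult.assoc)
next
  fix f assume f: "f \<in> sob_tensor I c"
  show "\<bar>box_coeff I \<kappa> f\<bar> \<le> 1 * sob_tensor_norm I c f"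
  proof (rule ccontr)
    assume "\<not> ?thesis"
    then have "sob_tensor_norm I c f < \<bar>box_coeff I \<kappa> f\<bar>" by simp
    from sob_tensor_norm_lessE[OF f this] obtain X r where
      "sob_represents I c X f" "(\<lambda>n. sqrt (sob_tensor_inner I c (X n) (X n))) \<longlonglongrightarrow> r" "r < \<bar>box_coeff I \<kappa> f\<bar>" .
    then show False using abs_box_coeff_le[OF _ _ \<kappa>] by fastforce
  qed
qed

lemma Linf_norm_le:
  assumes "f \<in> borel_measurable M" "\<And>x. x \<in> space M \<Longrightarrow> \<bar>f x\<bar> \<le> b"
  shows "Linf_norm M f \<le> ereal b"
  unfolding Linf_norm_def using assms by (intro esssup_I AE_I2) auto

lemma cos_tensor_in_Linf: "cos_tensor I \<kappa> \<in> Linf (box_measure I)"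
  using Linf_norm_le[OF measurable_cos_tensor abs_cos_tensor_le[OF I], of \<kappa>]
  by (auto simp: Linf_def measurable_cos_tensor intro: le_less_trans)

text \<open>The algorithm is the truncated cosine series: its functionals are the coefficients with
  indices in \<open>T\<close> and its output functions the corresponding tensor cosines.\<close>

lemma minimal_error_le:
  assumes T: "finite T" "T \<subseteq> I \<rightarrow>\<^sub>E UNIV"
    and t: "\<And>K. finite K \<Longrightarrow> K \<subseteq> (I \<rightarrow>\<^sub>E UNIV) - T \<Longrightarrow> (\<Sum>\<kappa>\<in>K. tensor_mass I c \<kappa>) \<le> t"
  shows "minimal_error (sob_tensor I c) (sob_tensor_norm I c) (box_measure I) (card T) \<le> ereal (sqrt t)"
proof -
  obtain h where h: "bij_betw h {1..card T} T"
    using ex_bij_betw_nat_finite_1[OF T(1)] by blast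
  define A where "A = (\<lambda>f x. \<Sum>j=1..card T. box_coeff I (h j) f * cos_tensor I (h j) x)"
  have A: "A f x = (\<Sum>\<kappa>\<in>T. box_coeff I \<kappa> f * cos_tensor I \<kappa> x)" for f x
    unfolding A_def using sum.reindex_bij_betw[OF h] .
  have "A \<in> linear_algorithms (sob_tensor I c) (sob_tensor_norm I c) (box_measure I) (card T)"
    unfolding linear_algorithms_def
  proof (intro CollectI exI conjI ballI)
    fix j assume "j \<in> {1..card T}"
    then have "h j \<in> T" using h by (meson bij_betwE)
    then have "h j \<in> I \<rightarrow>\<^sub>E UNIV" using T(2) by blast
    then show "box_coeff I (h j) \<in> continuous_functionals (sob_tensor I c) (sob_tensor_norm I c)"
      by (rule box_coeff_continuous_functional)
    show "cos_tensor I (h j) \<in> Linf (box_measure I)" by (rule cos_tensor_in_Linf)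
  qed (simp add: A_def)
  then have "minimal_error (sob_tensor I c) (sob_tensor_norm I c) (box_measure I) (card T)
     \<le> (SUP f \<in> {f \<in> sob_tensor I c. sob_tensor_norm I c f \<le> 1}. Linf_norm (box_measure I) (\<lambda>x. f x - A f x))"
    unfolding minimal_error_def by (rule INF_lower)
  also have "\<dots> \<le> ereal (sqrt t)"
  proof (rule SUP_least)
    fix f assume "f \<in> {f \<in> sob_tensor I c. sob_tensor_norm I c f \<le> 1}"
    then have f: "f \<in> sob_tensor I c" "sob_tensor_norm I c f \<le> 1" by auto
    then obtain X where X: "sob_represents I c X f" by (auto simp: hilbert_tensor_def)
    have t': "t \<ge> 0" using t[of "{}"] by simp
    show "Linf_norm (box_measure I) (\<lambda>x. f x - A f x) \<le> ereal (sqrt t)"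
    proof (rule Linf_norm_le)
      show "(\<lambda>x. f x - A f x) \<in> borel_measurable (box_measure I)"
        unfolding A by (intro borel_measurable_diff represents_measurable[OF X] borel_measurable_sum
            borel_measurable_times borel_measurable_const measurable_cos_tensor)
      fix x assume "x \<in> space (box_measure I)"
      then have x: "x \<in> I \<rightarrow>\<^sub>E {0..1}" by (simp add: space_box_measure)
      show "\<bar>f x - A f x\<bar> \<le> sqrt t"
      proof (rule field_le_epsilon)
        fix e :: real assume e: "e > 0"
        \<comment> \<open>A norm of at most 1 is an infimum of limits \<open>r\<close>, so
          \<open>r\<close> may exceed 1 slightly; the slack is scaled so that
          \<open>sqrt t * r\<close> exceeds \<open>sqrt t\<close> by at most
          \<open>e\<close>.\<close>
        have "sob_tensor_norm I c f < 1 + e / (sqrt t + 1)" using f(2) e t'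
          by (smt (verit) divide_pos_pos real_sqrt_ge_zero)
        from sob_tensor_norm_lessE[OF f(1) this] obtain Y r where
          Y: "sob_represents I c Y f" "(\<lambda>n. sqrt (sob_tensor_inner I c (Y n) (Y n))) \<longlonglongrightarrow> r" "r < 1 + e / (sqrt t + 1)" .
        have "\<bar>f x - A f x\<bar> \<le> sqrt t * r"
          unfolding A using represents_remainder_le[OF Y(1,2) T t x] .
        also have "\<dots> \<le> sqrt t * (1 + e / (sqrt t + 1))"
          using Y(3) t' by (intro mult_left_mono) auto
        also have "\<dots> = sqrt t + e * (sqrt t / (sqrt t + 1))" by (simp add: field_simps)
        also have "\<dots> \<le> sqrt t + e"
        proof -
          have "sqrt t / (sqrt t + 1) \<le> 1" using real_sqrt_ge_zero[OF t'] by (subst divide_le_eq_1_pos; linarith)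
          then have "e * (sqrt t / (sqrt t + 1)) \<le> e * 1" using e by (intro mult_left_mono) auto
          then show ?thesis by simp
        qed
        finally show "\<bar>f x - A f x\<bar> \<le> sqrt t + e" .
      qed
    qed
  qed
  finally show ?thesis .
qed

end

subsection \<open>Tractability from summability of the weights\<close>

text \<open>Dropping the 1 in the weight and absorbing the factor 2 into the square of
  \<open>pi\<close> leaves a bound free of constants.\<close>

lemma cos_mass_powr_le:
  assumes c: "c > 0" and \<tau>: "\<tau> > 0" and m: "m > 0"
  shows "cos_mass c m powr \<tau> \<le> c powr \<tau> * real m powr (- (2 * \<tau>))"
proof -
  have m0: "real m > 0" using m by simp
  have pi2: "2 \<le> pi\<^sup>2" using pi_gt3 by (smt (verit) power2_le_imp_le power_mono one_power2 self_le_power pos2 power2_eq_square mult_less_cancel_right2)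
  have "cos_mass c m = 2 / (1 + (real m * pi)\<^sup>2 / c)" using m by (simp add: cos_mass_def cos_weight_def)
  also have "\<dots> \<le> 2 / ((real m * pi)\<^sup>2 / c)"
    using c m0 by (intro divide_left_mono mult_pos_pos add_pos_pos divide_pos_pos) auto
  also have "\<dots> = 2 / pi\<^sup>2 * (c / (real m)\<^sup>2)" using c m0 by (simp add: field_simps)
  also have "\<dots> \<le> 1 * (c / (real m)\<^sup>2)"
    using pi2 c by (intro mult_right_mono) (auto simp: divide_le_eq)
  finally have "cos_mass c m powr \<tau> \<le> (c / (real m)\<^sup>2) powr \<tau>"
    using \<tau> cos_mass_pos[OF c, of m] by (intro powr_mono2) auto
  also have "\<dots> = c powr \<tau> / (real m powr 2) powr \<tau>" using m0 by (simp add: powr_divide)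
  also have "\<dots> = c powr \<tau> / real m powr (2 * \<tau>)" by (simp only: powr_powr)
  also have "\<dots> = c powr \<tau> * real m powr (- (2 * \<tau>))" by (simp add: powr_minus divide_inverse)
  finally show ?thesis .
qed

text \<open>The zero frequency gives the 1. The others form a zeta series with exponent
  \<open>2 * \<tau>\<close>, convergent because \<open>\<tau> > 1/2\<close>; its term at 0 is 0 by
  the convention for \<open>powr\<close>.\<close>

lemma sum_cos_mass_powr_le:
  assumes c: "c > 0" and \<tau>: "\<tau> > 1/2"
  shows "(\<Sum>m<M. cos_mass c m powr \<tau>) \<le> 1 + (\<Sum>m. real m powr (- (2 * \<tau>))) * c powr \<tau>"
proof -
  have s: "summable (\<lambda>m. real m powr (- (2 * \<tau>)))" using \<tau> by (subst summable_real_powr_iff) auto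
  have "(\<Sum>m<M. cos_mass c m powr \<tau>) \<le> (\<Sum>m<M. (if m = 0 then 1 else 0) + c powr \<tau> * real m powr (- (2 * \<tau>)))"
    using cos_mass_powr_le[OF c, of \<tau>] \<tau> by (intro sum_mono) (auto simp: cos_mass_def)
  also have "\<dots> = (\<Sum>m<M. if m = 0 then 1 else 0) + c powr \<tau> * (\<Sum>m<M. real m powr (- (2 * \<tau>)))"
    by (simp add: sum.distrib sum_distrib_left)
  also have "\<dots> \<le> 1 + c powr \<tau> * (\<Sum>m. real m powr (- (2 * \<tau>)))"
    using s by (intro add_mono mult_left_mono sum_le_suminf) auto
  finally show ?thesis by (simp add: mult.commute)
qed

text \<open>A finite set of multi-indices lies in a cube, over which the sum is a product of
  univariate sums.\<close>

lemma sum_tensor_mass_powr_le: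
  fixes I :: "'i set"
  assumes I: "finite I" and c: "\<And>k. k \<in> I \<Longrightarrow> c k > 0" and \<tau>: "\<tau> > 1/2" and K: "finite K" "K \<subseteq> I \<rightarrow>\<^sub>E UNIV"
  shows "(\<Sum>\<kappa>\<in>K. tensor_mass I c \<kappa> powr \<tau>) \<le> (\<Prod>k\<in>I. 1 + (\<Sum>m. real m powr (- (2 * \<tau>))) * c k powr \<tau>)"
proof -
  define M where "M = Suc (Max (insert 0 (\<Union>\<kappa>\<in>K. \<kappa> ` I)))"
  have "K \<subseteq> I \<rightarrow>\<^sub>E {..<M}"
  proof
    fix \<kappa> assume \<kappa>: "\<kappa> \<in> K"
    have "\<kappa> k < M" if "k \<in> I" for k
    proof -
      have "\<kappa> k \<le> Max (insert 0 (\<Union>\<kappa>\<in>K. \<kappa> ` I))" using \<kappa> that K I by (intro Max_ge) auto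
      then show ?thesis by (simp add: M_def)
    qed
    then show "\<kappa> \<in> I \<rightarrow>\<^sub>E {..<M}" using \<kappa> K by (auto simp: PiE_iff subset_iff)
  qed
  then have "(\<Sum>\<kappa>\<in>K. tensor_mass I c \<kappa> powr \<tau>) \<le> (\<Sum>\<kappa>\<in>I \<rightarrow>\<^sub>E {..<M}. tensor_mass I c \<kappa> powr \<tau>)"
    using I by (intro sum_mono2 finite_PiE) auto
  also have "\<dots> = (\<Sum>\<kappa>\<in>I \<rightarrow>\<^sub>E {..<M}. \<Prod>k\<in>I. cos_mass (c k) (\<kappa> k) powr \<tau>)"
    by (simp add: prod_powr_distrib)
  also have "\<dots> = (\<Prod>k\<in>I. \<Sum>m<M. cos_mass (c k) m powr \<tau>)"
    using I by (subst prod_sum_PiE) auto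
  also have "\<dots> \<le> (\<Prod>k\<in>I. 1 + (\<Sum>m. real m powr (- (2 * \<tau>))) * c k powr \<tau>)"
    using c \<tau> by (intro prod_mono conjI sum_cos_mass_powr_le sum_nonneg) auto
  finally show ?thesis .
qed

lemma minimal_error_le_eps:
  fixes I :: "'i set"
  assumes I: "finite I" and c: "\<And>k. k \<in> I \<Longrightarrow> c k > 0" and \<tau>: "1/2 < \<tau>" "\<tau> < 1" and \<epsilon>: "\<epsilon> > 0"
    and S: "(\<Prod>k\<in>I. 1 + (\<Sum>m. real m powr (- (2 * \<tau>))) * c k powr \<tau>) \<le> S" "S > 0"
  obtains n where "minimal_error (sob_tensor I c) (sob_tensor_norm I c) (box_measure I) n \<le> ereal \<epsilon>"
    "real n \<le> S powr (1 / (1 - \<tau>)) * \<epsilon> powr (- (2 * \<tau> / (1 - \<tau>)))"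
proof -
  \<comment> \<open>The threshold solves
    \<open>S * \<delta> powr (1 - \<tau>) = \<epsilon>\<^sup>2\<close>, which makes the discarded
    mass at most the squared error allowed.\<close>
  define \<delta> where "\<delta> = (\<epsilon>\<^sup>2 / S) powr (1 / (1 - \<tau>))"
  have \<delta>: "\<delta> > 0" using \<epsilon> S by (simp add: \<delta>_def)
  define T where "T = {\<kappa> \<in> I \<rightarrow>\<^sub>E UNIV. tensor_mass I c \<kappa> > \<delta>}"
  have mass: "tensor_mass I c \<kappa> > 0" for \<kappa>
    using c cos_mass_pos by (intro prod_pos) auto
  have le: "(\<Sum>\<kappa>\<in>K. tensor_mass I c \<kappa> powr \<tau>) \<le> S" if "finite K" "K \<subseteq> I \<rightarrow>\<^sub>E UNIV" for K
    using that by (intro order_trans[OF sum_tensor_mass_powr_le S(1)] I c \<tau>(1))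
  define b where "b = S powr (1 / (1 - \<tau>)) * \<epsilon> powr (- (2 * \<tau> / (1 - \<tau>)))"
  have cardF: "real (card F) \<le> b" if F: "F \<subseteq> T" "finite F" for F
  proof -
    have "real (card F) * \<delta> powr \<tau> = (\<Sum>\<kappa>\<in>F. \<delta> powr \<tau>)" by simp
    also have "\<dots> \<le> (\<Sum>\<kappa>\<in>F. tensor_mass I c \<kappa> powr \<tau>)"
      using F \<delta> \<tau> by (intro sum_mono powr_mono2) (auto simp: T_def)
    also have "\<dots> \<le> S" using F by (intro le) (auto simp: T_def)
    finally have "real (card F) \<le> S / \<delta> powr \<tau>" using \<delta> by (simp add: pos_le_divide_eq)
    also have "\<dots> = b"
    proof -
      have "\<delta> powr \<tau> = (\<epsilon> powr 2 / S) powr (\<tau> / (1 - \<tau>))"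
        using \<epsilon> by (simp add: \<delta>_def powr_powr)
      also have "\<dots> = \<epsilon> powr (2 * \<tau> / (1 - \<tau>)) / S powr (\<tau> / (1 - \<tau>))"
        by (simp add: powr_divide powr_powr del: powr_numeral)
      finally have *: "\<delta> powr \<tau> = \<epsilon> powr (2 * \<tau> / (1 - \<tau>)) / S powr (\<tau> / (1 - \<tau>))" .
      have "S / \<delta> powr \<tau> = S powr 1 * S powr (\<tau> / (1 - \<tau>)) * \<epsilon> powr (- (2 * \<tau> / (1 - \<tau>)))"
        unfolding * powr_minus using S by (simp add: divide_inverse mult_ac)
      also have "S powr 1 * S powr (\<tau> / (1 - \<tau>)) = S powr (1 / (1 - \<tau>))"
        using \<tau> by (simp only: powr_add[symmetric]) (simp add: field_simps)
      finally show ?thesis by (simp add: b_def)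
    qed
    finally show ?thesis .
  qed
  \<comment> \<open>The cardinality estimate is uniform over finite subsets of \<open>T\<close>,
    which forces \<open>T\<close> itself to be finite.\<close>
  have "finite T \<and> card T \<le> nat \<lfloor>b\<rfloor>"
    by (rule finite_if_finite_subsets_card_bdd) (use cardF in \<open>simp add: le_nat_floor\<close>)
  then have T: "finite T" by simp
  \<comment> \<open>Exponent 1 in the mass estimate supplies the bound on the total mass that the
    locale requires.\<close>
  have t0: "(\<Sum>\<kappa>\<in>K. tensor_mass I c \<kappa>) \<le> (\<Prod>k\<in>I. 1 + (\<Sum>m. real m powr (- (2 * 1))) * c k powr 1)"
    if "finite K" "K \<subseteq> I \<rightarrow>\<^sub>E UNIV" for K
  proof -
    have "(\<Sum>\<kappa>\<in>K. tensor_mass I c \<kappa> powr 1) \<le> (\<Prod>k\<in>I. 1 + (\<Sum>m. real m powr (- (2 * 1))) * c k powr 1)"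
      using that by (intro sum_tensor_mass_powr_le I c) auto
    then show ?thesis using mass by (simp add: less_imp_le)
  qed
  interpret sob_tensor_space I c "\<Prod>k\<in>I. 1 + (\<Sum>m. real m powr (- (2 * 1))) * c k powr 1"
    using I c t0 by unfold_locales
  have "minimal_error (sob_tensor I c) (sob_tensor_norm I c) (box_measure I) (card T) \<le> ereal (sqrt (\<epsilon>\<^sup>2))"
  proof (rule minimal_error_le[OF T])
    show "T \<subseteq> I \<rightarrow>\<^sub>E UNIV" by (auto simp: T_def)
    fix K assume K: "finite K" "K \<subseteq> (I \<rightarrow>\<^sub>E UNIV) - T"
    have "(\<Sum>\<kappa>\<in>K. tensor_mass I c \<kappa>) \<le> (\<Sum>\<kappa>\<in>K. tensor_mass I c \<kappa> powr \<tau> * \<delta> powr (1 - \<tau>))"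
    proof (rule sum_mono)
      fix \<kappa> assume "\<kappa> \<in> K"
      then have m: "tensor_mass I c \<kappa> \<le> \<delta>" using K by (auto simp: T_def)
      have "tensor_mass I c \<kappa> = tensor_mass I c \<kappa> powr \<tau> * tensor_mass I c \<kappa> powr (1 - \<tau>)"
        using mass[of \<kappa>] by (simp flip: powr_add)
      also have "\<dots> \<le> tensor_mass I c \<kappa> powr \<tau> * \<delta> powr (1 - \<tau>)"
        using m mass[of \<kappa>] \<tau> by (intro mult_left_mono powr_mono2) auto
      finally show "tensor_mass I c \<kappa> \<le> tensor_mass I c \<kappa> powr \<tau> * \<delta> powr (1 - \<tau>)" .
    qed
    also have "\<dots> = (\<Sum>\<kappa>\<in>K. tensor_mass I c \<kappa> powr \<tau>) * \<delta> powr (1 - \<tau>)"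
      by (simp add: sum_distrib_right)
    also have "\<dots> \<le> S * \<delta> powr (1 - \<tau>)" using K by (intro mult_right_mono le) auto
    also have "\<dots> = \<epsilon>\<^sup>2" using \<tau> \<epsilon> S by (simp add: \<delta>_def powr_powr)
    finally show "(\<Sum>\<kappa>\<in>K. tensor_mass I c \<kappa>) \<le> \<epsilon>\<^sup>2" .
  qed
  moreover have "real (card T) \<le> b" using cardF T by blast
  ultimately show ?thesis using that[of "card T"] \<epsilon> by (simp add: b_def)
qed

section \<open>Information complexity and sum exponents\<close>

lemma unif_error_eq:
  "unif_error \<gamma> n d = minimal_error (sob_tensor {1..d} (\<gamma> d)) (sob_tensor_norm {1..d} (\<gamma> d)) (box_measure {1..d}) n"
  unfolding unif_error_def sobolev_def sobolev_norm_def cube_measure_def ..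

lemma info_complexity_le:
  assumes "unif_error \<gamma> n d \<le> ereal \<epsilon>"
  shows "info_complexity \<gamma> \<epsilon> d \<le> enat n"
  unfolding info_complexity_def using assms by (intro Inf_lower) auto

text \<open>The function \<open>L\<close> is the permitted growth of the weight sums: constant for
  strong polynomial tractability, \<open>ln (real d + 1)\<close> for polynomial tractability.
  Exponentiating turns it into a constant or a power of the dimension.\<close>

lemma info_complexity_upper:
  assumes pos: "\<And>d j. 1 \<le> j \<Longrightarrow> j \<le> d \<Longrightarrow> 0 < \<gamma> d j" and bd: "\<And>d j. 1 \<le> j \<Longrightarrow> j \<le> d \<Longrightarrow> \<gamma> d j \<le> C"
    and \<kappa>: "0 \<le> \<kappa>" "\<kappa> < 1" and B: "0 \<le> B" "\<And>d. d \<ge> 1 \<Longrightarrow> (\<Sum>j=1..d. \<gamma> d j powr \<kappa>) \<le> B * L d"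
  shows "\<exists>E\<ge>0. \<exists>p>0. \<forall>\<epsilon>\<in>{0<..1}. \<forall>d\<ge>1.
    ereal_of_enat (info_complexity \<gamma> \<epsilon> d) \<le> ereal (exp (E * L d) * \<epsilon> powr (- p))"
proof -
  \<comment> \<open>The exponent has to exceed 1/2 for the zeta series, stay below 1 for the
    truncation estimate, and be at least \<open>\<kappa>\<close>.\<close>
  define \<tau> where "\<tau> = max \<kappa> (3/4)"
  have \<tau>: "1/2 < \<tau>" "\<tau> < 1" "\<kappa> \<le> \<tau>" using \<kappa> by (auto simp: \<tau>_def)
  define Z where "Z = (\<Sum>m. real m powr (- (2 * \<tau>)))"
  have Z: "Z \<ge> 0" unfolding Z_def using \<tau> by (intro suminf_nonneg) (auto simp: summable_real_powr_iff)
  define D where "D = Z * C powr (\<tau> - \<kappa>) * B"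
  have D: "D \<ge> 0" using Z B by (simp add: D_def)
  have "ereal_of_enat (info_complexity \<gamma> \<epsilon> d) \<le> ereal (exp (D / (1 - \<tau>) * L d) * \<epsilon> powr (- (2 * \<tau> / (1 - \<tau>))))"
    if \<epsilon>: "\<epsilon> \<in> {0<..1}" and d: "d \<ge> 1" for \<epsilon> d
  proof -
    have "(\<Prod>k\<in>{1..d}. 1 + Z * \<gamma> d k powr \<tau>) \<le> (\<Prod>k\<in>{1..d}. exp (Z * \<gamma> d k powr \<tau>))"
      using Z by (intro prod_mono) (auto intro: add_nonneg_nonneg)
    also have "\<dots> = exp (Z * (\<Sum>k=1..d. \<gamma> d k powr \<tau>))" by (simp add: exp_sum sum_distrib_left)
    also have "Z * (\<Sum>k=1..d. \<gamma> d k powr \<tau>) \<le> Z * (C powr (\<tau> - \<kappa>) * (\<Sum>k=1..d. \<gamma> d k powr \<kappa>))"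
    proof (rule mult_left_mono[OF _ Z])
      show "(\<Sum>k=1..d. \<gamma> d k powr \<tau>) \<le> C powr (\<tau> - \<kappa>) * (\<Sum>k=1..d. \<gamma> d k powr \<kappa>)"
        unfolding sum_distrib_left
      proof (rule sum_mono)
        fix k assume k: "k \<in> {1..d}"
        \<comment> \<open>Raising the exponent from \<open>\<kappa>\<close> to \<open>\<tau>\<close>
          costs only a constant because the weights are bounded by \<open>C\<close>.\<close>
        have "\<gamma> d k powr \<tau> = \<gamma> d k powr (\<tau> - \<kappa>) * \<gamma> d k powr \<kappa>"
          by (simp flip: powr_add)
        also have "\<dots> \<le> C powr (\<tau> - \<kappa>) * \<gamma> d k powr \<kappa>"
          using pos[of k d] bd[of k d] \<tau> k by (intro mult_right_mono powr_mono2) auto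
        finally show "\<gamma> d k powr \<tau> \<le> C powr (\<tau> - \<kappa>) * \<gamma> d k powr \<kappa>" .
      qed
    qed
    also have "\<dots> \<le> Z * (C powr (\<tau> - \<kappa>) * (B * L d))"
      using Z B(2)[OF d] by (intro mult_left_mono) auto
    also have "\<dots> = D * L d" by (simp add: D_def)
    finally have "(\<Prod>k\<in>{1..d}. 1 + Z * \<gamma> d k powr \<tau>) \<le> exp (D * L d)" by simp
    then obtain n where n: "unif_error \<gamma> n d \<le> ereal \<epsilon>"
      "real n \<le> exp (D * L d) powr (1 / (1 - \<tau>)) * \<epsilon> powr (- (2 * \<tau> / (1 - \<tau>)))"
      unfolding unif_error_eq Z_def
      using minimal_error_le_eps[of "{1..d}" "\<gamma> d" \<tau> \<epsilon> "exp (D * L d)"] pos \<tau> \<epsilon> by auto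
    have "ereal_of_enat (info_complexity \<gamma> \<epsilon> d) \<le> ereal (real n)"
      using info_complexity_le[OF n(1)] by (metis ereal_of_enat_le_iff ereal_of_enat_simps(1))
    also have "\<dots> \<le> ereal (exp (D / (1 - \<tau>) * L d) * \<epsilon> powr (- (2 * \<tau> / (1 - \<tau>))))"
      using n(2) by (simp add: exp_powr_real)
    finally show "ereal_of_enat (info_complexity \<gamma> \<epsilon> d) \<le> ereal (exp (D / (1 - \<tau>) * L d) * \<epsilon> powr (- (2 * \<tau> / (1 - \<tau>))))" .
  qed
  moreover have "0 \<le> D / (1 - \<tau>)" "0 < 2 * \<tau> / (1 - \<tau>)" using D \<tau> by auto
  ultimately show ?thesis by blast
qed

text \<open>The finitely many values before the bound sets in are absorbed into a maximum. Starting
  at \<open>d = 1\<close> matches the tractability notions and avoids the denominator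
  \<open>ln 1 = 0\<close> in the second exponent.\<close>

lemma limsup_ereal_less_top_iff:
  fixes g :: "nat \<Rightarrow> real"
  shows "limsup (\<lambda>d. ereal (g d)) < \<infinity> \<longleftrightarrow> (\<exists>B\<ge>0. \<forall>d\<ge>1. g d \<le> B)"
proof
  assume "limsup (\<lambda>d. ereal (g d)) < \<infinity>"
  then obtain b where "limsup (\<lambda>d. ereal (g d)) < ereal b"
    using ereal_dense2 by blast
  then have "eventually (\<lambda>d. ereal (g d) < ereal b) sequentially"
    by (rule Limsup_lessD)
  then obtain N where N: "\<And>d. d \<ge> N \<Longrightarrow> g d < b" by (auto simp: eventually_sequentially)
  define B where "B = Max (insert 0 (insert b (g ` {..<N})))"
  have "g d \<le> B" for d
  proof (cases "d < N")
    case True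
    then show ?thesis unfolding B_def by (intro Max_ge) auto
  next
    case False
    then have "g d \<le> b" using N[of d] by simp
    also have "b \<le> B" unfolding B_def by (intro Max_ge) auto
    finally show ?thesis .
  qed
  moreover have "0 \<le> B" unfolding B_def by (intro Max_ge) auto
  ultimately show "\<exists>B\<ge>0. \<forall>d\<ge>1. g d \<le> B" by blast
next
  assume "\<exists>B\<ge>0. \<forall>d\<ge>1. g d \<le> B"
  then obtain B where B: "\<forall>d\<ge>1. g d \<le> B" by blast
  have "limsup (\<lambda>d. ereal (g d)) \<le> ereal B"
    using B by (intro Limsup_bounded eventually_sequentiallyI[of 1]) auto
  then show "limsup (\<lambda>d. ereal (g d)) < \<infinity>" by (rule le_less_trans) simp
qed

lemma Inf_ereal_Collect_less_iff: "Inf {ereal \<kappa> |\<kappa>. P \<kappa>} < ereal b \<longleftrightarrow> (\<exists>\<kappa>. P \<kappa> \<and> \<kappa> < b)"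
  by (simp add: setcompr_eq_image Inf_less_iff)

lemma sum_exponent_p_less_1_iff:
  "sum_exponent_p \<gamma> < 1 \<longleftrightarrow> (\<exists>\<kappa>\<ge>0. \<kappa> < 1 \<and> (\<exists>B\<ge>0. \<forall>d\<ge>1. (\<Sum>j=1..d. \<gamma> d j powr \<kappa>) \<le> B))"
  unfolding sum_exponent_p_def limsup_ereal_less_top_iff one_ereal_def Inf_ereal_Collect_less_iff by auto

lemma sum_exponent_q_less_1_iff:
  "sum_exponent_q \<gamma> < 1 \<longleftrightarrow> (\<exists>\<kappa>\<ge>0. \<kappa> < 1 \<and> (\<exists>B\<ge>0. \<forall>d\<ge>1. (\<Sum>j=1..d. \<gamma> d j powr \<kappa>) \<le> B * ln (real d + 1)))"
proof -
  have "(\<Sum>j=1..d. \<gamma> d j powr \<kappa>) / ln (real d + 1) \<le> B \<longleftrightarrow> (\<Sum>j=1..d. \<gamma> d j powr \<kappa>) \<le> B * ln (real d + 1)"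
    if "d \<ge> 1" for d \<kappa> B
    using that by (subst pos_divide_le_eq) auto
  then show ?thesis
    unfolding sum_exponent_q_def limsup_ereal_less_top_iff one_ereal_def Inf_ereal_Collect_less_iff by auto
qed

lemma strongly_tractable_if_sum_exponent:
  assumes pos: "\<And>d j. 1 \<le> j \<Longrightarrow> j \<le> d \<Longrightarrow> 0 < \<gamma> d j" and bd: "\<And>d j. 1 \<le> j \<Longrightarrow> j \<le> d \<Longrightarrow> \<gamma> d j \<le> C"
    and p: "sum_exponent_p \<gamma> < 1"
  shows "strongly_polynomially_tractable (info_complexity \<gamma>)"
proof -
  obtain \<kappa> B where \<kappa>: "0 \<le> \<kappa>" "\<kappa> < 1" "0 \<le> B" and B: "\<And>d. d \<ge> 1 \<Longrightarrow> (\<Sum>j=1..d. \<gamma> d j powr \<kappa>) \<le> B * 1"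
    using p unfolding sum_exponent_p_less_1_iff by auto
  have "\<exists>E\<ge>0. \<exists>p>0. \<forall>\<epsilon>\<in>{0<..1}. \<forall>d\<ge>1. ereal_of_enat (info_complexity \<gamma> \<epsilon> d) \<le> ereal (exp (E * 1) * \<epsilon> powr (- p))"
    by (rule info_complexity_upper[where L = "\<lambda>_. 1", OF pos bd \<kappa> B])
  then obtain E p where "E \<ge> 0" "p > 0"
    "\<forall>\<epsilon>\<in>{0<..1}. \<forall>d\<ge>1. ereal_of_enat (info_complexity \<gamma> \<epsilon> d) \<le> ereal (exp (E * 1) * \<epsilon> powr (- p))"
    by blast
  then show ?thesis
    unfolding strongly_polynomially_tractable_def by (intro exI[of _ "exp (E * 1)"] exI[of _ p]) auto
qed

lemma tractable_if_sum_exponent: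
  assumes pos: "\<And>d j. 1 \<le> j \<Longrightarrow> j \<le> d \<Longrightarrow> 0 < \<gamma> d j" and bd: "\<And>d j. 1 \<le> j \<Longrightarrow> j \<le> d \<Longrightarrow> \<gamma> d j \<le> C"
    and q: "sum_exponent_q \<gamma> < 1"
  shows "polynomially_tractable (info_complexity \<gamma>)"
proof -
  obtain \<kappa> B where \<kappa>: "0 \<le> \<kappa>" "\<kappa> < 1" "0 \<le> B" and B: "\<And>d. d \<ge> 1 \<Longrightarrow> (\<Sum>j=1..d. \<gamma> d j powr \<kappa>) \<le> B * ln (real d + 1)"
    using q unfolding sum_exponent_q_less_1_iff by auto
  have "\<exists>E\<ge>0. \<exists>p>0. \<forall>\<epsilon>\<in>{0<..1}. \<forall>d\<ge>1.
      ereal_of_enat (info_complexity \<gamma> \<epsilon> d) \<le> ereal (exp (E * ln (real d + 1)) * \<epsilon> powr (- p))"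
    by (rule info_complexity_upper[where L = "\<lambda>d. ln (real d + 1)", OF pos bd \<kappa> B])
  then obtain E p where E: "E \<ge> 0" "p > 0"
    and le: "\<And>\<epsilon> d. \<epsilon> \<in> {0<..1} \<Longrightarrow> d \<ge> 1 \<Longrightarrow> ereal_of_enat (info_complexity \<gamma> \<epsilon> d) \<le> ereal (exp (E * ln (real d + 1)) * \<epsilon> powr (- p))"
    by blast
  have "ereal_of_enat (info_complexity \<gamma> \<epsilon> d) \<le> ereal (2 powr E * \<epsilon> powr (- p) * real d powr E)"
    if "\<epsilon> \<in> {0<..1}" "d \<ge> 1" for \<epsilon> d
  proof -
    have "exp (E * ln (real d + 1)) = (real d + 1) powr E" by (simp add: powr_def)
    \<comment> \<open>For \<open>d \<ge> 1\<close> the shift in the logarithm costs a factor of at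
      most 2 in the base.\<close>
    also have "\<dots> \<le> (2 * real d) powr E" using that E by (intro powr_mono2) auto
    also have "\<dots> = 2 powr E * real d powr E" by (simp add: powr_mult)
    finally have "exp (E * ln (real d + 1)) * \<epsilon> powr (- p) \<le> 2 powr E * real d powr E * \<epsilon> powr (- p)"
      by (intro mult_right_mono) auto
    then show ?thesis using le[OF that] by (auto simp: mult_ac intro: order_trans)
  qed
  then show ?thesis
    unfolding polynomially_tractable_def using E by (intro exI[of _ "2 powr E"] exI[of _ p] exI[of _ E] conjI ballI allI impI) auto
qed

subsection \<open>Trace lower bound for the minimal error\<close>

definition dot :: "'u set \<Rightarrow> ('u \<Rightarrow> real) \<Rightarrow> ('u \<Rightarrow> real) \<Rightarrow> real" where
  "dot U v w = (\<Sum>u\<in>U. v u * w u)"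

lemma dot_commute: "dot U v w = dot U w v"
  by (simp add: dot_def mult.commute)

lemma dot_self_nonneg: "0 \<le> dot U v v"
  unfolding dot_def by (intro sum_nonneg) simp

lemma dot_diff_scaled_sum:
  "dot U (\<lambda>u. v u - (\<Sum>i<r. a i * q i u)) w = dot U v w - (\<Sum>i<r::nat. a i * dot U (q i) w)"
proof -
  have "dot U (\<lambda>u. v u - (\<Sum>i<r. a i * q i u)) w = dot U v w - (\<Sum>u\<in>U. \<Sum>i<r. a i * (q i u * w u))"
    by (simp add: dot_def left_diff_distrib sum_subtractf sum_distrib_right mult.assoc)
  also have "(\<Sum>u\<in>U. \<Sum>i<r. a i * (q i u * w u)) = (\<Sum>i<r. a i * dot U (q i) w)"
    by (subst sum.swap) (simp add: dot_def sum_distrib_left)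
  finally show ?thesis .
qed

definition orthonormal_on :: "'u set \<Rightarrow> nat \<Rightarrow> (nat \<Rightarrow> 'u \<Rightarrow> real) \<Rightarrow> bool" where
  "orthonormal_on U r q \<longleftrightarrow> (\<forall>i<r. \<forall>j<r. dot U (q i) (q j) = (if i = j then 1 else 0))"

text \<open>For an orthonormal system this is the component of \<open>v\<close> orthogonal to the
  span of the first \<open>r\<close> vectors.\<close>

definition residual :: "'u set \<Rightarrow> nat \<Rightarrow> (nat \<Rightarrow> 'u \<Rightarrow> real) \<Rightarrow> ('u \<Rightarrow> real) \<Rightarrow> 'u \<Rightarrow> real" where
  "residual U r q v u = v u - (\<Sum>i<r. dot U (q i) v * q i u)"

lemma dot_residual: "dot U (residual U r q v) w = dot U v w - (\<Sum>i<r. dot U (q i) v * dot U (q i) w)"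
  unfolding residual_def[abs_def] by (rule dot_diff_scaled_sum)

lemma dot_residual_orthonormal:
  assumes "orthonormal_on U r q" "j < r"
  shows "dot U (q j) (residual U r q v) = 0"
proof -
  have "(\<Sum>i<r. dot U (q i) v * dot U (q i) (q j)) = (\<Sum>i<r. if i = j then dot U (q j) v else 0)"
    using assms by (intro sum.cong) (auto simp: orthonormal_on_def)
  then show ?thesis
    using assms(2) by (simp add: dot_commute[of U "q j" "residual U r q v"] dot_residual dot_commute[of U v])
qed

text \<open>Pythagoras. The two quantities coincide because the residual is orthogonal to the part
  of \<open>v\<close> that was subtracted.\<close>

lemma dot_residual_self:
  assumes "orthonormal_on U r q"
  shows "dot U (residual U r q v) (residual U r q v) = dot U v v - (\<Sum>i<r. (dot U (q i) v)\<^sup>2)"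
    and "dot U (residual U r q v) v = dot U v v - (\<Sum>i<r. (dot U (q i) v)\<^sup>2)"
proof -
  show *: "dot U (residual U r q v) v = dot U v v - (\<Sum>i<r. (dot U (q i) v)\<^sup>2)"
    by (simp add: dot_residual power2_eq_square)
  have "dot U (residual U r q v) (residual U r q v) = dot U v (residual U r q v)"
    using dot_residual_orthonormal[OF assms] by (subst dot_residual) simp
  then show "dot U (residual U r q v) (residual U r q v) = dot U v v - (\<Sum>i<r. (dot U (q i) v)\<^sup>2)"
    using * by (simp add: dot_commute)
qed

text \<open>Gram-Schmidt reduced to what the trace argument uses: vectors orthogonal to the system
  are annihilated by every \<open>l j\<close>. A vector with vanishing residual is skipped, so
  \<open>r\<close> can be smaller than \<open>n\<close>.\<close>

lemma gram_schmidt_on: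
  fixes l :: "nat \<Rightarrow> 'u \<Rightarrow> real"
  assumes U: "finite U"
  shows "\<exists>r\<le>n. \<exists>q. orthonormal_on U r q \<and>
    (\<forall>c. (\<forall>i<r. dot U (q i) c = 0) \<longrightarrow> (\<forall>j\<in>{1..n}. dot U (l j) c = 0))"
proof (induction n)
  case 0
  show ?case by (auto simp: orthonormal_on_def)
next
  case (Suc n)
  then obtain r q where r: "r \<le> n" and q: "orthonormal_on U r q"
    and ker: "\<And>c. (\<forall>i<r. dot U (q i) c = 0) \<Longrightarrow> (\<forall>j\<in>{1..n}. dot U (l j) c = 0)" by blast
  define v where "v = residual U r q (l (Suc n))"
  have lv: "dot U (l (Suc n)) c = dot U v c" if "\<forall>i<r. dot U (q i) c = 0" for c
    using that by (simp add: v_def dot_residual)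
  have Suc: "{1..Suc n} = insert (Suc n) {1..n}" by auto
  show ?case
  proof (cases "dot U v v = 0")
    case True
    then have "\<forall>u\<in>U. v u = 0"
      using U unfolding dot_def by (subst (asm) sum_nonneg_eq_0_iff) auto
    then have "dot U v c = 0" for c by (simp add: dot_def)
    then have "\<forall>c. (\<forall>i<r. dot U (q i) c = 0) \<longrightarrow> (\<forall>j\<in>{1..Suc n}. dot U (l j) c = 0)"
      unfolding Suc using ker lv by auto
    then show ?thesis using r q by (meson le_Suc_eq)
  next
    case False
    define s where "s = sqrt (dot U v v)"
    have s: "s > 0" "s * s = dot U v v"
      using False dot_self_nonneg[of U v] by (auto simp: s_def)
    define q' where "q' = q(r := (\<lambda>u. v u / s))"
    have dv: "dot U (\<lambda>u. v u / s) c = dot U v c / s" "dot U c (\<lambda>u. v u / s) = dot U c v / s" for c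
      by (simp_all add: dot_def sum_divide_distrib)
    have qv: "dot U (q i) v = 0" "dot U v (q i) = 0" if "i < r" for i
      using dot_residual_orthonormal[OF q that] by (simp_all add: v_def dot_commute)
    have "orthonormal_on U (Suc r) q'"
      unfolding orthonormal_on_def
    proof (intro allI impI)
      fix i j assume "i < Suc r" "j < Suc r"
      then consider "i < r" "j < r" | "i = r" "j < r" | "i < r" "j = r" | "i = r" "j = r" by linarith
      then show "dot U (q' i) (q' j) = (if i = j then 1 else 0)"
      proof cases
        case 1
        then show ?thesis using q by (simp add: q'_def orthonormal_on_def)
      next
        case 2
        then show ?thesis using qv by (simp add: q'_def dv)
      next
        case 3
        then show ?thesis using qv by (simp add: q'_def dv)
      next
        case 4
        then show ?thesis using s by (simp add: q'_def dv flip: s(2))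
      qed
    qed
    moreover have "\<forall>j\<in>{1..Suc n}. dot U (l j) c = 0" if c: "\<forall>i<Suc r. dot U (q' i) c = 0" for c
    proof -
      have c1: "\<forall>i<r. dot U (q i) c = 0"
      proof (intro allI impI)
        fix i assume "i < r"
        then show "dot U (q i) c = 0" using c[rule_format, of i] by (simp add: q'_def)
      qed
      have "dot U v c = 0"
        using c[rule_format, of r] s by (simp add: q'_def dv)
      then show ?thesis unfolding Suc using ker[OF c1] lv[OF c1] by simp
    qed
    ultimately show ?thesis using r by (intro exI[of _ "Suc r"]) auto
  qed
qed

lemma le_square_if_square_le_mult:
  fixes a E :: real
  assumes "a \<ge> 0" "a\<^sup>2 \<le> E * a" "E \<ge> 0"
  shows "a\<^sup>2 \<le> E\<^sup>2"
proof (cases "a = 0")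
  case False
  then have "a \<le> E" using assms by (simp add: power2_eq_square)
  then show ?thesis using assms by (intro power_mono) auto
qed simp

text \<open>
  The residual of the evaluation vector \<open>u \<mapsto> h u x\<close> against the functionals has norm at most
  \<open>E\<close>; integrating over \<open>x\<close> bounds the trace of the projection onto the common kernel. The bound is
  only known almost everywhere for each single coefficient vector, hence the detour through
  rational vectors.
\<close>

lemma trace_lower_bound:
  fixes h :: "'u \<Rightarrow> 'x \<Rightarrow> real" and l :: "nat \<Rightarrow> 'u \<Rightarrow> real"
  assumes M: "prob_space M" and U: "finite U" and E: "E \<ge> 0"
    and ker: "\<And>c. (\<forall>j\<in>{1..n}. dot U (l j) c = 0) \<Longrightarrow> AE x in M. \<bar>dot U c (\<lambda>u. h u x)\<bar> \<le> E * sqrt (dot U c c)"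
    and int: "\<And>u v. u \<in> U \<Longrightarrow> v \<in> U \<Longrightarrow> integrable M (\<lambda>x. h u x * h v x)"
    and orth: "\<And>u v. u \<in> U \<Longrightarrow> v \<in> U \<Longrightarrow> (LINT x|M. h u x * h v x) = (if u = v then m u else 0)"
    and m: "\<And>u. u \<in> U \<Longrightarrow> \<delta> \<le> m u" and \<delta>: "\<delta> \<ge> 0"
  shows "(real (card U) - real n) * \<delta> \<le> E\<^sup>2"
proof -
  interpret prob_space M by (rule M)
  obtain r q where r: "r \<le> n" and q: "orthonormal_on U r q"
    and qker: "\<And>c. (\<forall>i<r. dot U (q i) c = 0) \<Longrightarrow> (\<forall>j\<in>{1..n}. dot U (l j) c = 0)"
    using gram_schmidt_on[OF U, of n l] by blast
  let ?P = "residual U r q"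
  let ?h = "\<lambda>x u. h u x"
  \<comment> \<open>Projecting a rational vector off the system puts it into the common kernel.
    There are countably many of them, so one exceptional null set serves all.\<close>
  have "AE x in M. \<forall>v\<in>U \<rightarrow>\<^sub>E \<rat>. \<bar>dot U (?P v) (?h x)\<bar> \<le> E * sqrt (dot U (?P v) (?P v))"
  proof (subst AE_ball_countable)
    show "countable (U \<rightarrow>\<^sub>E (\<rat> :: real set))" using U countable_rat by (intro countable_PiE) auto
    show "\<forall>v\<in>U \<rightarrow>\<^sub>E \<rat>. AE x in M. \<bar>dot U (?P v) (?h x)\<bar> \<le> E * sqrt (dot U (?P v) (?P v))"
      using dot_residual_orthonormal[OF q] by (intro ballI ker qker) auto
  qed
  then have AE1: "AE x in M. dot U (?h x) (?h x) - (\<Sum>i<r. (dot U (q i) (?h x))\<^sup>2) \<le> E\<^sup>2"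
  proof (rule eventually_mono)
    fix x assume x: "\<forall>v\<in>U \<rightarrow>\<^sub>E \<rat>. \<bar>dot U (?P v) (?h x)\<bar> \<le> E * sqrt (dot U (?P v) (?P v))"
    have "\<exists>v. (\<forall>n. v n \<in> \<rat>) \<and> v \<longlonglongrightarrow> h u x" for u
    proof -
      have "h u x \<in> closure \<rat>" by (simp add: Rats_closure_real)
      then show ?thesis unfolding closure_sequential by blast
    qed
    then have "\<forall>u. \<exists>v. (\<forall>n. v n \<in> \<rat>) \<and> v \<longlonglongrightarrow> h u x" by blast
    from choice[OF this] obtain w where w: "\<And>u n. w u n \<in> \<rat>" "\<And>u. w u \<longlonglongrightarrow> h u x" by blast
    define v where "v = (\<lambda>n. \<lambda>u\<in>U. w u n)"
    have v: "v n \<in> U \<rightarrow>\<^sub>E \<rat>" for n using w by (simp add: v_def)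
    have vlim: "(\<lambda>n. v n u) \<longlonglongrightarrow> h u x" if "u \<in> U" for u
      using w(2)[of u] that by (simp add: v_def)
    have Plim: "(\<lambda>n. ?P (v n) u) \<longlonglongrightarrow> ?P (?h x) u" if "u \<in> U" for u
      unfolding residual_def dot_def using that by (intro tendsto_intros vlim)
    have 1: "(\<lambda>n. \<bar>dot U (?P (v n)) (?h x)\<bar>) \<longlonglongrightarrow> \<bar>dot U (?P (?h x)) (?h x)\<bar>"
      unfolding dot_def[of U "?P _" "?h x"] by (intro tendsto_intros Plim)
    have 2: "(\<lambda>n. E * sqrt (dot U (?P (v n)) (?P (v n)))) \<longlonglongrightarrow> E * sqrt (dot U (?P (?h x)) (?P (?h x)))"
      unfolding dot_def[of U "?P _" "?P _"] by (intro tendsto_intros Plim)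
    \<comment> \<open>At a fixed \<open>x\<close> both sides are continuous in the vector, so the
      bound extends to the evaluation vector itself. There it compares a squared norm with
      \<open>E\<close> times the norm.\<close>
    have "\<bar>dot U (?P (?h x)) (?h x)\<bar> \<le> E * sqrt (dot U (?P (?h x)) (?P (?h x)))"
      using x v by (intro LIMSEQ_le[OF 1 2]) auto
    moreover define a where "a = sqrt (dot U (?P (?h x)) (?P (?h x)))"
    moreover have a2: "a\<^sup>2 = dot U (?h x) (?h x) - (\<Sum>i<r. (dot U (q i) (?h x))\<^sup>2)"
      unfolding a_def using dot_self_nonneg[of U "?P (?h x)"] dot_residual_self(1)[OF q] by simp
    moreover have "dot U (?P (?h x)) (?h x) = a\<^sup>2"
      using dot_residual_self(2)[OF q] a2 by simp
    ultimately have "a\<^sup>2 \<le> E * a" by simp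
    moreover have "a \<ge> 0" unfolding a_def using dot_self_nonneg by simp
    ultimately have "a\<^sup>2 \<le> E\<^sup>2" using E by (intro le_square_if_square_le_mult)
    then show "dot U (?h x) (?h x) - (\<Sum>i<r. (dot U (q i) (?h x))\<^sup>2) \<le> E\<^sup>2" by (simp add: a2)
  qed
  have sq: "(dot U (q i) (?h x))\<^sup>2 = (\<Sum>u\<in>U. \<Sum>v\<in>U. q i u * q i v * (h u x * h v x))" for i x
    by (simp add: dot_def power2_eq_square sum_product algebra_simps)
  have int1: "integrable M (\<lambda>x. dot U (?h x) (?h x))"
    unfolding dot_def using int by (intro Bochner_Integration.integrable_sum)
  have int2: "integrable M (\<lambda>x. (dot U (q i) (?h x))\<^sup>2)" for i
    unfolding sq using int by (intro Bochner_Integration.integrable_sum integrable_mult_right)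
  have I1: "(LINT x|M. dot U (?h x) (?h x)) = (\<Sum>u\<in>U. m u)"
    unfolding dot_def using int by (subst Bochner_Integration.integral_sum) (auto simp: orth)
  have I2: "(LINT x|M. (dot U (q i) (?h x))\<^sup>2) = (\<Sum>u\<in>U. (q i u)\<^sup>2 * m u)" for i
  proof -
    have "(LINT x|M. (dot U (q i) (?h x))\<^sup>2) = (\<Sum>u\<in>U. \<Sum>v\<in>U. q i u * q i v * (LINT x|M. h u x * h v x))"
      unfolding sq using int by (simp add: Bochner_Integration.integral_sum)
    also have "\<dots> = (\<Sum>u\<in>U. \<Sum>v\<in>U. if u = v then (q i u)\<^sup>2 * m u else 0)"
      by (intro sum.cong refl) (auto simp: orth power2_eq_square)
    also have "\<dots> = (\<Sum>u\<in>U. (q i u)\<^sup>2 * m u)" using U by simp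
    finally show ?thesis .
  qed
  have "(LINT x|M. dot U (?h x) (?h x) - (\<Sum>i<r. (dot U (q i) (?h x))\<^sup>2)) \<le> (LINT x|M. E\<^sup>2)"
    using int1 int2 AE1 by (intro integral_mono_AE) auto
  then have "(\<Sum>u\<in>U. m u) - (\<Sum>i<r. \<Sum>u\<in>U. (q i u)\<^sup>2 * m u) \<le> E\<^sup>2"
    using int1 int2 by (simp add: I1 I2 prob_space Bochner_Integration.integral_sum)
  moreover have "(\<Sum>i<r. \<Sum>u\<in>U. (q i u)\<^sup>2 * m u) = (\<Sum>u\<in>U. (\<Sum>i<r. (q i u)\<^sup>2) * m u)"
    by (subst sum.swap) (simp add: sum_distrib_right)
  ultimately have le: "(\<Sum>u\<in>U. (1 - (\<Sum>i<r. (q i u)\<^sup>2)) * m u) \<le> E\<^sup>2"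
    by (simp add: left_diff_distrib sum_subtractf)
  have bessel: "(\<Sum>i<r. (q i u)\<^sup>2) \<le> 1" if u: "u \<in> U" for u
  proof -
    \<comment> \<open>The unit vector at \<open>u\<close> turns Pythagoras into Bessel's inequality
      for one coordinate: a diagonal entry of an orthogonal projection is at most 1.\<close>
    have d: "dot U v (\<lambda>v. if v = u then 1 else 0) = v u" for v
      using U u by (simp add: dot_def if_distrib cong: if_cong)
    show ?thesis
      using dot_residual_self(1)[OF q, of "\<lambda>v. if v = u then 1 else 0"]
        dot_self_nonneg[of U "?P (\<lambda>v. if v = u then 1 else 0)"] by (simp add: d)
  qed
  \<comment> \<open>The trace of the projection onto the system is its rank \<open>r\<close>, which
    is at most \<open>n\<close>.\<close>
  have "(\<Sum>u\<in>U. \<Sum>i<r. (q i u)\<^sup>2) = (\<Sum>i<r. dot U (q i) (q i))"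
    by (subst sum.swap) (simp add: dot_def power2_eq_square)
  also have "\<dots> = real r" using q by (simp add: orthonormal_on_def)
  finally have "(real (card U) - real n) * \<delta> \<le> (\<Sum>u\<in>U. 1 - (\<Sum>i<r. (q i u)\<^sup>2)) * \<delta>"
    using r \<delta> by (intro mult_right_mono) (auto simp: sum_subtractf)
  also have "\<dots> = (\<Sum>u\<in>U. (1 - (\<Sum>i<r. (q i u)\<^sup>2)) * \<delta>)" by (simp add: sum_distrib_right)
  also have "\<dots> \<le> (\<Sum>u\<in>U. (1 - (\<Sum>i<r. (q i u)\<^sup>2)) * m u)"
    using m bessel by (intro sum_mono mult_left_mono) auto
  finally show ?thesis using le by linarith
qed

section \<open>Finite cosine sums as test functions\<close>

abbreviation tensor_weight :: "'i set \<Rightarrow> ('i \<Rightarrow> real) \<Rightarrow> ('i \<Rightarrow> nat) \<Rightarrow> real" where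
  "tensor_weight I c \<kappa> \<equiv> (\<Prod>k\<in>I. cos_weight (c k) (\<kappa> k))"

lemma tensor_weight_pos: "(\<And>k. k \<in> I \<Longrightarrow> c k > 0) \<Longrightarrow> tensor_weight I c \<kappa> > 0"
  using cos_weight_ge_1 by (intro prod_pos) (meson less_le_trans zero_less_one)

text \<open>Each coefficient is absorbed into the factor at one fixed coordinate \<open>i0\<close>,
  for which \<open>I\<close> is assumed nonempty. A constant sequence represents the sum, so its
  norm is among the values over which the infimum is taken.\<close>

lemma
  fixes I :: "'i set"
  assumes I: "finite I" "I \<noteq> {}" and c: "\<And>k. k \<in> I \<Longrightarrow> c k > 0" and U: "finite U" "U \<subseteq> I \<rightarrow>\<^sub>E UNIV"
  shows cos_tensor_sum_in_sob_tensor: "(\<lambda>x. \<Sum>\<kappa>\<in>U. a \<kappa> * cos_tensor I \<kappa> x) \<in> sob_tensor I c"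
    and sob_tensor_norm_cos_tensor_sum_le:
      "sob_tensor_norm I c (\<lambda>x. \<Sum>\<kappa>\<in>U. a \<kappa> * cos_tensor I \<kappa> x) \<le> sqrt (\<Sum>\<kappa>\<in>U. (a \<kappa>)\<^sup>2 * tensor_weight I c \<kappa>)"
proof -
  obtain i0 where i0: "i0 \<in> I" using I(2) by blast
  obtain us where us: "set us = U" "distinct us" using finite_distinct_list[OF U(1)] by blast
  define s where "s = (\<lambda>\<kappa> k y. (if k = i0 then a \<kappa> else 1) * cos_basis (\<kappa> k) y)"
  define S where "S = map s us"
  let ?f = "\<lambda>x. \<Sum>\<kappa>\<in>U. a \<kappa> * cos_tensor I \<kappa> x"
  have pa: "(\<Prod>k\<in>I. if k = i0 then a \<kappa> else 1) = a \<kappa>" for \<kappa>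
    using I(1) i0 by simp
  have f: "tensor_fun I S = ?f"
  proof
    fix x
    have "tensor_fun I S x = (\<Sum>\<kappa>\<in>U. \<Prod>k\<in>I. s \<kappa> k (x k))"
      using us by (simp add: tensor_fun_def S_def sum_list_distinct_conv_sum_set o_def)
    then show "tensor_fun I S x = ?f x"
      by (simp add: s_def prod.distrib pa cos_tensor_def)
  qed
  have inner: "sob_tensor_inner I c S S = (\<Sum>\<kappa>\<in>U. (a \<kappa>)\<^sup>2 * tensor_weight I c \<kappa>)"
  proof -
    have "sob_tensor_inner I c S S = (\<Sum>\<kappa>\<in>U. \<Sum>\<kappa>'\<in>U. \<Prod>k\<in>I. sobolev1_inner (c k) (s \<kappa> k) (s \<kappa>' k))"
      using us by (simp add: tensor_inner_def S_def sum_list_distinct_conv_sum_set o_def)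
    also have "\<dots> = (\<Sum>\<kappa>\<in>U. \<Sum>\<kappa>'\<in>U. if \<kappa> = \<kappa>' then (a \<kappa>)\<^sup>2 * tensor_weight I c \<kappa> else 0)"
    proof (intro sum.cong refl)
      fix \<kappa> \<kappa>' assume \<kappa>: "\<kappa> \<in> U" "\<kappa>' \<in> U"
      have "(\<Prod>k\<in>I. sobolev1_inner (c k) (s \<kappa> k) (s \<kappa>' k)) = (\<Prod>k\<in>I. (if k = i0 then a \<kappa> else 1) * (if k = i0 then a \<kappa>' else 1)
          * (if \<kappa> k = \<kappa>' k then cos_weight (c k) (\<kappa> k) else 0))"
        unfolding s_def by (simp only: sobolev1_inner_cmult_cos_basis cos_weight_def)
      also have "\<dots> = a \<kappa> * a \<kappa>' * (\<Prod>k\<in>I. if \<kappa> k = \<kappa>' k then cos_weight (c k) (\<kappa> k) else 0)"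
        by (simp only: prod.distrib pa)
      also have "(\<Prod>k\<in>I. if \<kappa> k = \<kappa>' k then cos_weight (c k) (\<kappa> k) else 0) = (if \<kappa> = \<kappa>' then tensor_weight I c \<kappa> else 0)"
        using \<kappa> U I by (intro prod_if_eq_PiE) auto
      finally show "(\<Prod>k\<in>I. sobolev1_inner (c k) (s \<kappa> k) (s \<kappa>' k)) = (if \<kappa> = \<kappa>' then (a \<kappa>)\<^sup>2 * tensor_weight I c \<kappa> else 0)"
        by (simp add: power2_eq_square)
    qed
    also have "\<dots> = (\<Sum>\<kappa>\<in>U. (a \<kappa>)\<^sup>2 * tensor_weight I c \<kappa>)" using U by simp
    finally show ?thesis .
  qed
  have rep: "sob_represents I c (\<lambda>n. S) ?f"
    unfolding tensor_represents_def
  proof (intro conjI allI ballI impI)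
    fix t k assume "t \<in> set S" "k \<in> I"
    then show "t k \<in> sobolev1" by (auto simp: S_def s_def cmult_cos_basis_sobolev1)
  next
    fix \<epsilon> :: real assume "\<epsilon> > 0"
    then show "\<exists>N. \<forall>m\<ge>N. \<forall>n\<ge>N. sob_tensor_dist2 I c S S < \<epsilon>"
      by (simp add: tensor_dist2_def)
  next
    fix x show "(\<lambda>n. tensor_fun I S x) \<longlonglongrightarrow> ?f x" by (simp add: f)
  qed
  show "?f \<in> sob_tensor I c" unfolding hilbert_tensor_def using rep by blast
  let ?R = "{r. \<exists>X. sob_represents I c X ?f \<and> (\<lambda>n. sqrt (sob_tensor_inner I c (X n) (X n))) \<longlonglongrightarrow> r}"
  have "bdd_below ?R"
  proof (rule bdd_belowI[of _ 0])
    fix r assume "r \<in> ?R"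
    then obtain X where X: "sob_represents I c X ?f" "(\<lambda>n. sqrt (sob_tensor_inner I c (X n) (X n))) \<longlonglongrightarrow> r" by blast
    have "sob_tensor_inner I c (X n) (X n) \<ge> 0" for n
      using X(1) by (intro sob_tensor_inner_self_nonneg I(1) c) (auto simp: tensor_represents_def)
    then show "0 \<le> r" using X(2) by (intro LIMSEQ_le_const[OF X(2)]) auto
  qed
  moreover have "sqrt (\<Sum>\<kappa>\<in>U. (a \<kappa>)\<^sup>2 * tensor_weight I c \<kappa>) \<in> ?R"
    using rep by (auto simp: inner intro!: exI[of _ "\<lambda>n. S"])
  ultimately show "sob_tensor_norm I c ?f \<le> sqrt (\<Sum>\<kappa>\<in>U. (a \<kappa>)\<^sup>2 * tensor_weight I c \<kappa>)"
    unfolding hilbert_tensor_norm_def by (rule cInf_lower[rotated])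
qed

lemma continuous_functionals_linear:
  assumes "L \<in> continuous_functionals H N" "f \<in> H" "g \<in> H"
  shows "L (\<lambda>x. a * f x + b * g x) = a * L f + b * L g"
  using assms by (auto simp: continuous_functionals_def)

text \<open>Functionals are linear only for two-term combinations of members of the space, hence the
  induction; the empty sum is handled with both coefficients 0.\<close>

lemma continuous_functional_cos_tensor_sum:
  fixes I :: "'i set"
  assumes I: "finite I" "I \<noteq> {}" and c: "\<And>k. k \<in> I \<Longrightarrow> c k > 0" and U: "finite U" "U \<subseteq> I \<rightarrow>\<^sub>E UNIV"
    and L: "L \<in> continuous_functionals (sob_tensor I c) N"
  shows "L (\<lambda>x. \<Sum>\<kappa>\<in>U. a \<kappa> * cos_tensor I \<kappa> x) = (\<Sum>\<kappa>\<in>U. a \<kappa> * L (cos_tensor I \<kappa>))"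
  using U
proof (induction U rule: finite_induct)
  case empty
  have "(\<lambda>x. \<Sum>\<kappa>\<in>{}. a \<kappa> * cos_tensor I \<kappa> x) \<in> sob_tensor I c"
    by (intro cos_tensor_sum_in_sob_tensor I c) auto
  then have "(\<lambda>x. 0) \<in> sob_tensor I c" by simp
  from continuous_functionals_linear[OF L this this, of 0 0]
  show ?case by simp
next
  case (insert \<kappa> U)
  have "(\<lambda>x. \<Sum>\<kappa>\<in>{\<kappa>}. 1 * cos_tensor I \<kappa> x) \<in> sob_tensor I c"
    using insert.prems by (intro cos_tensor_sum_in_sob_tensor I c) auto
  then have 1: "cos_tensor I \<kappa> \<in> sob_tensor I c" by simp
  have 2: "(\<lambda>x. \<Sum>\<kappa>\<in>U. a \<kappa> * cos_tensor I \<kappa> x) \<in> sob_tensor I c"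
    using insert by (intro cos_tensor_sum_in_sob_tensor I c) auto
  have "L (\<lambda>x. a \<kappa> * cos_tensor I \<kappa> x + 1 * (\<Sum>\<kappa>\<in>U. a \<kappa> * cos_tensor I \<kappa> x))
      = a \<kappa> * L (cos_tensor I \<kappa>) + 1 * L (\<lambda>x. \<Sum>\<kappa>\<in>U. a \<kappa> * cos_tensor I \<kappa> x)"
    by (rule continuous_functionals_linear[OF L 1 2])
  then show ?case using insert by simp
qed

lemma
  assumes I: "finite I" and \<kappa>: "\<kappa> \<in> I \<rightarrow>\<^sub>E UNIV" "\<kappa>' \<in> I \<rightarrow>\<^sub>E UNIV"
  shows integrable_cos_tensor_mult: "integrable (box_measure I) (\<lambda>x. cos_tensor I \<kappa> x * cos_tensor I \<kappa>' x)"
    and integral_cos_tensor_mult: "(LINT x|box_measure I. cos_tensor I \<kappa> x * cos_tensor I \<kappa>' x) = (if \<kappa> = \<kappa>' then 1 else 0)"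
proof -
  have f: "tensor_fun I [\<lambda>k. cos_basis (\<kappa> k)] x = cos_tensor I \<kappa> x" for x
    by (simp add: tensor_fun_def cos_tensor_def)
  show "integrable (box_measure I) (\<lambda>x. cos_tensor I \<kappa> x * cos_tensor I \<kappa>' x)"
    using integrable_tensor_fun_cos_tensor[OF I, of "[\<lambda>k. cos_basis (\<kappa> k)]" \<kappa>'] by (simp add: f cos_basis_sobolev1)
  have "tensor_coeff I [\<lambda>k. cos_basis (\<kappa> k)] \<kappa>' = (\<Prod>k\<in>I. if \<kappa> k = \<kappa>' k then 1 else 0)"
    by (simp add: tensor_coeff_def cos_coeff_cos_basis)
  also have "\<dots> = (if \<kappa> = \<kappa>' then 1 else 0)"
    using prod_if_eq_PiE[OF I \<kappa>, of "\<lambda>_. 1"] by simp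
  finally show "(LINT x|box_measure I. cos_tensor I \<kappa> x * cos_tensor I \<kappa>' x) = (if \<kappa> = \<kappa>' then 1 else 0)"
    using integral_tensor_fun_cos_tensor[OF I, of "[\<lambda>k. cos_basis (\<kappa> k)]" \<kappa>'] by (simp add: f cos_basis_sobolev1)
qed

text \<open>In the coordinates of the normalised tensor cosines \<open>h\<close>, a vector
  \<open>b\<close> in the kernel of all \<open>l j\<close> describes a function that the algorithm
  maps to 0 and whose Sobolev norm is at most the length of \<open>b\<close>. The error bound then
  supplies the kernel hypothesis of \<open>trace_lower_bound\<close>. Strictness of the assumption
  allows an actual algorithm to be picked from the infimum.\<close>

lemma minimal_error_lower_bound:
  fixes I :: "'i set"
  assumes I: "finite I" "I \<noteq> {}" and c: "\<And>k. k \<in> I \<Longrightarrow> c k > 0" and U: "finite U" "U \<subseteq> I \<rightarrow>\<^sub>E UNIV"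
    and \<delta>: "\<delta> \<ge> 0" "\<And>\<kappa>. \<kappa> \<in> U \<Longrightarrow> \<delta> \<le> inverse (tensor_weight I c \<kappa>)" and E: "E > 0"
    and err: "minimal_error (sob_tensor I c) (sob_tensor_norm I c) (box_measure I) n < ereal E"
  shows "(real (card U) - real n) * \<delta> \<le> E\<^sup>2"
proof -
  have w: "tensor_weight I c \<kappa> > 0" for \<kappa> using c by (rule tensor_weight_pos)
  obtain A where A: "A \<in> linear_algorithms (sob_tensor I c) (sob_tensor_norm I c) (box_measure I) n"
    and sup: "(SUP f \<in> {f \<in> sob_tensor I c. sob_tensor_norm I c f \<le> 1}. Linf_norm (box_measure I) (\<lambda>x. f x - A f x)) < ereal E"
    using err unfolding minimal_error_def INF_less_iff by blast
  obtain L g where L: "\<And>j. j \<in> {1..n} \<Longrightarrow> L j \<in> continuous_functionals (sob_tensor I c) (sob_tensor_norm I c)"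
    and Aeq: "A = (\<lambda>f x. \<Sum>j=1..n. L j f * g j x)"
    using A unfolding linear_algorithms_def by blast
  define h where "h = (\<lambda>\<kappa> x. cos_tensor I \<kappa> x / sqrt (tensor_weight I c \<kappa>))"
  define l where "l = (\<lambda>j \<kappa>. L j (cos_tensor I \<kappa>) / sqrt (tensor_weight I c \<kappa>))"
  show ?thesis
  proof (rule trace_lower_bound[where h = h and l = l and m = "\<lambda>\<kappa>. inverse (tensor_weight I c \<kappa>)" and M = "box_measure I"])
    fix b assume ker: "\<forall>j\<in>{1..n}. dot U (l j) b = 0"
    define s where "s = sqrt (dot U b b)"
    show "AE x in box_measure I. \<bar>dot U b (\<lambda>\<kappa>. h \<kappa> x)\<bar> \<le> E * sqrt (dot U b b)"
    proof (cases "dot U b b = 0")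
      case True
      then have "\<forall>\<kappa>\<in>U. b \<kappa> = 0"
        using U unfolding dot_def by (subst (asm) sum_nonneg_eq_0_iff) auto
      then show ?thesis using E by (simp add: dot_def)
    next
      case False
      then have s: "s > 0" "s\<^sup>2 = dot U b b" using dot_self_nonneg[of U b] by (auto simp: s_def)
      \<comment> \<open>Division by \<open>s\<close> brings the function into the unit ball;
        division by the root of the weight passes from \<open>h\<close> to the unnormalised tensor
        cosines.\<close>
      define a where "a = (\<lambda>\<kappa>. b \<kappa> / s / sqrt (tensor_weight I c \<kappa>))"
      define f where "f = (\<lambda>x. \<Sum>\<kappa>\<in>U. a \<kappa> * cos_tensor I \<kappa> x)"
      have f: "f \<in> sob_tensor I c" unfolding f_def by (intro cos_tensor_sum_in_sob_tensor I c U)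
      have "sob_tensor_norm I c f \<le> sqrt (\<Sum>\<kappa>\<in>U. (a \<kappa>)\<^sup>2 * tensor_weight I c \<kappa>)"
        unfolding f_def by (intro sob_tensor_norm_cos_tensor_sum_le I c U)
      also have "(\<Sum>\<kappa>\<in>U. (a \<kappa>)\<^sup>2 * tensor_weight I c \<kappa>) = (\<Sum>\<kappa>\<in>U. b \<kappa> * b \<kappa> / s\<^sup>2)"
      proof (rule sum.cong[OF refl])
        fix \<kappa>
        have "(a \<kappa>)\<^sup>2 = b \<kappa> * b \<kappa> / s\<^sup>2 / tensor_weight I c \<kappa>"
          using w[of \<kappa>] by (simp add: a_def power_divide power_mult_distrib power2_eq_square[of "b \<kappa>"])
        then show "(a \<kappa>)\<^sup>2 * tensor_weight I c \<kappa> = b \<kappa> * b \<kappa> / s\<^sup>2" using w[of \<kappa>] by simp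
      qed
      also have "\<dots> = 1" using s False by (simp add: sum_divide_distrib[symmetric] dot_def[symmetric])
      finally have nf: "sob_tensor_norm I c f \<le> 1" by simp
      have Lf: "L j f = 0" if j: "j \<in> {1..n}" for j
      proof -
        have "L j f = (\<Sum>\<kappa>\<in>U. a \<kappa> * L j (cos_tensor I \<kappa>))"
          unfolding f_def by (rule continuous_functional_cos_tensor_sum[OF I c U L[OF j]])
        also have "\<dots> = dot U (l j) b / s"
          unfolding dot_def sum_divide_distrib by (intro sum.cong refl) (simp add: a_def l_def mult_ac)
        finally show ?thesis using ker j by simp
      qed
      have "Linf_norm (box_measure I) (\<lambda>x. f x - A f x) < ereal E"
        using f nf by (intro le_less_trans[OF SUP_upper sup]) auto
      \<comment> \<open>All functionals vanish on \<open>f\<close>, so its error is \<open>f\<close>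
        itself.\<close>
      moreover have "(\<lambda>x. f x - A f x) = f" using Lf by (simp add: Aeq)
      ultimately have lt: "esssup (box_measure I) (\<lambda>x. ereal \<bar>f x\<bar>) < ereal E" by (simp add: Linf_norm_def)
      have "AE x in box_measure I. ereal \<bar>f x\<bar> \<le> esssup (box_measure I) (\<lambda>x. ereal \<bar>f x\<bar>)"
        by (rule esssup_AE)
      then show ?thesis
      proof (rule eventually_mono)
        fix x assume "ereal \<bar>f x\<bar> \<le> esssup (box_measure I) (\<lambda>x. ereal \<bar>f x\<bar>)"
        then have "ereal \<bar>f x\<bar> < ereal E" using lt by (rule le_less_trans)
        then have fx: "\<bar>f x\<bar> \<le> E" by simp
        have "dot U b (\<lambda>\<kappa>. h \<kappa> x) = s * f x"
          unfolding dot_def f_def sum_distrib_left using s by (intro sum.cong refl) (simp add: a_def h_def)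
        then have "\<bar>dot U b (\<lambda>\<kappa>. h \<kappa> x)\<bar> = s * \<bar>f x\<bar>" using s by (simp add: abs_mult)
        also have "\<dots> \<le> s * E" using fx s by (intro mult_left_mono) auto
        finally show "\<bar>dot U b (\<lambda>\<kappa>. h \<kappa> x)\<bar> \<le> E * sqrt (dot U b b)" by (simp add: s_def mult.commute)
      qed
    qed
  next
    fix \<kappa> \<kappa>' assume \<kappa>: "\<kappa> \<in> U" "\<kappa>' \<in> U"
    have hh: "h \<kappa> x * h \<kappa>' x = inverse (sqrt (tensor_weight I c \<kappa>) * sqrt (tensor_weight I c \<kappa>')) * (cos_tensor I \<kappa> x * cos_tensor I \<kappa>' x)" for x
      by (simp add: h_def divide_inverse mult_ac)
    show "integrable (box_measure I) (\<lambda>x. h \<kappa> x * h \<kappa>' x)"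
      unfolding hh using \<kappa> U by (intro integrable_mult_right integrable_cos_tensor_mult I) auto
    have "(LINT x|box_measure I. h \<kappa> x * h \<kappa>' x) =
       inverse (sqrt (tensor_weight I c \<kappa>) * sqrt (tensor_weight I c \<kappa>')) * (if \<kappa> = \<kappa>' then 1 else 0)"
      unfolding hh integral_mult_right_zero using \<kappa> U by (subst integral_cos_tensor_mult[OF I(1)]) auto
    then show "(LINT x|box_measure I. h \<kappa> x * h \<kappa>' x) = (if \<kappa> = \<kappa>' then inverse (tensor_weight I c \<kappa>) else 0)"
      using w[of \<kappa>] by (auto simp flip: inverse_mult_distrib)
  qed (use I U \<delta> E prob_space_box_measure in auto)
qed

subsection \<open>Summability of the weights from tractability\<close>

text \<open>Dyadic layers: the layer between \<open>2 powr (- real (Suc i))\<close> and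
  \<open>2 powr (- real i)\<close> has at most \<open>B * 2 powr (\<sigma> * real (Suc i))\<close>
  elements, each contributing at most \<open>2 powr (- real i * \<tau>)\<close>. The sum is
  dominated by a geometric series with ratio \<open>2 powr (\<sigma> - \<tau>)\<close>.\<close>

lemma layer_sum_powr_le:
  fixes f :: "'a \<Rightarrow> real"
  assumes V: "finite V" and f: "\<And>v. v \<in> V \<Longrightarrow> 0 < f v" "\<And>v. v \<in> V \<Longrightarrow> f v \<le> 1"
    and \<sigma>: "\<sigma> < \<tau>" "0 \<le> \<tau>" and B: "0 \<le> B"
    and card: "\<And>\<delta>. 0 < \<delta> \<Longrightarrow> \<delta> \<le> 1 \<Longrightarrow> real (card {v \<in> V. \<delta> < f v}) \<le> B * \<delta> powr (- \<sigma>)"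
  shows "(\<Sum>v\<in>V. f v powr \<tau>) \<le> B * (2 powr \<sigma> / (1 - 2 powr (\<sigma> - \<tau>)))"
proof -
  have "\<forall>v\<in>V. \<exists>i::nat. 2 powr (- real (Suc i)) < f v \<and> f v \<le> 2 powr (- real i)"
  proof
    fix v assume v: "v \<in> V"
    define P where "P = (\<lambda>n::nat. 2 powr (- real n) < f v)"
    obtain n where "(1/2)^n < f v" using real_arch_pow_inv[OF f(1)[OF v], of "1/2"] by auto
    \<comment> \<open>The layer index is one less than the least such \<open>n\<close>, which is not
      0 because \<open>f v \<le> 1\<close>.\<close>
    then have "P n" by (simp add: P_def powr_minus powr_realpow power_one_over inverse_eq_divide)
    then have L: "P (LEAST n. P n)" by (rule LeastI)
    then have "(LEAST n. P n) \<noteq> 0" using f(2)[OF v] unfolding P_def by (intro notI) simp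
    then obtain i where i: "(LEAST n. P n) = Suc i" using not0_implies_Suc by blast
    then have "\<not> P i" using not_less_Least[of i P] by simp
    then show "\<exists>i::nat. 2 powr (- real (Suc i)) < f v \<and> f v \<le> 2 powr (- real i)"
      using L i unfolding P_def by (intro exI[of _ i]) auto
  qed
  then obtain g where g: "\<And>v. v \<in> V \<Longrightarrow> 2 powr (- real (Suc (g v))) < f v"
      "\<And>v. v \<in> V \<Longrightarrow> f v \<le> 2 powr (- real (g v))" by metis
  define J where "J = Suc (Max (insert 0 (g ` V)))"
  have gJ: "g ` V \<subseteq> {..<J}"
  proof
    fix i assume "i \<in> g ` V"
    then have "i \<le> Max (insert 0 (g ` V))" using V by (intro Max_ge) auto
    then show "i \<in> {..<J}" by (simp add: J_def)
  qed
  define x where "x = (2::real) powr (\<sigma> - \<tau>)"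
  have x: "0 < x" "x < 1" using \<sigma> by (auto simp: x_def powr_less_one)
  have "(\<Sum>v\<in>V. f v powr \<tau>) \<le> (\<Sum>v\<in>V. 2 powr (- real (g v) * \<tau>))"
  proof (rule sum_mono)
    fix v assume v: "v \<in> V"
    have "f v powr \<tau> \<le> (2 powr (- real (g v))) powr \<tau>"
      using g(2)[OF v] f(1)[OF v] \<sigma> by (intro powr_mono2) auto
    then show "f v powr \<tau> \<le> 2 powr (- real (g v) * \<tau>)" by (simp add: powr_powr)
  qed
  also have "\<dots> = (\<Sum>i<J. \<Sum>v\<in>{v \<in> V. g v = i}. 2 powr (- real (g v) * \<tau>))"
    using V gJ by (intro sum.group[symmetric]) auto
  also have "\<dots> \<le> (\<Sum>i<J. B * 2 powr \<sigma> * x ^ i)"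
  proof (rule sum_mono)
    fix i
    have "(\<Sum>v\<in>{v \<in> V. g v = i}. 2 powr (- real (g v) * \<tau>)) = real (card {v \<in> V. g v = i}) * 2 powr (- real i * \<tau>)"
      by simp
    also have "\<dots> \<le> (B * (2 powr (- real (Suc i))) powr (- \<sigma>)) * 2 powr (- real i * \<tau>)"
    proof (rule mult_right_mono)
      have "card {v \<in> V. g v = i} \<le> card {v \<in> V. 2 powr (- real (Suc i)) < f v}"
        using V g(1) by (intro card_mono) auto
      also have "real \<dots> \<le> B * (2 powr (- real (Suc i))) powr (- \<sigma>)"
      proof (rule card)
        have "2 powr (- real (Suc i)) \<le> (2::real) powr 0" by (rule powr_mono) auto
        then show "2 powr (- real (Suc i)) \<le> (1::real)" by simp
      qed simp
      finally show "real (card {v \<in> V. g v = i}) \<le> B * (2 powr (- real (Suc i))) powr (- \<sigma>)" by simp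
    qed simp
    also have "\<dots> = B * 2 powr \<sigma> * x ^ i"
    proof -
      have "(2 powr (- real (Suc i))) powr (- \<sigma>) * 2 powr (- real i * \<tau>) = (2::real) powr (\<sigma> + (\<sigma> - \<tau>) * real i)"
        unfolding powr_powr powr_add[symmetric] by (simp add: algebra_simps)
      also have "\<dots> = 2 powr \<sigma> * x ^ i"
        by (simp add: powr_add x_def powr_powr[symmetric] powr_realpow)
      finally show ?thesis by (simp add: mult_ac)
    qed
    finally show "(\<Sum>v\<in>{v \<in> V. g v = i}. 2 powr (- real (g v) * \<tau>)) \<le> B * 2 powr \<sigma> * x ^ i" .
  qed
  also have "\<dots> = B * 2 powr \<sigma> * (\<Sum>i<J. x ^ i)" by (simp add: sum_distrib_left)
  also have "\<dots> \<le> B * 2 powr \<sigma> * (1 / (1 - x))"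
  proof (rule mult_left_mono)
    have "(\<Sum>i<J. x ^ i) \<le> (\<Sum>i. x ^ i)" using x by (intro sum_le_suminf summable_geometric) auto
    then show "(\<Sum>i<J. x ^ i) \<le> 1 / (1 - x)" using x by (simp add: suminf_geometric)
  qed (use B in simp)
  finally show ?thesis by (simp add: x_def)
qed

text \<open>A converse to \<open>1 + x \<le> exp x\<close> on the unit interval, used to recover a
  sum from a bounded product.\<close>

lemma exp_half_le:
  fixes x :: real
  assumes "0 \<le> x" "x \<le> 1"
  shows "exp (x / 2) \<le> 1 + x"
proof -
  have "exp (x / 2) \<le> 1 + x / 2 + (x / 2)\<^sup>2" using assms by (intro exp_bound) auto
  also have "(x / 2)\<^sup>2 \<le> 1 * (x / 2)" unfolding power2_eq_square using assms by (intro mult_right_mono) auto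
  finally show ?thesis by simp
qed

text \<open>A finite bound rules out the empty set, and a nonempty set of extended naturals attains
  its infimum.\<close>

lemma info_complexity_leE:
  assumes "ereal_of_enat (info_complexity \<gamma> \<epsilon> d) \<le> ereal b"
  obtains n where "unif_error \<gamma> n d \<le> ereal \<epsilon>" "real n \<le> b"
proof -
  let ?A = "{enat n |n. unif_error \<gamma> n d \<le> ereal \<epsilon>}"
  have ne: "?A \<noteq> {}"
  proof
    assume "?A = {}"
    then have "info_complexity \<gamma> \<epsilon> d = \<infinity>" unfolding info_complexity_def by (simp add: Inf_enat_def)
    then show False using assms by simp
  qed
  have "Inf ?A \<in> ?A"
    unfolding Inf_enat_def if_not_P[OF ne] by (rule LeastI_ex) (use ne in blast)
  then obtain n where "Inf ?A = enat n" "unif_error \<gamma> n d \<le> ereal \<epsilon>" by blast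
  then show ?thesis using that assms unfolding info_complexity_def by simp
qed

text \<open>The count of large inverse weights is governed by \<open>\<epsilon> powr (- p)\<close>
  and \<open>\<epsilon>\<^sup>2 / \<delta>\<close>. Balancing them leads to the exponent
  \<open>\<sigma>\<close>, and \<open>\<tau>\<close> is the midpoint between \<open>\<sigma>\<close>
  and 1, so the layer sum converges while \<open>\<tau>\<close> remains below 1.\<close>

lemma sum_inverse_weight_powr_le:
  fixes I :: "'i set"
  assumes I: "finite I" "I \<noteq> {}" and c: "\<And>k. k \<in> I \<Longrightarrow> c k > 0" and p: "p > 0" and K: "K \<ge> 0"
    and err: "\<And>\<epsilon>. 0 < \<epsilon> \<Longrightarrow> \<epsilon> \<le> 1 \<Longrightarrow> \<exists>n. minimal_error (sob_tensor I c) (sob_tensor_norm I c) (box_measure I) n \<le> ereal \<epsilon>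
        \<and> real n \<le> K * \<epsilon> powr (- p)"
  defines "\<sigma> \<equiv> p / (p + 2)" and "\<tau> \<equiv> (p + 1) / (p + 2)"
  shows "(\<Sum>k\<in>I. inverse (cos_weight (c k) 1) powr \<tau>) \<le> 2 * ln ((K + 4) * (2 powr \<sigma> / (1 - 2 powr (\<sigma> - \<tau>))))"
proof -
  have \<sigma>\<tau>: "0 < \<sigma>" "\<sigma> < \<tau>" "\<tau> < 1" using p by (auto simp: \<sigma>_def \<tau>_def divide_strict_right_mono)
  define f where "f = (\<lambda>\<kappa>. inverse (tensor_weight I c \<kappa>))"
  \<comment> \<open>Frequencies 0 and 1 suffice: over this set the sum factorises into the terms
    \<open>1 + t k powr \<tau>\<close>.\<close>
  define V where "V = I \<rightarrow>\<^sub>E {..<2::nat}"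
  define Z where "Z = 2 powr \<sigma> / (1 - 2 powr (\<sigma> - \<tau>))"
  define t where "t = (\<lambda>k. inverse (cos_weight (c k) 1))"
  have V: "finite V" using I by (simp add: V_def finite_PiE)
  have f0: "f \<kappa> > 0" for \<kappa> using tensor_weight_pos[of I c] c by (simp add: f_def)
  have f1: "f \<kappa> \<le> 1" for \<kappa>
  proof -
    have "1 \<le> tensor_weight I c \<kappa>" using c cos_weight_ge_1 by (intro prod_ge_1) auto
    then show ?thesis by (simp add: f_def inverse_le_1_iff)
  qed
  have "(\<Sum>\<kappa>\<in>V. f \<kappa> powr \<tau>) \<le> (K + 4) * Z"
    unfolding Z_def
  proof (rule layer_sum_powr_le[OF V f0 f1])
    fix \<delta> :: real assume \<delta>: "0 < \<delta>" "\<delta> \<le> 1"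
    define U where "U = {\<kappa> \<in> V. \<delta> < f \<kappa>}"
    \<comment> \<open>With this choice \<open>\<epsilon> powr (- p)\<close> and
      \<open>\<epsilon>\<^sup>2 / \<delta>\<close> both equal
      \<open>\<delta> powr (- \<sigma>)\<close>.\<close>
    define \<epsilon> where "\<epsilon> = \<delta> powr (1 / (p + 2))"
    have \<epsilon>: "0 < \<epsilon>" "\<epsilon> \<le> 1" using \<delta> p by (auto simp: \<epsilon>_def powr_le1)
    have e1: "\<epsilon> powr (- p) = \<delta> powr (- \<sigma>)" by (simp add: \<epsilon>_def \<sigma>_def powr_powr)
    have e2: "\<epsilon>\<^sup>2 / \<delta> = \<delta> powr (- \<sigma>)"
    proof -
      have "\<epsilon>\<^sup>2 / \<delta> = \<delta> powr (2 / (p + 2)) / \<delta> powr 1"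
        using \<delta> \<epsilon> by (simp add: \<epsilon>_def powr_powr flip: powr_numeral)
      also have "\<dots> = \<delta> powr (2 / (p + 2) - 1)" by (simp only: powr_diff)
      also have "2 / (p + 2) - 1 = - \<sigma>" using p by (simp add: \<sigma>_def field_simps)
      finally show ?thesis .
    qed
    obtain n where n: "minimal_error (sob_tensor I c) (sob_tensor_norm I c) (box_measure I) n \<le> ereal \<epsilon>"
      "real n \<le> K * \<epsilon> powr (- p)" using err[OF \<epsilon>] by blast
    have "V \<subseteq> I \<rightarrow>\<^sub>E UNIV" unfolding V_def by (intro PiE_mono) auto
    then have U: "finite U" "U \<subseteq> I \<rightarrow>\<^sub>E UNIV" using V by (auto simp: U_def)
    \<comment> \<open>Doubling the error makes the inequality strict as the lower bound demands; its
      square is the source of the 4 in \<open>K + 4\<close>.\<close>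
    have "(real (card U) - real n) * \<delta> \<le> (2 * \<epsilon>)\<^sup>2"
    proof (rule minimal_error_lower_bound[OF I c U])
      show "minimal_error (sob_tensor I c) (sob_tensor_norm I c) (box_measure I) n < ereal (2 * \<epsilon>)"
        using n(1) by (rule le_less_trans) (use \<epsilon> in simp)
    qed (use \<delta> \<epsilon> in \<open>auto simp: U_def f_def\<close>)
    then have "real (card U) - real n \<le> 4 * (\<epsilon>\<^sup>2 / \<delta>)"
      using \<delta> by (simp add: pos_le_divide_eq power_mult_distrib)
    then show "real (card {\<kappa> \<in> V. \<delta> < f \<kappa>}) \<le> (K + 4) * \<delta> powr (- \<sigma>)"
      using n(2) unfolding e1 e2 U_def by (simp add: distrib_right)
  qed (use \<sigma>\<tau> K in auto)
  moreover have "(\<Sum>\<kappa>\<in>V. f \<kappa> powr \<tau>) = (\<Prod>k\<in>I. 1 + t k powr \<tau>)"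
  proof -
    have "f \<kappa> powr \<tau> = (\<Prod>k\<in>I. inverse (cos_weight (c k) (\<kappa> k)) powr \<tau>)" for \<kappa>
      by (simp add: f_def prod_powr_distrib[symmetric] prod_inversef[symmetric] o_def)
    then have "(\<Sum>\<kappa>\<in>V. f \<kappa> powr \<tau>) = (\<Prod>k\<in>I. \<Sum>m<2. inverse (cos_weight (c k) m) powr \<tau>)"
      unfolding V_def using I by (subst prod_sum_PiE) auto
    then show ?thesis by (simp add: numeral_2_eq_2 t_def cos_weight_def)
  qed
  moreover have "exp ((\<Sum>k\<in>I. t k powr \<tau>) / 2) \<le> (\<Prod>k\<in>I. 1 + t k powr \<tau>)"
  proof -
    have "exp ((\<Sum>k\<in>I. t k powr \<tau>) / 2) = (\<Prod>k\<in>I. exp (t k powr \<tau> / 2))"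
      using I by (simp add: exp_sum sum_divide_distrib)
    also have "\<dots> \<le> (\<Prod>k\<in>I. 1 + t k powr \<tau>)"
    proof (intro prod_mono conjI exp_half_le)
      fix k assume k: "k \<in> I"
      have "0 < t k" "t k \<le> 1" using cos_weight_ge_1[OF c[OF k], of 1] by (auto simp: t_def inverse_le_1_iff)
      then show "t k powr \<tau> \<le> 1" using \<sigma>\<tau> by (intro powr_le1) auto
    qed auto
    finally show ?thesis .
  qed
  ultimately have *: "exp ((\<Sum>k\<in>I. t k powr \<tau>) / 2) \<le> (K + 4) * Z" by linarith
  then have "0 < (K + 4) * Z" by (rule less_le_trans[OF exp_gt_zero])
  then have "(\<Sum>k\<in>I. t k powr \<tau>) / 2 \<le> ln ((K + 4) * Z)" using * by (subst ln_ge_iff) auto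
  then show ?thesis by (simp add: t_def Z_def)
qed

text \<open>The factor \<open>K d\<close> may grow with the dimension, so that both kinds of
  tractability are instances.\<close>

lemma weight_sum_le_ln:
  assumes pos: "\<And>d j. 1 \<le> j \<Longrightarrow> j \<le> d \<Longrightarrow> 0 < \<gamma> d j" and bd: "\<And>d j. 1 \<le> j \<Longrightarrow> j \<le> d \<Longrightarrow> \<gamma> d j \<le> C"
    and p: "p > 0" and K: "\<And>d. K d \<ge> 0"
    and N: "\<And>\<epsilon> d. \<epsilon> \<in> {0<..1} \<Longrightarrow> d \<ge> 1 \<Longrightarrow> ereal_of_enat (info_complexity \<gamma> \<epsilon> d) \<le> ereal (K d * \<epsilon> powr (- p))"
  obtains \<tau> a b where "0 \<le> \<tau>" "\<tau> < 1" "a > 0" "b > 0"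
    "\<And>d. d \<ge> 1 \<Longrightarrow> (\<Sum>j=1..d. \<gamma> d j powr \<tau>) \<le> a * ln ((K d + 4) * b)"
proof -
  define \<sigma> where "\<sigma> = p / (p + 2)"
  define \<tau> where "\<tau> = (p + 1) / (p + 2)"
  have \<sigma>\<tau>: "0 < \<sigma>" "\<sigma> < \<tau>" "\<tau> < 1" using p by (auto simp: \<sigma>_def \<tau>_def divide_strict_right_mono)
  define b where "b = (2::real) powr \<sigma> / (1 - 2 powr (\<sigma> - \<tau>))"
  have b: "b > 0" using \<sigma>\<tau> by (simp add: b_def powr_less_one)
  \<comment> \<open>The inverse weight of frequency 1 is
    \<open>\<gamma> d j / (\<gamma> d j + pi\<^sup>2)\<close>, so \<open>D\<close> bounds the ratio
    of the weight to it.\<close>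
  define D where "D = C + pi\<^sup>2"
  have C: "C > 0" using pos[of 1 1] bd[of 1 1] by linarith
  have D: "D > 0" using C by (simp add: D_def add_pos_pos)
  show ?thesis
  proof (rule that[of \<tau> "D powr \<tau> * 2" b])
    fix d :: nat assume d: "d \<ge> 1"
    have "(\<Sum>j=1..d. \<gamma> d j powr \<tau>) \<le> (\<Sum>j=1..d. D powr \<tau> * inverse (cos_weight (\<gamma> d j) 1) powr \<tau>)"
    proof (rule sum_mono)
      fix j assume j: "j \<in> {1..d}"
      have g: "0 < \<gamma> d j" "\<gamma> d j \<le> C" using pos bd j by auto
      have "\<gamma> d j = (\<gamma> d j + pi\<^sup>2) * inverse (cos_weight (\<gamma> d j) 1)"
      proof -
        have "cos_weight (\<gamma> d j) 1 = (\<gamma> d j + pi\<^sup>2) / \<gamma> d j" using g by (simp add: cos_weight_def field_simps)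
        moreover have "\<gamma> d j + pi\<^sup>2 > 0" using g by (simp add: add_pos_pos)
        ultimately show ?thesis using g by simp
      qed
      also have "\<dots> \<le> D * inverse (cos_weight (\<gamma> d j) 1)"
        using g cos_weight_ge_1[OF g(1), of 1] by (intro mult_right_mono) (auto simp: D_def)
      finally have "\<gamma> d j powr \<tau> \<le> (D * inverse (cos_weight (\<gamma> d j) 1)) powr \<tau>"
        using g \<sigma>\<tau> by (intro powr_mono2) auto
      then show "\<gamma> d j powr \<tau> \<le> D powr \<tau> * inverse (cos_weight (\<gamma> d j) 1) powr \<tau>" by (simp only: powr_mult)
    qed
    also have "\<dots> = D powr \<tau> * (\<Sum>j=1..d. inverse (cos_weight (\<gamma> d j) 1) powr \<tau>)" by (simp add: sum_distrib_left)
    also have "\<dots> \<le> D powr \<tau> * (2 * ln ((K d + 4) * b))"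
      unfolding b_def \<sigma>_def \<tau>_def
    proof (intro mult_left_mono sum_inverse_weight_powr_le)
      fix \<epsilon> :: real assume "0 < \<epsilon>" "\<epsilon> \<le> 1"
      then have "ereal_of_enat (info_complexity \<gamma> \<epsilon> d) \<le> ereal (K d * \<epsilon> powr (- p))" using N d by simp
      then obtain n where "unif_error \<gamma> n d \<le> ereal \<epsilon>" "real n \<le> K d * \<epsilon> powr (- p)"
        by (rule info_complexity_leE)
      then show "\<exists>n. minimal_error (sob_tensor {1..d} (\<gamma> d)) (sob_tensor_norm {1..d} (\<gamma> d)) (box_measure {1..d}) n \<le> ereal \<epsilon>
        \<and> real n \<le> K d * \<epsilon> powr (- p)" unfolding unif_error_eq by blast
    qed (use d pos K p in auto)
    finally show "(\<Sum>j=1..d. \<gamma> d j powr \<tau>) \<le> D powr \<tau> * 2 * ln ((K d + 4) * b)" by simp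
  qed (use \<sigma>\<tau> D b in auto)
qed

section \<open>Sum exponents below 1 from the two tractability notions\<close>

lemma sum_exponent_if_strongly_tractable:
  assumes pos: "\<And>d j. 1 \<le> j \<Longrightarrow> j \<le> d \<Longrightarrow> 0 < \<gamma> d j" and bd: "\<And>d j. 1 \<le> j \<Longrightarrow> j \<le> d \<Longrightarrow> \<gamma> d j \<le> C"
    and tr: "strongly_polynomially_tractable (info_complexity \<gamma>)"
  shows "sum_exponent_p \<gamma> < 1"
proof -
  obtain K p where K: "K > 0" "p > 0"
    and N: "\<And>\<epsilon> d. \<epsilon> \<in> {0<..1} \<Longrightarrow> d \<ge> 1 \<Longrightarrow> ereal_of_enat (info_complexity \<gamma> \<epsilon> d) \<le> ereal (K * \<epsilon> powr (- p))"
    using tr unfolding strongly_polynomially_tractable_def by blast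
  obtain \<tau> a b where \<tau>: "0 \<le> \<tau>" "\<tau> < 1" "a > 0" "b > 0"
    and le: "\<And>d. d \<ge> 1 \<Longrightarrow> (\<Sum>j=1..d. \<gamma> d j powr \<tau>) \<le> a * ln ((K + 4) * b)"
    using weight_sum_le_ln[where K = "\<lambda>_. K", OF pos bd K(2) less_imp_le[OF K(1)] N] by blast
  \<comment> \<open>The characterisation of the exponent asks for a nonnegative bound, and the
    logarithm may be negative.\<close>
  have "\<forall>d\<ge>1. (\<Sum>j=1..d. \<gamma> d j powr \<tau>) \<le> max 0 (a * ln ((K + 4) * b))"
    using le by (meson max.coboundedI2)
  then show ?thesis unfolding sum_exponent_p_less_1_iff using \<tau> by (meson max.cobounded1)
qed

lemma sum_exponent_if_tractable:
  assumes pos: "\<And>d j. 1 \<le> j \<Longrightarrow> j \<le> d \<Longrightarrow> 0 < \<gamma> d j" and bd: "\<And>d j. 1 \<le> j \<Longrightarrow> j \<le> d \<Longrightarrow> \<gamma> d j \<le> C"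
    and tr: "polynomially_tractable (info_complexity \<gamma>)"
  shows "sum_exponent_q \<gamma> < 1"
proof -
  obtain K p q where K: "K > 0" "p > 0" "q \<ge> 0"
    and N0: "\<And>\<epsilon> d. \<epsilon> \<in> {0<..1} \<Longrightarrow> d \<ge> 1 \<Longrightarrow> ereal_of_enat (info_complexity \<gamma> \<epsilon> d) \<le> ereal (K * \<epsilon> powr (- p) * real d powr q)"
    using tr unfolding polynomially_tractable_def by blast
  have N: "ereal_of_enat (info_complexity \<gamma> \<epsilon> d) \<le> ereal (K * real d powr q * \<epsilon> powr (- p))"
    if "\<epsilon> \<in> {0<..1}" "d \<ge> 1" for \<epsilon> d
    using N0[OF that] by (simp add: mult_ac)
  have K0: "0 \<le> K * real d powr q" for d using K by simp
  obtain \<tau> a b where \<tau>: "0 \<le> \<tau>" "\<tau> < 1" "a > 0" "b > 0"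
    and le: "\<And>d. d \<ge> 1 \<Longrightarrow> (\<Sum>j=1..d. \<gamma> d j powr \<tau>) \<le> a * ln ((K * real d powr q + 4) * b)"
    using weight_sum_le_ln[where K = "\<lambda>d. K * real d powr q", OF pos bd K(2) K0 N] by blast
  \<comment> \<open>Since \<open>ln (real d + 1) \<ge> ln 2\<close>, dividing by \<open>ln 2\<close>
    turns the additive constant into a multiple of \<open>ln (real d + 1)\<close>.\<close>
  define B where "B = a * (\<bar>ln ((K + 4) * b)\<bar> / ln 2 + q)"
  have "B \<ge> 0" using \<tau> K by (simp add: B_def)
  moreover have "(\<Sum>j=1..d. \<gamma> d j powr \<tau>) \<le> B * ln (real d + 1)" if d: "d \<ge> 1" for d
  proof -
    have dq: "1 \<le> real d powr q" using d K by (simp add: ge_one_powr_ge_zero)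
    \<comment> \<open>The power of \<open>d\<close> is at least 1 and can be factored out of the
      whole sum, where the logarithm separates it.\<close>
    have "(K * real d powr q + 4) * b \<le> (K * real d powr q + 4 * real d powr q) * b"
      using dq \<tau> by (intro mult_right_mono) auto
    also have "\<dots> = (K + 4) * b * real d powr q" by (simp add: algebra_simps)
    finally have "ln ((K * real d powr q + 4) * b) \<le> ln ((K + 4) * b * real d powr q)"
      using K0[of d] \<tau> dq d by (subst ln_le_cancel_iff) (auto intro!: mult_pos_pos add_nonneg_pos simp: K(1) less_imp_le add_pos_pos)
    also have "\<dots> = ln ((K + 4) * b) + q * ln (real d)"
      using K \<tau> d by (simp add: ln_mult ln_powr)
    also have "\<dots> \<le> \<bar>ln ((K + 4) * b)\<bar> / ln 2 * ln (real d + 1) + q * ln (real d + 1)"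
    proof (rule add_mono)
      have "ln 2 \<le> ln (real d + 1)" using d by simp
      then have "\<bar>ln ((K + 4) * b)\<bar> / ln 2 * ln 2 \<le> \<bar>ln ((K + 4) * b)\<bar> / ln 2 * ln (real d + 1)"
        by (intro mult_left_mono) auto
      then show "ln ((K + 4) * b) \<le> \<bar>ln ((K + 4) * b)\<bar> / ln 2 * ln (real d + 1)" by simp
      show "q * ln (real d) \<le> q * ln (real d + 1)" using d K by (intro mult_left_mono) auto
    qed
    finally have "a * ln ((K * real d powr q + 4) * b) \<le> a * (\<bar>ln ((K + 4) * b)\<bar> / ln 2 * ln (real d + 1) + q * ln (real d + 1))"
      using \<tau> by (intro mult_left_mono) auto
    then show ?thesis using le[OF d] by (simp add: B_def distrib_right mult.assoc)
  qed
  ultimately show ?thesis unfolding sum_exponent_q_less_1_iff using \<tau> by blast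
qed

theorem theorem4p18:
  fixes \<gamma> :: "nat \<Rightarrow> nat \<Rightarrow> real" and C\<^sub>\<gamma> :: real
  assumes bounded: "\<And>d. d \<ge> 1 \<Longrightarrow> \<gamma> d 1 \<le> C\<^sub>\<gamma>"
    and ordered: "\<And>d. antimono_on {1..d} (\<gamma> d)"
    and positive: "\<And>d. d \<ge> 1 \<Longrightarrow> \<gamma> d d > 0"
  shows "(polynomially_tractable (info_complexity \<gamma>) \<longleftrightarrow> sum_exponent_q \<gamma> < 1) \<and>
         (strongly_polynomially_tractable (info_complexity \<gamma>) \<longleftrightarrow> sum_exponent_p \<gamma> < 1)"
proof -
  have pos: "0 < \<gamma> d j" if "1 \<le> j" "j \<le> d" for d j
    using monotone_onD[OF ordered[of d], of j d] positive[of d] that by auto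
  have bd: "\<gamma> d j \<le> C\<^sub>\<gamma>" if "1 \<le> j" "j \<le> d" for d j
    using monotone_onD[OF ordered[of d], of 1 j] bounded[of d] that by auto
  show ?thesis
    using tractable_if_sum_exponent[of \<gamma>, OF pos bd] sum_exponent_if_tractable[of \<gamma>, OF pos bd]
      strongly_tractable_if_sum_exponent[of \<gamma>, OF pos bd] sum_exponent_if_strongly_tractable[of \<gamma>, OF pos bd] by blast
qed

end
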